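(* Let $\mathfrak g$ be a real semi-simple Lie algebra. Consider the dual space $(\mathfrak g^*,P)$ with its linear (Lie–)Poisson structure, and endow $\mathfrak g^*$ with the (pseudo-)Riemannian metric $K^*$ induced by the Killing form $K$ on $\mathfrak g$. Let $M=\mathfrak g^*_{reg}$ be the (open and dense) submanifold of $\mathfrak g^*$ of co-adjoint orbits (symplectic leaves) of $*$-regular elements. Then the restriction of $K^*$ to each orbit in $M$ has constant signature and is non-degenerate. The $K^*$-orthogonal distribution $\mathcal N$ to the symplectic leaves is integrable. Maximal integral submanifolds of $\mathcal N$ are images under the identification $i_K:\mathfrak g\equiv\mathfrak g^*$ of (the regular parts of) Cartan subalgebras of $\mathfrak g$.
   Context: The Killing form is $K(x,y)=\operatorname{Tr}(\operatorname{ad}(x)\circ\operatorname{ad}(y))$. Since $\mathfrak g$ is semi-simple, $K$ is non-degenerate and gives an isomorphism $i_K:\mathfrak g\to\mathfrak g^*$; $K^*$ is the constant metric on the vector space $\mathfrak g^*$ corresponding to $K$ under $i_K$. If $\{e_\mu\}$ is a basis of $\mathfrak g$ with $[e_\mu,e_\nu]=c^\sigma_{\mu\nu}e_\sigma$ and $\lambda_\nu=\langle\lambda,e_\nu\rangle$ are the corresponding linear coordinates on $\mathfrak g^*$, the linear Poisson structure is $P^{\mu\nu}(\lambda)=\{\lambda_\mu,\lambda_\nu\}=c^\sigma_{\mu\nu}\lambda_\sigma$; its symplectic leaves are the co-adjoint orbits of a connected Lie group $G$ with Lie algebra $\mathfrak g$. An element $X\in\mathfrak g$ is regular if it is semi-simple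 (i.e. $\operatorname{ad}(X)$ is semi-simple) with centralizer of minimal dimension; the set of regular elements is denoted $\mathfrak g'$, and the regular part of a Cartan subalgebra $\mathfrak j$ is $\mathfrak j\cap\mathfrak g'$. An element $\lambda\in\mathfrak g^*$ is $*$-regular if $X_\lambda=i_K^{-1}\lambda$ is regular in $\mathfrak g$. $\mathcal N$ is the distribution on $M$ of $K^*$-orthogonal complements of the tangent spaces of the co-adjoint orbits. *)

theory Defs
  imports "HOL-Analysis.Analysis"
begin

text \<open>
  A finite-dimensional real Lie algebra is a bracket on a Euclidean space. The inner product of
  the carrier plays no role beyond fixing the standard topology and providing a basis.
\<close>

definition lie_algebra :: "('a::euclidean_space \<Rightarrow> 'a \<Rightarrow> 'a) \<Rightarrow> bool" where
  "lie_algebra br \<longleftrightarrow> bilinear br \<and> (\<forall>x. br x x = 0) \<and>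
     (\<forall>x y z. br x (br y z) + br y (br z x) + br z (br x y) = 0)"

definition lie_ideal :: "('a::euclidean_space \<Rightarrow> 'a \<Rightarrow> 'a) \<Rightarrow> 'a set \<Rightarrow> bool" where
  "lie_ideal br I \<longleftrightarrow> subspace I \<and> (\<forall>x. \<forall>y\<in>I. br x y \<in> I)"

definition lie_subalgebra :: "('a::euclidean_space \<Rightarrow> 'a \<Rightarrow> 'a) \<Rightarrow> 'a set \<Rightarrow> bool" where
  "lie_subalgebra br H \<longleftrightarrow> subspace H \<and> (\<forall>x\<in>H. \<forall>y\<in>H. br x y \<in> H)"

definition bracket_span :: "('a::euclidean_space \<Rightarrow> 'a \<Rightarrow> 'a) \<Rightarrow> 'a set \<Rightarrow> 'a set \<Rightarrow> 'a set" where
  "bracket_span br A B = span {br x y | x y. x \<in> A \<and> y \<in> B}"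

definition lie_solvable :: "('a::euclidean_space \<Rightarrow> 'a \<Rightarrow> 'a) \<Rightarrow> 'a set \<Rightarrow> bool" where
  "lie_solvable br H \<longleftrightarrow> (\<exists>n. ((\<lambda>J. bracket_span br J J) ^^ n) H = {0})"

definition lie_nilpotent :: "('a::euclidean_space \<Rightarrow> 'a \<Rightarrow> 'a) \<Rightarrow> 'a set \<Rightarrow> bool" where
  "lie_nilpotent br H \<longleftrightarrow> (\<exists>n. ((\<lambda>J. bracket_span br H J) ^^ n) H = {0})"

definition semisimple_lie_algebra :: "('a::euclidean_space \<Rightarrow> 'a \<Rightarrow> 'a) \<Rightarrow> bool" where
  "semisimple_lie_algebra br \<longleftrightarrow> lie_algebra br \<and>
     (\<forall>I. lie_ideal br I \<and> lie_solvable br I \<longrightarrow> I = {0})"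

definition cartan_subalgebra :: "('a::euclidean_space \<Rightarrow> 'a \<Rightarrow> 'a) \<Rightarrow> 'a set \<Rightarrow> bool" where
  "cartan_subalgebra br H \<longleftrightarrow> lie_subalgebra br H \<and> lie_nilpotent br H \<and>
     {x. \<forall>y\<in>H. br x y \<in> H} = H"

text \<open>Over the reals: diagonalizable after complexification.\<close>

definition semisimple_endo :: "('a::euclidean_space \<Rightarrow> 'a) \<Rightarrow> bool" where
  "semisimple_endo f \<longleftrightarrow> linear f \<and>
     (\<forall>V. subspace V \<and> f ` V \<subseteq> V \<longrightarrow>
        (\<exists>W. subspace W \<and> f ` W \<subseteq> W \<and> V \<inter> W = {0} \<and> {v + w | v w. v \<in> V \<and> w \<in> W} = UNIV))"

definition centralizer :: "('a::euclidean_space \<Rightarrow> 'a \<Rightarrow> 'a) \<Rightarrow> 'a \<Rightarrow> 'a set" where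
  "centralizer br x = {y. br x y = 0}"

definition regular_elements :: "('a::euclidean_space \<Rightarrow> 'a \<Rightarrow> 'a) \<Rightarrow> 'a set" where
  "regular_elements br =
     {x. semisimple_endo (br x) \<and> (\<forall>y. dim (centralizer br x) \<le> dim (centralizer br y))}"

definition trace_endo :: "('a::euclidean_space \<Rightarrow> 'a) \<Rightarrow> real" where
  "trace_endo f = (\<Sum>b\<in>Basis. f b \<bullet> b)"

definition killing :: "('a::euclidean_space \<Rightarrow> 'a \<Rightarrow> 'a) \<Rightarrow> 'a \<Rightarrow> 'a \<Rightarrow> real" where
  "killing br x y = trace_endo (br x \<circ> br y)"

definition killing_iso :: "('a::euclidean_space \<Rightarrow> 'a \<Rightarrow> 'a) \<Rightarrow> 'a \<Rightarrow> ('a \<Rightarrow>\<^sub>L real)" where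
  "killing_iso br x = Blinfun (killing br x)"

definition killing_dual ::
    "('a::euclidean_space \<Rightarrow> 'a \<Rightarrow> 'a) \<Rightarrow> ('a \<Rightarrow>\<^sub>L real) \<Rightarrow> ('a \<Rightarrow>\<^sub>L real) \<Rightarrow> real" where
  "killing_dual br \<mu> \<nu> = killing br (inv (killing_iso br) \<mu>) (inv (killing_iso br) \<nu>)"

definition star_regular :: "('a::euclidean_space \<Rightarrow> 'a \<Rightarrow> 'a) \<Rightarrow> ('a \<Rightarrow>\<^sub>L real) \<Rightarrow> bool" where
  "star_regular br \<xi> \<longleftrightarrow> inv (killing_iso br) \<xi> \<in> regular_elements br"

text \<open>
  The linear Poisson bivector at \<open>\<xi>\<close>, evaluated on covectors, i.e. on elements of the Lie
  algebra; on basis vectors it is \<open>P\<^sup>\<mu>\<^sup>\<nu>(\<xi>) = c\<^sup>\<sigma>\<^sub>\<mu>\<^sub>\<nu> \<xi>\<^sub>\<sigma>\<close>. The values of the Hamiltonian vector fields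
  at \<open>\<xi>\<close> form the characteristic subspace, which is tangent to the symplectic leaf.
\<close>

definition lie_poisson ::
    "('a::euclidean_space \<Rightarrow> 'a \<Rightarrow> 'a) \<Rightarrow> ('a \<Rightarrow>\<^sub>L real) \<Rightarrow> 'a \<Rightarrow> 'a \<Rightarrow> real" where
  "lie_poisson br \<xi> x y = blinfun_apply \<xi> (br x y)"

definition poisson_characteristic ::
    "('a::euclidean_space \<Rightarrow> 'a \<Rightarrow> 'a) \<Rightarrow> ('a \<Rightarrow>\<^sub>L real) \<Rightarrow> ('a \<Rightarrow>\<^sub>L real) set" where
  "poisson_characteristic br \<xi> = range (\<lambda>x. Blinfun (lie_poisson br \<xi> x))"

text \<open>
  For every connected Lie group with the given Lie algebra, the image of the adjoint
  representation is the group generated by the exponentials of the inner derivations.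
\<close>

definition endo_exp :: "('a::euclidean_space \<Rightarrow> 'a) \<Rightarrow> 'a \<Rightarrow> 'a" where
  "endo_exp f y = (\<Sum>n. (f ^^ n) y /\<^sub>R fact n)"

inductive_set adjoint_group :: "('a::euclidean_space \<Rightarrow> 'a \<Rightarrow> 'a) \<Rightarrow> ('a \<Rightarrow> 'a) set"
  for br :: "'a \<Rightarrow> 'a \<Rightarrow> 'a" where
  "id \<in> adjoint_group br"
| "g \<in> adjoint_group br \<Longrightarrow> endo_exp (br x) \<circ> g \<in> adjoint_group br"

text \<open>
  The co-adjoint action of \<open>g\<close> is composition with the inverse of \<open>Ad g\<close>; the orbit is the
  same without the inverse, because the adjoint group is closed under inverses.
\<close>

definition coadjoint_orbit ::
    "('a::euclidean_space \<Rightarrow> 'a \<Rightarrow> 'a) \<Rightarrow> ('a \<Rightarrow>\<^sub>L real) \<Rightarrow> ('a \<Rightarrow>\<^sub>L real) set" where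
  "coadjoint_orbit br \<xi> = {Blinfun (blinfun_apply \<xi> \<circ> g) | g. g \<in> adjoint_group br}"

definition regular_dual :: "('a::euclidean_space \<Rightarrow> 'a \<Rightarrow> 'a) \<Rightarrow> ('a \<Rightarrow>\<^sub>L real) set" where
  "regular_dual br = (\<Union>\<xi>\<in>{\<xi>. star_regular br \<xi>}. coadjoint_orbit br \<xi>)"

definition nondegenerate_on :: "('b::real_vector \<Rightarrow> 'b \<Rightarrow> real) \<Rightarrow> 'b set \<Rightarrow> bool" where
  "nondegenerate_on B V \<longleftrightarrow> (\<forall>u\<in>V. (\<forall>v\<in>V. B u v = 0) \<longrightarrow> u = 0)"

text \<open>The positive and the negative index of inertia.\<close>

definition signature_on :: "('b::real_vector \<Rightarrow> 'b \<Rightarrow> real) \<Rightarrow> 'b set \<Rightarrow> nat \<times> nat" where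
  "signature_on B V =
     (Max {dim W | W. subspace W \<and> W \<subseteq> V \<and> (\<forall>w\<in>W - {0}. B w w > 0)},
      Max {dim W | W. subspace W \<and> W \<subseteq> V \<and> (\<forall>w\<in>W - {0}. B w w < 0)})"

primrec Ck_on :: "nat \<Rightarrow> 'b::real_normed_vector set \<Rightarrow> ('b \<Rightarrow> 'c::real_normed_vector) \<Rightarrow> bool" where
  "Ck_on 0 U f \<longleftrightarrow> continuous_on U f"
| "Ck_on (Suc k) U f \<longleftrightarrow> (\<forall>x\<in>U. f differentiable (at x)) \<and>
     (\<forall>v. Ck_on k U (\<lambda>x. frechet_derivative f (at x) v))"

text \<open>Intended for open subsets \<open>U\<close> of finite-dimensional spaces.\<close>

definition smooth_on :: "'b::real_normed_vector set \<Rightarrow> ('b \<Rightarrow> 'c::real_normed_vector) \<Rightarrow> bool" where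
  "smooth_on U f \<longleftrightarrow> (\<forall>k. Ck_on k U f)"

text \<open>Embedded: locally flattened onto a linear subspace by an ambient diffeomorphism.\<close>

definition embedded_submanifold :: "'b::real_normed_vector set \<Rightarrow> bool" where
  "embedded_submanifold S \<longleftrightarrow>
     (\<forall>p\<in>S. \<exists>U (\<Phi> :: 'b \<Rightarrow> 'b) \<Psi> V. open U \<and> p \<in> U \<and> open (\<Phi> ` U) \<and>
        smooth_on U \<Phi> \<and> smooth_on (\<Phi> ` U) \<Psi> \<and> (\<forall>x\<in>U. \<Psi> (\<Phi> x) = x) \<and>
        subspace V \<and> \<Phi> ` (S \<inter> U) = \<Phi> ` U \<inter> V)"

text \<open>
  An injectively immersed submanifold is given by its own topology \<open>T\<close>, with underlying set
  \<open>topspace T\<close>, which may be finer than the subspace topology; locally it is embedded. The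
  topology is automatically Hausdorff, and second countable if it is connected
  (Poincare-Volterra).
\<close>

definition immersed_submanifold :: "'b::real_normed_vector topology \<Rightarrow> bool" where
  "immersed_submanifold T \<longleftrightarrow>
     (\<forall>p\<in>topspace T. \<exists>U. openin T U \<and> p \<in> U \<and> subtopology T U = top_of_set U \<and>
        embedded_submanifold U)"

text \<open>
  Velocities at \<open>p\<close> of smooth curves in the submanifold. Orbits of Lie group actions are initial
  submanifolds, so for them \<open>T\<close> may be taken to be the subspace topology.
\<close>

definition tangent_space :: "'b::real_normed_vector topology \<Rightarrow> 'b \<Rightarrow> 'b set" where
  "tangent_space T p =
     {v. \<exists>\<gamma> e. e > 0 \<and> smooth_on {-e<..<e::real} \<gamma> \<and>
        continuous_map (top_of_set {-e<..<e}) T \<gamma> \<and> \<gamma> 0 = p \<and>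
        (\<gamma> has_vector_derivative v) (at 0)}"

definition smooth_distribution ::
    "('b::real_normed_vector \<Rightarrow> 'b set) \<Rightarrow> 'b set \<Rightarrow> bool" where
  "smooth_distribution D M \<longleftrightarrow>
     (\<exists>k. \<forall>p\<in>M. subspace (D p) \<and> dim (D p) = k) \<and>
     (\<forall>p\<in>M. \<exists>U F. open U \<and> p \<in> U \<and> U \<subseteq> M \<and> finite F \<and> (\<forall>X\<in>F. smooth_on U X) \<and>
        (\<forall>q\<in>U. D q = span ((\<lambda>X. X q) ` F)))"

definition integral_submanifold ::
    "('b::real_normed_vector \<Rightarrow> 'b set) \<Rightarrow> 'b set \<Rightarrow> 'b topology \<Rightarrow> bool" where
  "integral_submanifold D M T \<longleftrightarrow> immersed_submanifold T \<and> topspace T \<subseteq> M \<and>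
     (\<forall>p\<in>topspace T. tangent_space T p = D p)"

definition integrable_distribution ::
    "('b::real_normed_vector \<Rightarrow> 'b set) \<Rightarrow> 'b set \<Rightarrow> bool" where
  "integrable_distribution D M \<longleftrightarrow> smooth_distribution D M \<and>
     (\<forall>p\<in>M. \<exists>T. integral_submanifold D M T \<and> p \<in> topspace T)"

definition maximal_integral_submanifold ::
    "('b::real_normed_vector \<Rightarrow> 'b set) \<Rightarrow> 'b set \<Rightarrow> 'b topology \<Rightarrow> bool" where
  "maximal_integral_submanifold D M T \<longleftrightarrow>
     integral_submanifold D M T \<and> connected_space T \<and> topspace T \<noteq> {} \<and>
     (\<forall>T'. integral_submanifold D M T' \<and> connected_space T' \<and> topspace T \<subseteq> topspace T'
        \<longrightarrow> topspace T' = topspace T)"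

definition orbit_tangent ::
    "('a::euclidean_space \<Rightarrow> 'a \<Rightarrow> 'a) \<Rightarrow> ('a \<Rightarrow>\<^sub>L real) \<Rightarrow> ('a \<Rightarrow>\<^sub>L real) set" where
  "orbit_tangent br \<xi> = tangent_space (top_of_set (coadjoint_orbit br \<xi>)) \<xi>"

definition normal_distribution ::
    "('a::euclidean_space \<Rightarrow> 'a \<Rightarrow> 'a) \<Rightarrow> ('a \<Rightarrow>\<^sub>L real) \<Rightarrow> ('a \<Rightarrow>\<^sub>L real) set" where
  "normal_distribution br \<xi> = {\<mu>. \<forall>\<nu>\<in>orbit_tangent br \<xi>. killing_dual br \<mu> \<nu> = 0}"

definition cartan_image ::
    "('a::euclidean_space \<Rightarrow> 'a \<Rightarrow> 'a) \<Rightarrow> 'a set \<Rightarrow> ('a \<Rightarrow>\<^sub>L real) set" where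
  "cartan_image br H = killing_iso br ` (H \<inter> regular_elements br)"

end

theory Submission
  imports Defs "HOL-Computational_Algebra.Fundamental_Theorem_Algebra"
    "HOL-Computational_Algebra.Field_as_Ring" "HOL-Computational_Algebra.Polynomial_Factorial"
begin

text \<open>The argument rests on the elements whose Fitting null component, the generalized null space of \<open>ad x\<close>, has
  minimal dimension. They form a dense open set by perturbation theory. By Engel's theorem, trace identities
  for the weights of \<open>ad x\<close> on the complexification and non-degeneracy of \<open>K\<close>, the null component of such an \<open>x\<close>
  is abelian and \<open>ad x\<close> is semisimple. Hence these elements are exactly the regular ones, and \<open>C(x)\<close> is a Cartan
  subalgebra with \<open>g = C(x) + [x, g]\<close>, an orthogonal sum for \<open>K\<close>.

  Under \<open>i\<^sub>K\<close> the tangent space of the orbit of \<open>x\<close> becomes \<open>[x, g]\<close>: along a curve in the orbit \<open>p(ad y(t)) = 0\<close>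
  for a fixed polynomial \<open>p\<close> with simple roots, so the \<open>C(x)\<close>-component of the velocity is central. Therefore the
  normal distribution is \<open>x \<mapsto> C(x)\<close>. It has a local frame which is constant along curves tangent to it, so
  \<open>C(x)\<close> is locally constant on an integral submanifold. This identifies the maximal
  ones with the components of the regular parts of Cartan subalgebras; invariance of domain shows that they
  carry the subspace topology.\<close>

section \<open>Traces of endomorphisms\<close>

text \<open>Semisimplicity together with a minimal centralizer shows neither openness nor density.
  The null component does: it is the kernel of \<open>br x ^^ DIM('a)\<close>, which is polynomial
  in x, so its dimension is upper semicontinuous and attains its minimum at all but finitely many
  points of any line through a point of minimality. The price is that semisimplicity has to be
  derived from minimality.

  The trace identities rest on one observation. Multiplying each weight space of ad x by the
  conjugate of its weight is again a derivation, since weights add under the bracket and conjugation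
  is additive. Composed with ad x it has as trace the sum of |l|^2 times the traces of the weight
  projections, a sum of nonnegative terms.

  For the tangent spaces the obstacle is that a smooth curve in an orbit comes with no smooth lift
  to the group: a conjugating automorphism is only known to exist for each parameter separately. A
  polynomial identity satisfied on the whole orbit can be differentiated without a lift.\<close>

lemma trace_endo_add: "trace_endo (\<lambda>x. f x + g x) = trace_endo f + trace_endo g"
  by (simp add: trace_endo_def inner_add_left sum.distrib)

lemma trace_endo_diff: "trace_endo (\<lambda>x. f x - g x) = trace_endo f - trace_endo g"
  by (simp add: trace_endo_def inner_diff_left sum_subtractf)

lemma trace_endo_scale: "trace_endo (\<lambda>x. c *\<^sub>R f x) = c * trace_endo f"
  by (simp add: trace_endo_def sum_distrib_left)

lemma trace_endo_zero [simp]: "trace_endo (\<lambda>x. 0) = 0"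
  by (simp add: trace_endo_def)

lemma trace_endo_sum: "trace_endo (\<lambda>x. \<Sum>i\<in>I. f i x) = (\<Sum>i\<in>I. trace_endo (f i))"
  unfolding trace_endo_def inner_sum_left by (rule sum.swap)

lemma trace_endo_commute:
  fixes f g :: "'a::euclidean_space \<Rightarrow> 'a"
  assumes "linear f" "linear g"
  shows "trace_endo (\<lambda>x. f (g x)) = trace_endo (\<lambda>x. g (f x))"
proof -
  have expand: "trace_endo (\<lambda>x. f (g x)) = (\<Sum>b\<in>Basis. \<Sum>c\<in>Basis. (g b \<bullet> c) * (f c \<bullet> b))"
    if "linear f" for f g :: "'a \<Rightarrow> 'a"
  proof -
    have "f (g b) \<bullet> b = (\<Sum>c\<in>Basis. (g b \<bullet> c) * (f c \<bullet> b))" for b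
    proof -
      have "f (g b) = f (\<Sum>c\<in>Basis. (g b \<bullet> c) *\<^sub>R c)"
        by (simp add: euclidean_representation)
      also have "\<dots> = (\<Sum>c\<in>Basis. (g b \<bullet> c) *\<^sub>R f c)"
        using that by (simp add: linear_sum linear_scale)
      finally show ?thesis by (simp add: inner_sum_left)
    qed
    then show ?thesis by (simp add: trace_endo_def)
  qed
  show ?thesis
    unfolding expand[OF assms(1)] expand[OF assms(2)]
    by (subst sum.swap) (simp add: mult.commute)
qed

lemma linear_funpow:
  fixes f :: "'a::real_vector \<Rightarrow> 'a"
  assumes "linear f" shows "linear (f ^^ n)"
proof (induction n)
  case (Suc n)
  then show ?case using linear_compose[OF Suc assms] by (simp add: o_def)
qed (simp add: linear_id[unfolded id_def])

lemma funpow_commute: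
  assumes "\<And>x. f (g x) = g (f x)"
  shows "(f ^^ n) (g x) = g ((f ^^ n) x)"
  by (induction n) (auto simp: assms)

lemma funpow_add_apply: "(f ^^ (m + n)) x = (f ^^ m) ((f ^^ n) x)"
  by (simp add: funpow_add)

lemma linear_funpow_zero_mono:
  fixes f :: "'a::real_vector \<Rightarrow> 'a"
  assumes "linear f" "(f ^^ m) x = 0" "m \<le> n"
  shows "(f ^^ n) x = 0"
proof -
  have "(f ^^ n) x = (f ^^ (n - m)) ((f ^^ m) x)"
    using assms(3) by (simp flip: funpow_add_apply)
  then show ?thesis
    using assms linear_0[OF linear_funpow[OF assms(1)]] by simp
qed

lemma linear_pseudo_inverse:
  fixes f :: "'a::real_vector \<Rightarrow> 'b::real_vector"
  assumes "linear f"
  obtains h where "linear h" "\<And>x. f (h (f x)) = f x"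
  using linear_exists_right_inverse_on[OF assms subspace_UNIV] by auto

text \<open>Factoring \<open>f = f \<circ> \<pi>\<close> with \<open>\<pi>\<close> killing the kernel of \<open>f\<close>, the map \<open>\<pi> \<circ> f\<close> has the same trace
  and a smaller nilpotency index.\<close>

lemma trace_endo_nilpotent:
  fixes f :: "'a::euclidean_space \<Rightarrow> 'a"
  assumes "linear f" "\<And>x. (f ^^ n) x = 0"
  shows "trace_endo f = 0"
proof -
  have "trace_endo f = 0" if "linear f" "\<And>x. (f ^^ Suc n) x = 0" for f :: "'a \<Rightarrow> 'a"
    using that
  proof (induction n arbitrary: f)
    case 0
    then have "f = (\<lambda>x. 0)" by auto
    then show ?case by simp
  next
    case (Suc n)
    obtain h where h: "linear h" "\<And>x. f (h (f x)) = f x"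
      using linear_pseudo_inverse[OF Suc.prems(1)] by blast
    define p where "p x = h (f x)" for x
    have p: "linear p" "\<And>x. f (p x) = f x"
      unfolding p_def using h linear_compose[OF Suc.prems(1) h(1)] by (auto simp: o_def)
    define g where "g x = p (f x)" for x
    have lg: "linear g"
      unfolding g_def using linear_compose[OF Suc.prems(1) p(1)] by (simp add: o_def)
    have gk: "(g ^^ k) (p x) = p ((f ^^ k) x)" for k x
      by (induction k) (auto simp: g_def p(2))
    have "(g ^^ Suc n) x = 0" for x
    proof -
      have "(g ^^ Suc n) x = (g ^^ n) (p (f x))"
        unfolding funpow_Suc_right by (simp add: g_def)
      also have "\<dots> = h ((f ^^ (Suc (Suc n))) x)"
        unfolding gk by (simp add: p_def funpow_swap1)
      finally show ?thesis using Suc.prems(2) h(1) by (simp add: linear_0 del: funpow.simps)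
    qed
    then have "trace_endo g = 0" by (rule Suc.IH[OF lg])
    moreover have "trace_endo f = trace_endo g"
      using trace_endo_commute[OF Suc.prems(1) p(1)] by (simp add: g_def[abs_def] p(2))
    ultimately show ?case by simp
  qed
  moreover have "(f ^^ Suc n) x = 0" for x
    by (rule linear_funpow_zero_mono[OF assms(1) assms(2)]) simp
  ultimately show ?thesis using assms(1) by blast
qed

text \<open>The last property combines self-adjointness and idempotence; it turns the trace of the
  projection into a sum of squares.\<close>

lemma orthogonal_projection_exists:
  fixes S :: "'a::euclidean_space set"
  assumes "subspace S"
  obtains p where "linear p" "\<And>x. p x \<in> S" "\<And>x. x \<in> S \<Longrightarrow> p x = x"
    "\<And>x y. p x \<bullet> y = p x \<bullet> p y"
proof -
  obtain B where B: "B \<subseteq> S" "pairwise orthogonal B" "\<And>x. x \<in> B \<Longrightarrow> norm x = 1"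
    "independent B" "span B = S"
    using orthonormal_basis_subspace[OF assms] by metis
  have fin: "finite B" using B(4) independent_imp_finite by blast
  have ip: "b \<bullet> c = (if b = c then 1 else 0)" if "b \<in> B" "c \<in> B" for b c
    using B(2,3) that by (auto simp: pairwise_def orthogonal_def dot_square_norm)
  define p where "p x = (\<Sum>b\<in>B. (x \<bullet> b) *\<^sub>R b)" for x
  have lin: "linear p"
    by (rule linearI) (simp_all add: p_def inner_add_left scaleR_add_left sum.distrib scaleR_sum_right)
  have pS: "p x \<in> S" for x
    unfolding p_def using B(1) assms by (intro subspace_sum subspace_mul) auto
  have pb: "p b = b" if "b \<in> B" for b
  proof -
    have "p b = (\<Sum>c\<in>B. if b = c then b else 0)"
      unfolding p_def using that by (intro sum.cong) (auto simp: ip)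
    then show ?thesis using that fin by simp
  qed
  have id: "p x = x" if "x \<in> S" for x
    using linear_eq_on_span[OF lin linear_id, of B x] pb that B(5) by auto
  have orth: "b \<bullet> y = b \<bullet> p y" if "b \<in> B" for b y
  proof -
    have "b \<bullet> p y = (\<Sum>c\<in>B. if b = c then y \<bullet> b else 0)"
      unfolding p_def inner_sum_right using that by (intro sum.cong) (auto simp: ip)
    then show ?thesis using that fin by (simp add: inner_commute)
  qed
  have "p x \<bullet> y = p x \<bullet> p y" for x y
  proof -
    have *: "p x \<bullet> z = (\<Sum>b\<in>B. (x \<bullet> b) * (b \<bullet> z))" for z
      by (simp add: p_def inner_sum_left)
    show ?thesis unfolding *[of y] *[of "p y"] by (rule sum.cong[OF refl]) (metis orth)
  qed
  then show thesis using that[of p] lin pS id by blast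
qed

text \<open>The orthogonal projection p onto the range of e satisfies p e = e and e p = p, so both
  maps have the same trace, and that of p is the sum of |p b|^2 over the basis.\<close>

lemma trace_endo_idempotent:
  fixes e :: "'a::euclidean_space \<Rightarrow> 'a"
  assumes "linear e" "\<And>x. e (e x) = e x"
  shows "trace_endo e \<ge> 0" "trace_endo e = 0 \<Longrightarrow> e x = 0"
proof -
  obtain p where p: "linear p" "\<And>x. p x \<in> range e" "\<And>x. x \<in> range e \<Longrightarrow> p x = x"
    "\<And>x y. p x \<bullet> y = p x \<bullet> p y"
    using orthogonal_projection_exists[OF linear_subspace_image[OF assms(1) subspace_UNIV]] by metis
  have pe: "p (e x) = e x" and ep: "e (p x) = p x" for x
    using p(3)[of "e x"] p(2)[of x] assms(2) by auto
  have tr: "trace_endo e = (\<Sum>b\<in>Basis. p b \<bullet> p b)"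
    using trace_endo_commute[OF p(1) assms(1)] p(4) by (simp add: pe ep trace_endo_def)
  show "trace_endo e \<ge> 0" unfolding tr by (intro sum_nonneg) auto
  assume "trace_endo e = 0"
  then have "p b = 0" if "b \<in> Basis" for b
    using that unfolding tr by (subst (asm) sum_nonneg_eq_0_iff) auto
  then have "p y = 0" for y
    using linear_eq_stdbasis[OF p(1), of "\<lambda>_. 0"] by (simp add: module_hom_zero fun_eq_iff)
  then show "e x = 0" using pe[of x] by simp
qed

section \<open>Complexification\<close>

text \<open>A pair \<open>(x, y)\<close> stands for \<open>x + i y\<close>.\<close>

definition cscale :: "complex \<Rightarrow> 'a::real_vector \<times> 'a \<Rightarrow> 'a \<times> 'a" where
  "cscale z w = (Re z *\<^sub>R fst w - Im z *\<^sub>R snd w, Re z *\<^sub>R snd w + Im z *\<^sub>R fst w)"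

definition clinear :: "('a::real_vector \<times> 'a \<Rightarrow> 'a \<times> 'a) \<Rightarrow> bool" where
  "clinear F \<longleftrightarrow> linear F \<and> (\<forall>z w. F (cscale z w) = cscale z (F w))"

text \<open>On real vectors F has the form A u + \<i> B u, and A and B determine F. This is A; B
  arises in the same way from \<open>cscale (- \<i>) (F w)\<close>.\<close>

definition re_part :: "('a::real_vector \<times> 'a \<Rightarrow> 'a \<times> 'a) \<Rightarrow> 'a \<Rightarrow> 'a" where
  "re_part F u = fst (F (u, 0))"

lemma cscale_simps [simp]:
  "cscale 0 w = 0" "cscale 1 w = w" "cscale z 0 = 0"
  by (auto simp: cscale_def zero_prod_def)

lemma cscale_of_real: "cscale (of_real r) w = r *\<^sub>R w"
  by (auto simp: cscale_def prod_eq_iff)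

lemma cscale_add_left: "cscale (a + b) w = cscale a w + cscale b w"
  by (simp add: cscale_def algebra_simps)

lemma cscale_add_right: "cscale a (v + w) = cscale a v + cscale a w"
  by (simp add: cscale_def algebra_simps)

lemma cscale_diff_right: "cscale a (v - w) = cscale a v - cscale a w"
  by (simp add: cscale_def algebra_simps)

lemma cscale_minus_left: "cscale (- a) w = - cscale a w"
  by (simp add: cscale_def algebra_simps)

lemma cscale_cscale: "cscale a (cscale b w) = cscale (a * b) w"
  by (simp add: cscale_def algebra_simps)

lemma cscale_eq_0_iff: "cscale a w = 0 \<longleftrightarrow> a = 0 \<or> w = 0"
proof -
  have "w = 0" if "cscale a w = 0" "a \<noteq> 0"
  proof -
    have "w = cscale (inverse a) (cscale a w)" unfolding cscale_cscale using that(2) by simp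
    then show ?thesis using that(1) by simp
  qed
  then show ?thesis by auto
qed

lemma cscale_sum_right: "cscale a (\<Sum>i\<in>I. f i) = (\<Sum>i\<in>I. cscale a (f i))"
  by (induction I rule: infinite_finite_induct) (auto simp: cscale_add_right)

lemma clinearD:
  assumes "clinear F"
  shows "linear F" "F (cscale z w) = cscale z (F w)" "F (v + w) = F v + F w" "F (v - w) = F v - F w"
    "F 0 = 0" "F (r *\<^sub>R w) = r *\<^sub>R F w" "F (- w) = - F w"
    "F (\<Sum>i\<in>I. g i) = (\<Sum>i\<in>I. F (g i))"
proof -
  show lin: "linear F" and "F (cscale z w) = cscale z (F w)"
    using assms unfolding clinear_def by blast+
  show "F (v + w) = F v + F w" "F (v - w) = F v - F w" "F 0 = 0" "F (r *\<^sub>R w) = r *\<^sub>R F w" "F (- w) = - F w"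
    "F (\<Sum>i\<in>I. g i) = (\<Sum>i\<in>I. F (g i))"
    using lin by (simp_all only: linear_add linear_diff linear_0 linear_scale linear_neg linear_sum)
qed

lemma clinearI:
  assumes "\<And>v w. F (v + w) = F v + F w" "\<And>z w. F (cscale z w) = cscale z (F w)"
  shows "clinear F"
  unfolding clinear_def
proof (intro conjI allI linearI)
  show "F (r *\<^sub>R w) = r *\<^sub>R F w" for r w
    using assms(2)[of "of_real r" w] by (simp only: cscale_of_real)
qed (rule assms)+

lemma clinear_cscale: "clinear (cscale z)"
  by (rule clinearI) (auto simp: cscale_add_right cscale_cscale mult.commute)

lemma clinear_compose: "clinear F \<Longrightarrow> clinear G \<Longrightarrow> clinear (\<lambda>w. F (G w))"
  by (rule clinearI) (auto simp: clinearD)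

lemma clinear_add: "clinear F \<Longrightarrow> clinear G \<Longrightarrow> clinear (\<lambda>w. F w + G w)"
  by (rule clinearI) (auto simp: clinearD cscale_add_right)

lemma clinear_diff: "clinear F \<Longrightarrow> clinear G \<Longrightarrow> clinear (\<lambda>w. F w - G w)"
  by (rule clinearI) (auto simp: clinearD cscale_diff_right)

lemma clinear_sum: "(\<And>i. i \<in> I \<Longrightarrow> clinear (F i)) \<Longrightarrow> clinear (\<lambda>w. \<Sum>i\<in>I. F i w)"
  by (rule clinearI) (auto simp: clinearD sum.distrib cscale_sum_right intro!: sum.cong)

lemma clinear_map_prod: "linear f \<Longrightarrow> clinear (map_prod f f)"
  by (rule clinearI) (auto simp: cscale_def linear_add linear_diff linear_scale)

lemma linear_re_part: "clinear F \<Longrightarrow> linear (re_part F)"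
proof (rule linearI)
  assume F: "clinear F"
  fix u v :: 'a and r :: real
  have "(u + v, 0) = (u, 0) + (v, 0::'a)" "(r *\<^sub>R u, 0) = r *\<^sub>R (u, 0::'a)" by auto
  then show "re_part F (u + v) = re_part F u + re_part F v" "re_part F (r *\<^sub>R u) = r *\<^sub>R re_part F u"
    using F unfolding re_part_def by (simp_all only: clinearD fst_add fst_scaleR)
qed

text \<open>\<open>trace_endo\<close> is the real trace on pairs. Both diagonal blocks of F equal
  \<open>re_part F\<close>, so it is twice the real part of the complex trace.\<close>

lemma trace_endo_clinear:
  fixes F :: "'a::euclidean_space \<times> 'a \<Rightarrow> 'a \<times> 'a"
  assumes "clinear F"
  shows "trace_endo F = 2 * trace_endo (re_part F)"
proof -
  have "snd (F (0, v)) = re_part F v" for v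
  proof -
    have "(0, v) = cscale \<i> (v, 0)" by (simp add: cscale_def)
    then show ?thesis using assms by (simp add: clinearD re_part_def) (simp add: cscale_def)
  qed
  moreover have "trace_endo F = trace_endo (re_part F) + trace_endo (\<lambda>v. snd (F (0, v)))"
    unfolding trace_endo_def Basis_prod_def re_part_def
    by (subst sum.union_disjoint) (auto simp: sum.reindex inj_on_def inner_prod_def)
  ultimately show ?thesis by simp
qed

lemma clinear_zero_if_re_part:
  assumes "clinear F" "\<And>u. re_part F u = 0" "\<And>u. re_part (\<lambda>w. cscale (- \<i>) (F w)) u = 0"
  shows "F w = 0"
proof -
  have 0: "F (u, 0) = 0" for u
    using assms(2,3)[of u] by (simp add: re_part_def cscale_def prod_eq_iff)
  have "w = (fst w, 0) + cscale \<i> (snd w, 0)" by (simp add: cscale_def)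
  then show ?thesis by (metis 0 assms(1) clinearD(2,3) cscale_simps(3) add_0)
qed

section \<open>Polynomials in an operator and the primary decomposition\<close>

text \<open>The value p(D), computed by Horner's scheme; complex coefficients act through
  \<open>cscale\<close>.\<close>

definition pop :: "('a::real_vector \<times> 'a \<Rightarrow> 'a \<times> 'a) \<Rightarrow> complex poly \<Rightarrow> 'a \<times> 'a \<Rightarrow> 'a \<times> 'a" where
  "pop D p = fold_coeffs (\<lambda>a F w. cscale a w + D (F w)) p (\<lambda>w. 0)"

lemma pop_0 [simp]: "pop D 0 w = 0"
  by (simp add: pop_def)

lemma pop_pCons:
  assumes "clinear D"
  shows "pop D (pCons a p) w = cscale a w + D (pop D p w)"
proof (cases "p = 0 \<and> a = 0")
  case True
  then show ?thesis using assms by (simp add: clinearD)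
next
  case False
  then show ?thesis by (auto simp: pop_def)
qed

lemma clinear_pop:
  assumes D: "clinear D" shows "clinear (pop D p)"
proof (induction p)
  case 0
  show ?case by (rule clinearI) auto
next
  case (pCons a p)
  have "pop D (pCons a p) = (\<lambda>w. cscale a w + D (pop D p w))"
    by (rule ext) (simp add: pop_pCons[OF D])
  then show ?case
    by (simp add: clinear_add[OF clinear_cscale clinear_compose[OF D pCons.IH]])
qed

lemma pop_add:
  assumes "clinear D"
  shows "pop D (p + q) w = pop D p w + pop D q w"
  by (induction p q rule: poly_induct2) (simp_all add: pop_pCons assms clinearD cscale_add_left)

lemma pop_smult:
  assumes "clinear D"
  shows "pop D (smult a p) w = cscale a (pop D p w)"
  by (induction p) (simp_all add: pop_pCons assms clinearD cscale_add_right cscale_cscale)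

lemma pop_diff:
  assumes "clinear D"
  shows "pop D (p - q) w = pop D p w - pop D q w"
proof -
  have "pop D (p - q) w = pop D (p + smult (-1) q) w" by simp
  then show ?thesis by (simp only: pop_add[OF assms] pop_smult[OF assms]) (simp add: cscale_minus_left)
qed

lemma pop_sum:
  assumes "clinear D"
  shows "pop D (\<Sum>i\<in>I. p i) w = (\<Sum>i\<in>I. pop D (p i) w)"
  by (induction I rule: infinite_finite_induct) (auto simp: pop_add assms)

lemma pop_1: "clinear D \<Longrightarrow> pop D 1 w = w"
  by (simp add: one_pCons pop_pCons clinearD)

lemma pop_mult:
  assumes "clinear D"
  shows "pop D (p * q) w = pop D p (pop D q w)"
  by (induction p) (simp_all add: pop_pCons pop_add pop_smult assms clinearD)

lemma pop_linear_power:
  assumes "clinear D"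
  shows "pop D ([:-l, 1:] ^ n) w = ((\<lambda>v. D v - cscale l v) ^^ n) w"
proof (induction n arbitrary: w)
  case (Suc n)
  have "pop D [:-l, 1:] w = D w - cscale l w" for w
    by (simp add: pop_pCons assms clinearD cscale_minus_left)
  then show ?case
    by (simp only: power_Suc pop_mult[OF assms] Suc.IH funpow.simps o_apply)
qed (simp add: pop_1 assms)

lemma pop_commute:
  assumes "clinear D" "clinear F" "\<And>w. F (D w) = D (F w)"
  shows "F (pop D p w) = pop D p (F w)"
  by (induction p) (simp_all add: pop_pCons assms clinearD)

lemma pop_monom: "clinear D \<Longrightarrow> pop D (monom c k) w = cscale c ((D ^^ k) w)"
  by (induction k) (simp_all add: monom_Suc monom_0 pop_pCons clinearD)

lemma pop_in_subspace:
  assumes "clinear D" "subspace S" "\<And>z w. w \<in> S \<Longrightarrow> cscale z w \<in> S" "\<And>w. w \<in> S \<Longrightarrow> D w \<in> S" "w \<in> S"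
  shows "pop D p w \<in> S"
  by (induction p) (auto simp: pop_pCons assms subspace_0 intro!: subspace_add[OF assms(2)] assms(3-5))

text \<open>A vector has more iterates under D than can be independent, and a relation among them is
  a polynomial killing that vector. The product of these polynomials over a basis kills everything,
  because polynomials in D commute.\<close>

lemma annihilating_polynomial:
  fixes D :: "'a::euclidean_space \<times> 'a \<Rightarrow> 'a \<times> 'a"
  assumes D: "clinear D"
  obtains p where "p \<noteq> 0" "\<And>w. pop D p w = 0"
proof -
  have "\<exists>p. p \<noteq> 0 \<and> pop D p w = 0" for w
  proof (cases "inj_on (\<lambda>k. (D ^^ k) w) {..DIM('a \<times> 'a)}")
    \<comment> \<open>Linear dependence is a property of sets of vectors, so a repetition among the
      iterates is treated separately.\<close>
    case False
    then obtain i j where ij: "i \<noteq> j" "(D ^^ i) w = (D ^^ j) w"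
      unfolding inj_on_def by blast
    then have "monom 1 i - monom (1::complex) j \<noteq> 0"
      by (metis coeff_monom eq_iff_diff_eq_0 zero_neq_one)
    then show ?thesis using ij by (intro exI[of _ "monom 1 i - monom 1 j"]) (simp add: pop_diff pop_monom D)
  next
    case True
    let ?v = "\<lambda>k. (D ^^ k) w" and ?I = "{..DIM('a \<times> 'a)}"
    have "card (?v ` ?I) > DIM('a \<times> 'a)" using True by (simp add: card_image)
    then have "dependent (?v ` ?I)" by (intro dependent_biggerset) simp
    then obtain u where u: "\<exists>v\<in>?v ` ?I. u v \<noteq> 0" "(\<Sum>v\<in>?v ` ?I. u v *\<^sub>R v) = 0"
      by (subst (asm) dependent_finite) auto
    then obtain j where j: "j \<in> ?I" "u (?v j) \<noteq> 0" by auto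
    define p where "p = (\<Sum>k\<in>?I. monom (complex_of_real (u (?v k))) k)"
    have "coeff p j = (\<Sum>k\<in>?I. if k = j then complex_of_real (u (?v k)) else 0)"
      unfolding p_def coeff_sum by (simp add: coeff_monom)
    then have "coeff p j = of_real (u (?v j))" using j(1) by simp
    then have "p \<noteq> 0" using j(2) by auto
    moreover have "pop D p w = 0"
      using u(2) True unfolding p_def
      by (simp add: pop_sum pop_monom D cscale_of_real sum.reindex)
    ultimately show ?thesis by blast
  qed
  then obtain p where p: "\<And>w. p w \<noteq> 0" "\<And>w. pop D (p w) w = 0" by metis
  define P where "P = (\<Prod>b\<in>Basis. p b)"
  have "pop D P b = 0" if "b \<in> Basis" for b
  proof -
    have "P = (\<Prod>c\<in>Basis - {b}. p c) * p b"
      unfolding P_def using that by (simp add: prod.remove mult.commute)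
    then show ?thesis using p(2) by (simp add: pop_mult D clinearD clinear_pop)
  qed
  then have "pop D P w = 0" for w
    using linear_eq_stdbasis[OF clinearD(1)[OF clinear_pop[OF D]] linear_zero] by (metis ext)
  moreover have "P \<noteq> 0" unfolding P_def using p(1) by simp
  ultimately show thesis using that by blast
qed

text \<open>The operator \<open>pop D (Q l)\<close> is the projection onto the generalized eigenspace for \<open>l\<close>. For \<open>l \<noteq> 0\<close> it is a
  polynomial in \<open>D\<close> without constant term, so its trace vanishes when the traces of all positive powers of \<open>D\<close> do.\<close>

locale spectral =
  fixes D :: "'a::euclidean_space \<times> 'a \<Rightarrow> 'a \<times> 'a" and \<Lambda> :: "complex set" and N :: nat
    and Q :: "complex \<Rightarrow> complex poly"
  assumes clinear_D: "clinear D" and finite_\<Lambda>: "finite \<Lambda>" and zero_in_\<Lambda>: "0 \<in> \<Lambda>"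
    and Q_0: "\<And>l. l \<in> \<Lambda> \<Longrightarrow> l \<noteq> 0 \<Longrightarrow> poly (Q l) 0 = 0"
    and sum_proj: "\<And>w. (\<Sum>l\<in>\<Lambda>. pop D (Q l) w) = w"
    and ann_proj: "\<And>l w. l \<in> \<Lambda> \<Longrightarrow> ((\<lambda>v. D v - cscale l v) ^^ N) (pop D (Q l) w) = 0"

lemma dvd_prod_pairwise_coprime:
  fixes f :: "'i \<Rightarrow> 'a::{semiring_gcd}"
  assumes "finite S" "\<And>i j. i \<in> S \<Longrightarrow> j \<in> S \<Longrightarrow> i \<noteq> j \<Longrightarrow> coprime (f i) (f j)" "\<And>i. i \<in> S \<Longrightarrow> f i dvd x"
  shows "prod f S dvd x"
  using assms
proof (induction S rule: finite_induct)
  case (insert i S)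
  have "coprime (f i) (prod f S)"
    using insert by (intro prod_coprime_right) auto
  then show ?case using insert by (auto intro!: divides_mult)
qed simp

lemma coprime_linear_poly:
  assumes "a \<noteq> (b::complex)" shows "coprime [:-a, 1:] [:-b, 1:]"
proof (rule coprimeI)
  fix c assume "c dvd [:-a, 1:]" "c dvd [:-b, 1:]"
  then have "c dvd [:-a, 1:] - [:-b, 1:]" by (rule dvd_diff)
  then have "c dvd [:b - a:]" by simp
  moreover have "[:b - a:] dvd 1" using assms by (simp add: is_unit_const_poly_iff dvd_field_iff)
  ultimately show "c dvd 1" using dvd_trans by blast
qed

text \<open>Chinese remaindering for the pairwise coprime factors (X - l)^N: \<open>Q l\<close> is 1
  modulo its own factor and 0 modulo the others, so the sum of all \<open>Q l\<close> is 1 modulo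
  the product e, and e(D) = 0.\<close>

lemma spectral_exists:
  fixes D :: "'a::euclidean_space \<times> 'a \<Rightarrow> 'a \<times> 'a"
  assumes D: "clinear D"
  obtains \<Lambda> N Q where "spectral D \<Lambda> N Q"
proof -
  obtain p where p: "p \<noteq> 0" "\<And>w. pop D p w = 0" using annihilating_polynomial[OF D] by blast
  obtain A where A: "p = smult (lead_coeff p) (\<Prod>x\<in>#A. [:-x, 1:])"
    using alg_closed_imp_factorization[OF p(1)] by blast
  \<comment> \<open>The index 0 is included whether or not it is a root: every other
    \<open>Q l\<close> then has the factor X^N and no constant term.\<close>
  define \<Lambda> where "\<Lambda> = insert 0 (set_mset A)"
  \<comment> \<open>The number of roots bounds every multiplicity; \<open>Suc\<close> keeps the
    exponent positive, so that X divides X^N.\<close>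
  define N where "N = Suc (size A)"
  define e where "e = (\<Prod>x\<in>\<Lambda>. [:-x, 1:] ^ N)"
  have fin: "finite \<Lambda>" by (simp add: \<Lambda>_def)
  have "(\<Prod>x\<in>#B. [:-x, 1:]) dvd (\<Prod>x\<in>\<Lambda>. [:-x, 1:]) ^ size B" if "set_mset B \<subseteq> \<Lambda>" for B
    using that
  proof (induction B)
    case (add x B)
    then have "[:-x, 1:] dvd (\<Prod>x\<in>\<Lambda>. [:-x, 1:])" by (intro dvd_prodI fin) auto
    moreover have "set_mset B \<subseteq> \<Lambda>" using add.prems by auto
    ultimately show ?case using add.IH
      unfolding image_mset_add_mset prod_mset.add_mset size_add_mset power_Suc by (intro mult_dvd_mono)
  qed simp
  from this[of A] have "(\<Prod>x\<in>#A. [:-x, 1:]) dvd (\<Prod>x\<in>\<Lambda>. [:-x, 1:]) ^ N"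
    unfolding N_def \<Lambda>_def by (auto intro: dvd_mult)
  then have "(\<Prod>x\<in>#A. [:-x, 1:]) dvd e" unfolding e_def by (simp add: prod_power_distrib)
  then have "p dvd e" using A p(1) by (metis leading_coeff_0_iff smult_dvd)
  then obtain e' where e': "e = e' * p" by (metis dvdE mult.commute)
  have e0: "pop D e w = 0" for w
    unfolding e' pop_mult[OF D] p(2) by (rule clinearD(5)[OF clinear_pop[OF D]])
  define r where "r l = (\<Prod>x\<in>\<Lambda>-{l}. [:-x, 1:] ^ N)" for l
  have "\<exists>a b. a * [:-l, 1:] ^ N + b * r l = 1" for l
  proof -
    have "coprime ([:-l, 1:] ^ N) (r l)"
      unfolding r_def
      by (rule prod_coprime_right)
        (metis coprime_linear_poly coprime_power_left_iff coprime_power_right_iff Diff_iff singletonI)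
    then show ?thesis
      using bezout_coefficients_fst_snd[of "[:-l, 1:] ^ N" "r l"] by (metis coprime_iff_gcd_eq_1)
  qed
  then obtain a b where ab: "\<And>l. a l * [:-l, 1:] ^ N + b l * r l = 1" by metis
  define Q where "Q l = b l * r l" for l
  have Q0: "poly (Q l) 0 = 0" if "l \<noteq> 0" for l
  proof -
    have "0 \<in> \<Lambda> - {l}" using that by (simp add: \<Lambda>_def)
    then have "[:-0, 1:] ^ N dvd r l" unfolding r_def using fin by (intro dvd_prodI) auto
    then have "poly (r l) 0 = 0" by (auto simp: dvd_def N_def)
    then show ?thesis by (simp add: Q_def)
  qed
  have "e dvd 1 - (\<Sum>m\<in>\<Lambda>. Q m)"
    unfolding e_def
  proof (rule dvd_prod_pairwise_coprime[OF fin])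
    fix l assume l: "l \<in> \<Lambda>"
    have "1 - (\<Sum>m\<in>\<Lambda>. Q m) = (1 - Q l) - (\<Sum>m\<in>\<Lambda>-{l}. Q m)"
      using l fin by (simp add: sum.remove)
    moreover have "1 - Q l = a l * [:-l, 1:] ^ N" unfolding Q_def using ab[of l] by (simp add: algebra_simps)
    moreover have "[:-l, 1:] ^ N dvd Q m" if "m \<in> \<Lambda> - {l}" for m
      unfolding Q_def r_def using that l fin by (intro dvd_mult dvd_prodI) auto
    ultimately show "[:-l, 1:] ^ N dvd 1 - (\<Sum>m\<in>\<Lambda>. Q m)"
      by (metis (no_types, lifting) dvd_diff dvd_sum dvd_triv_right)
  qed (use coprime_linear_poly in \<open>auto simp: coprime_power_left_iff coprime_power_right_iff\<close>)
  then have s: "(\<Sum>l\<in>\<Lambda>. pop D (Q l) w) = w" for w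
  proof -
    obtain e'' where "1 - (\<Sum>m\<in>\<Lambda>. Q m) = e'' * e" using \<open>e dvd _\<close> by (metis dvdE mult.commute)
    then have "pop D (1 - (\<Sum>m\<in>\<Lambda>. Q m)) w = 0"
      by (simp only: pop_mult[OF D] e0) (rule clinearD(5)[OF clinear_pop[OF D]])
    then show ?thesis by (simp add: pop_diff pop_sum pop_1 D)
  qed
  have "pop D ([:-l, 1:] ^ N) (pop D (Q l) w) = 0" if "l \<in> \<Lambda>" for l w
  proof -
    have "[:-l, 1:] ^ N * Q l = b l * e"
      unfolding Q_def e_def r_def using that fin by (simp add: prod.remove mult_ac)
    then show ?thesis by (metis D clinear_pop clinearD(5) e0 pop_mult)
  qed
  then have "spectral D \<Lambda> N Q"
    by unfold_locales (use D fin Q0 s in \<open>auto simp: pop_linear_power \<Lambda>_def\<close>)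
  then show thesis by (rule that)
qed

context spectral
begin

text \<open>For k \<noteq> l the component \<open>pop D (Q k) w\<close> is annihilated by the
  coprime polynomials (X - l)^m and (X - k)^N, hence zero; for k = l it is all that remains of the
  sum. The number l may lie outside \<Lambda>, as a sum of two weights can.\<close>

lemma proj_apply:
  assumes "((\<lambda>v. D v - cscale l v) ^^ m) w = 0" "k \<in> \<Lambda>"
  shows "pop D (Q k) w = (if k = l then w else 0)"
proof -
  have off: "pop D (Q k) w = 0" if "k \<noteq> l" "k \<in> \<Lambda>" for k
  proof -
    let ?u = "pop D (Q k) w"
    have "coprime ([:-l, 1:] ^ m) ([:-k, 1:] ^ N)"
      using coprime_linear_poly[OF that(1)[symmetric]]
      by (metis coprime_power_left_iff coprime_power_right_iff)
    then obtain a b where ab: "a * [:-l, 1:] ^ m + b * [:-k, 1:] ^ N = 1"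
      using bezout_coefficients_fst_snd by (metis coprime_iff_gcd_eq_1)
    have "pop D ([:-l, 1:] ^ m) ?u = pop D (Q k) (pop D ([:-l, 1:] ^ m) w)"
      by (metis clinear_D mult.commute pop_mult)
    then have "pop D ([:-l, 1:] ^ m) ?u = 0"
      using assms(1) by (simp add: pop_linear_power clinear_D clinearD clinear_pop)
    moreover have "pop D ([:-k, 1:] ^ N) ?u = 0"
      using ann_proj that by (simp add: pop_linear_power clinear_D)
    ultimately have "pop D (a * [:-l, 1:] ^ m + b * [:-k, 1:] ^ N) ?u = 0"
      by (simp only: pop_add[OF clinear_D] pop_mult[OF clinear_D] clinearD(5)[OF clinear_pop[OF clinear_D]] add_0)
    then show ?thesis using ab by (simp add: pop_1 clinear_D)
  qed
  show ?thesis
  proof (cases "k = l")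
    case True
    have "w = (\<Sum>j\<in>\<Lambda>. pop D (Q j) w)" using sum_proj by simp
    also have "\<dots> = pop D (Q k) w"
      using assms(2) finite_\<Lambda> off True by (subst sum.remove[of _ k]) auto
    finally show ?thesis using True by simp
  qed (use off assms in auto)
qed

lemma eigen_outside:
  assumes "((\<lambda>v. D v - cscale l v) ^^ m) w = 0" "l \<notin> \<Lambda>"
  shows "w = 0"
proof -
  have "w = (\<Sum>j\<in>\<Lambda>. pop D (Q j) w)" using sum_proj by simp
  also have "\<dots> = 0" using proj_apply[OF assms(1)] assms(2) by (intro sum.neutral) auto
  finally show ?thesis .
qed

lemma proj_proj:
  assumes "k \<in> \<Lambda>" "l \<in> \<Lambda>"
  shows "pop D (Q k) (pop D (Q l) w) = (if k = l then pop D (Q l) w else 0)"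
  using proj_apply[OF ann_proj[OF assms(2)] assms(1)] by simp

end

text \<open>An idempotent of trace 0 vanishes, so no generalized eigenspace for a nonzero eigenvalue
  survives, and D is nilpotent on the one for 0.\<close>

lemma nilpotent_if_power_traces_zero:
  fixes c :: "'a::euclidean_space \<Rightarrow> 'a"
  assumes c: "linear c" and tr: "\<And>k. k \<ge> 1 \<Longrightarrow> trace_endo (c ^^ k) = 0"
  obtains n where "\<And>x. (c ^^ n) x = 0"
proof -
  let ?D = "map_prod c c"
  have D: "clinear ?D" using c by (rule clinear_map_prod)
  obtain \<Lambda> N Q where "spectral ?D \<Lambda> N Q" using spectral_exists[OF D] by blast
  then interpret spectral ?D \<Lambda> N Q .
  have re: "re_part (\<lambda>w. cscale z (map_prod (c ^^ j) (c ^^ j) w)) = (\<lambda>u. Re z *\<^sub>R (c ^^ j) u)" for z j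
    using linear_0[OF linear_funpow[OF c]] by (auto simp: re_part_def cscale_def)
  \<comment> \<open>The factor \<open>c ^^ j\<close> with j \<ge> 1 encodes the missing constant
    term: peeling off a coefficient of p only raises j.\<close>
  have trp: "trace_endo (\<lambda>w. map_prod (c ^^ j) (c ^^ j) (pop ?D p w)) = 0" if "j \<ge> 1" for j p
    using that
  proof (induction p arbitrary: j)
    case 0
    then show ?case using linear_0[OF linear_funpow[OF c]]
      by (simp add: zero_prod_def) (simp flip: zero_prod_def)
  next
    case (pCons a p)
    have cj: "clinear (map_prod (c ^^ j) (c ^^ j))" by (intro clinear_map_prod linear_funpow c)
    have "(\<lambda>w. map_prod (c ^^ j) (c ^^ j) (pop ?D (pCons a p) w)) =
       (\<lambda>w. cscale a (map_prod (c ^^ j) (c ^^ j) w) + map_prod (c ^^ Suc j) (c ^^ Suc j) (pop ?D p w))"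
    proof
      fix w
      have "map_prod (c ^^ j) (c ^^ j) (?D v) = map_prod (c ^^ Suc j) (c ^^ Suc j) v" for v
        by (cases v) (simp only: map_prod_simp funpow_Suc_right o_apply)
      then show "map_prod (c ^^ j) (c ^^ j) (pop ?D (pCons a p) w) =
         cscale a (map_prod (c ^^ j) (c ^^ j) w) + map_prod (c ^^ Suc j) (c ^^ Suc j) (pop ?D p w)"
        by (simp only: pop_pCons[OF D] clinearD(2,3)[OF cj])
    qed
    moreover have "trace_endo (\<lambda>w. cscale a (map_prod (c ^^ j) (c ^^ j) w)) = 0"
      using tr[OF pCons.prems]
      by (simp add: trace_endo_clinear clinear_compose[OF clinear_cscale cj] re trace_endo_scale del: funpow.simps)
    ultimately show ?case using pCons.IH[of "Suc j"] by (simp add: trace_endo_add del: funpow.simps)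
  qed
  have "pop ?D (Q l) w = 0" if l: "l \<in> \<Lambda>" "l \<noteq> 0" for l w
  proof -
    obtain p where p: "Q l = pCons 0 p"
      using Q_0[OF l] by (cases "Q l") auto
    have "pop ?D (Q l) = (\<lambda>w. map_prod (c ^^ 1) (c ^^ 1) (pop ?D p w))"
      by (rule ext) (simp add: p pop_pCons[OF D])
    then have "trace_endo (pop ?D (Q l)) = 0" using trp[of 1 p] by simp
    then show ?thesis
      using trace_endo_idempotent(2)[of "pop ?D (Q l)" w] proj_proj[OF l(1) l(1)]
        clinearD(1)[OF clinear_pop[OF D]] by auto
  qed
  then have "pop ?D (Q 0) w = w" for w
    using sum_proj[of w] zero_in_\<Lambda> finite_\<Lambda> by (simp add: sum.remove)
  then have 0: "(?D ^^ N) w = 0" for w using ann_proj[OF zero_in_\<Lambda>, of w] by simp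
  have "(?D ^^ N) (x, x) = ((c ^^ N) x, (c ^^ N) x)" for x by (induction N) auto
  then show thesis using that[of N] 0 by (metis fst_conv fst_zero)
qed

section \<open>Functions of the semisimple part and the Jordan decomposition\<close>

context spectral
begin

lemma clinear_proj: "clinear (pop D (Q l))"
  by (rule clinear_pop[OF clinear_D])

text \<open>It acts as the scalar \<open>\<phi> l\<close> on the generalized eigenspace of l. For
  the identity function it is the semisimple Jordan component of D, for \<open>cnj\<close> the test
  operator of Cartan's criterion.\<close>

definition spectral_sum :: "(complex \<Rightarrow> complex) \<Rightarrow> 'a \<times> 'a \<Rightarrow> 'a \<times> 'a" where
  "spectral_sum \<phi> w = (\<Sum>l\<in>\<Lambda>. cscale (\<phi> l) (pop D (Q l) w))"

lemma spectral_sum_eq_pop: "spectral_sum \<phi> w = pop D (\<Sum>l\<in>\<Lambda>. smult (\<phi> l) (Q l)) w"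
  by (simp add: spectral_sum_def pop_sum pop_smult clinear_D)

lemma clinear_spectral_sum: "clinear (spectral_sum \<phi>)"
  unfolding spectral_sum_def[abs_def]
  by (intro clinear_sum clinear_compose[OF clinear_cscale] clinear_proj)

lemma spectral_sum_apply:
  assumes "((\<lambda>v. D v - cscale l v) ^^ m) w = 0"
  shows "spectral_sum \<phi> w = cscale (\<phi> l) w"
proof (cases "l \<in> \<Lambda>")
  case True
  have "spectral_sum \<phi> w = (\<Sum>k\<in>\<Lambda>. if k = l then cscale (\<phi> l) w else 0)"
    unfolding spectral_sum_def using proj_apply[OF assms] by (intro sum.cong) auto
  then show ?thesis using True finite_\<Lambda> by simp
next
  case False
  then have "w = 0" by (rule eigen_outside[OF assms])
  then show ?thesis by (simp add: clinearD[OF clinear_spectral_sum])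
qed

definition nil_part :: "'a \<times> 'a \<Rightarrow> 'a \<times> 'a" where
  "nil_part w = D w - spectral_sum (\<lambda>l. l) w"

lemma clinear_nil_part: "clinear nil_part"
  unfolding nil_part_def[abs_def] by (rule clinear_diff[OF clinear_D clinear_spectral_sum])

lemma nil_part_commute:
  assumes "clinear F" "\<And>w. F (D w) = D (F w)"
  shows "F (nil_part w) = nil_part (F w)"
  unfolding nil_part_def spectral_sum_eq_pop
  by (simp add: clinearD(4)[OF assms(1)] assms(2) pop_commute[OF clinear_D assms])

lemma shift_pow_proj:
  "((\<lambda>v. D v - cscale l v) ^^ k) (pop D (Q l) w) = pop D (Q l) (((\<lambda>v. D v - cscale l v) ^^ k) w)"
  unfolding pop_linear_power[OF clinear_D, symmetric]
  by (simp flip: pop_mult[OF clinear_D]) (simp add: mult.commute)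

text \<open>On the generalized eigenspace of l it agrees with D - l, whose N-th power is zero
  there.\<close>

lemma nil_part_nilpotent: "(nil_part ^^ N) w = 0"
proof -
  have 1: "nil_part (pop D (Q l) w) = D (pop D (Q l) w) - cscale l (pop D (Q l) w)" if "l \<in> \<Lambda>" for l w
    using spectral_sum_apply[OF ann_proj[OF that]] by (simp add: nil_part_def)
  have 2: "(nil_part ^^ k) (pop D (Q l) w) = ((\<lambda>v. D v - cscale l v) ^^ k) (pop D (Q l) w)" if "l \<in> \<Lambda>" for l w k
  proof (induction k)
    case (Suc k)
    show ?case
      unfolding funpow.simps o_apply Suc.IH shift_pow_proj using 1[OF that] by blast
  qed simp
  have "(nil_part ^^ N) w = (nil_part ^^ N) (\<Sum>l\<in>\<Lambda>. pop D (Q l) w)" by (simp add: sum_proj)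
  also have "\<dots> = (\<Sum>l\<in>\<Lambda>. (nil_part ^^ N) (pop D (Q l) w))"
    by (rule linear_sum[OF linear_funpow[OF clinearD(1)[OF clinear_nil_part]]])
  also have "\<dots> = 0" using 2 ann_proj by (intro sum.neutral) auto
  finally show ?thesis .
qed

text \<open>The operator is a polynomial in D whose power with exponent \<open>Suc N\<close>
  contains the factor (X - l)^N * Q l, so it is nilpotent. The complex factor c stands inside
  because the trace is only real linear.\<close>

lemma trace_shift_proj:
  assumes "l \<in> \<Lambda>"
  shows "trace_endo (\<lambda>w. cscale c (D (pop D (Q l) w) - cscale l (pop D (Q l) w))) = 0"
proof -
  define p where "p = smult c ([:-l, 1:] * Q l)"
  have *: "(\<lambda>w. cscale c (D (pop D (Q l) w) - cscale l (pop D (Q l) w))) = pop D p"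
    unfolding p_def
    by (rule ext) (simp only: pop_smult[OF clinear_D] pop_mult[OF clinear_D],
        simp add: pop_pCons clinear_D cscale_minus_left clinearD)
  have "((pop D p) ^^ k) w = pop D (p ^ k) w" for k w
    by (induction k) (auto simp: pop_1 pop_mult clinear_D)
  moreover have "pop D (p ^ Suc N) w = 0" for w
  proof -
    have "(smult c (X * Q l)) ^ Suc N = smult (c ^ Suc N) (Q l ^ N) * (X * (X ^ N * Q l))" for X
      by (simp add: smult_power power_mult_distrib mult_ac)
    then have "p ^ Suc N = smult (c ^ Suc N) (Q l ^ N) * ([:-l, 1:] * ([:-l, 1:] ^ N * Q l))"
      unfolding p_def .
    moreover have "pop D ([:-l, 1:] ^ N * Q l) w = 0"
      by (simp add: pop_mult pop_linear_power clinear_D ann_proj assms)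
    ultimately show ?thesis by (simp only: pop_mult[OF clinear_D] clinearD(5)[OF clinear_pop[OF clinear_D]])
  qed
  ultimately have "((pop D p) ^^ Suc N) w = 0" for w by (simp only:)
  then show ?thesis
    unfolding * by (rule trace_endo_nilpotent[OF clinearD(1)[OF clinear_pop[OF clinear_D]]])
qed

text \<open>On the generalized eigenspace of l the operator is the real number |l|^2 plus a
  nilpotent part. A vanishing sum of nonnegative terms forces every projection with l \<noteq> 0 to
  have trace 0, hence to be 0.\<close>

lemma nilpotent_if_trace_cnj_zero:
  assumes "trace_endo (\<lambda>w. spectral_sum cnj (D w)) = 0"
  shows "(D ^^ N) w = 0"
proof -
  have lD: "pop D (Q l) (D w) = D (pop D (Q l) w)" for l w
    using pop_commute[OF clinear_D clinear_D] by simp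
  have "trace_endo (\<lambda>w. cscale (cnj l) (D (pop D (Q l) w))) = (cmod l)\<^sup>2 * trace_endo (pop D (Q l))"
    if "l \<in> \<Lambda>" for l
  proof -
    have "trace_endo (\<lambda>w. cscale (cnj l) (D (pop D (Q l) w)))
      = trace_endo (\<lambda>w. cscale (cnj l) (D (pop D (Q l) w) - cscale l (pop D (Q l) w)) + (cmod l)\<^sup>2 *\<^sub>R pop D (Q l) w)"
      by (simp add: cscale_diff_right cscale_cscale complex_norm_square[symmetric] mult.commute
          flip: cscale_of_real)
    then show ?thesis
      by (simp only: trace_endo_add trace_shift_proj[OF that] trace_endo_scale)
  qed
  then have "(\<Sum>l\<in>\<Lambda>. (cmod l)\<^sup>2 * trace_endo (pop D (Q l))) = 0"
    using assms unfolding spectral_sum_def lD trace_endo_sum by simp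
  moreover have "trace_endo (pop D (Q l)) \<ge> 0" if "l \<in> \<Lambda>" for l
    using trace_endo_idempotent(1)[OF clinearD(1)[OF clinear_proj]] proj_proj[OF that that] by simp
  ultimately have "(cmod l)\<^sup>2 * trace_endo (pop D (Q l)) = 0" if "l \<in> \<Lambda>" for l
    using that finite_\<Lambda> by (subst (asm) sum_nonneg_eq_0_iff) auto
  then have "pop D (Q l) w = 0" if "l \<in> \<Lambda> - {0}" for l w
    using trace_endo_idempotent(2)[OF clinearD(1)[OF clinear_proj], of l w] proj_proj[of l l] that by auto
  then have "pop D (Q 0) w = w"
    using sum_proj[of w] zero_in_\<Lambda> finite_\<Lambda> by (simp add: sum.remove)
  then show ?thesis using ann_proj[OF zero_in_\<Lambda>, of w] by simp
qed

end

section \<open>Lie algebras and the Killing form\<close>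

definition derivation :: "('a::euclidean_space \<Rightarrow> 'a \<Rightarrow> 'a) \<Rightarrow> ('a \<Rightarrow> 'a) \<Rightarrow> bool" where
  "derivation br d \<longleftrightarrow> linear d \<and> (\<forall>x y. d (br x y) = br (d x) y + br x (d y))"

locale lie =
  fixes br :: "'a::euclidean_space \<Rightarrow> 'a \<Rightarrow> 'a"
  assumes lie_algebra: "lie_algebra br"
begin

lemma bilinear: "bilinear br"
  using lie_algebra by (simp add: lie_algebra_def)

lemma linear_ad: "linear (br x)" and linear_br_left: "linear (\<lambda>x. br x y)"
  using bilinear by (auto simp: bilinear_def)

lemma br_simps:
  "br (x + y) z = br x z + br y z" "br z (x + y) = br z x + br z y"
  "br (x - y) z = br x z - br y z" "br z (x - y) = br z x - br z y"
  "br (c *\<^sub>R x) z = c *\<^sub>R br x z" "br z (c *\<^sub>R x) = c *\<^sub>R br z x"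
  "br 0 z = 0" "br z 0 = 0" "br (- x) z = - br x z" "br z (- x) = - br z x"
  "br (\<Sum>i\<in>I. f i) z = (\<Sum>i\<in>I. br (f i) z)" "br z (\<Sum>i\<in>I. f i) = (\<Sum>i\<in>I. br z (f i))"
  using linear_ad linear_br_left
  by (auto simp: linear_add linear_diff linear_scale linear_0 linear_neg linear_sum
      linear_add[OF linear_br_left] linear_diff[OF linear_br_left] linear_scale[OF linear_br_left]
      linear_0[OF linear_br_left] linear_neg[OF linear_br_left] linear_sum[OF linear_br_left])

lemma br_self [simp]: "br x x = 0"
  using lie_algebra by (simp add: lie_algebra_def)

lemma br_anti: "br x y = - br y x"
proof -
  have "br (x + y) (x + y) = br x y + br y x"
    unfolding br_simps(1) br_simps(2) by simp
  then have "br x y + br y x = 0" by simp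
  then show ?thesis by (simp add: eq_neg_iff_add_eq_0)
qed

lemma jacobi: "br x (br y z) = br (br x y) z + br y (br x z)"
proof -
  have "br x (br y z) + br y (br z x) + br z (br x y) = 0"
    using lie_algebra by (auto simp: lie_algebra_def)
  moreover have "br y (br z x) = - br y (br x z)" "br z (br x y) = - br (br x y) z"
    using br_anti[of z x] br_anti[of z "br x y"] by (simp_all add: br_simps)
  ultimately show ?thesis by (simp add: algebra_simps)
qed

lemma ad_br: "br (br x y) z = br x (br y z) - br y (br x z)"
  using jacobi[of x y z] by simp

lemma derivation_ad: "derivation br (br x)"
  unfolding derivation_def using linear_ad jacobi by blast

abbreviation K :: "'a \<Rightarrow> 'a \<Rightarrow> real" where "K \<equiv> killing br"

lemma K_def': "K x y = trace_endo (\<lambda>z. br x (br y z))"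
  by (simp add: killing_def o_def)

lemma K_commute: "K x y = K y x"
  unfolding K_def' by (rule trace_endo_commute[OF linear_ad linear_ad])

lemma linear_K: "linear (K x)"
  by (rule linearI) (simp_all add: K_def' br_simps trace_endo_add trace_endo_scale)

lemma linear_K_left: "linear (\<lambda>x. K x y)"
  using linear_K[of y] unfolding K_commute[of y] .

lemma K_simps:
  "K (x + y) z = K x z + K y z" "K z (x + y) = K z x + K z y"
  "K (x - y) z = K x z - K y z" "K z (x - y) = K z x - K z y"
  "K (c *\<^sub>R x) z = c * K x z" "K z (c *\<^sub>R x) = c * K z x"
  "K 0 z = 0" "K z 0 = 0" "K (- x) z = - K x z" "K z (- x) = - K z x"
  by (simp_all only: linear_add[OF linear_K] linear_diff[OF linear_K] linear_scale[OF linear_K]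
      linear_0[OF linear_K] linear_neg[OF linear_K] real_scaleR_def
      linear_add[OF linear_K_left] linear_diff[OF linear_K_left] linear_scale[OF linear_K_left]
      linear_0[OF linear_K_left] linear_neg[OF linear_K_left])

text \<open>Write ad [u, v] as a commutator, move ad u cyclically under the trace, and use that the
  commutator of d and ad u is ad (d u). For inner d this is the invariance of K; for arbitrary d it
  serves Cartan's criterion and the proof that derivations are inner.\<close>

lemma trace_derivation_br:
  assumes "derivation br d"
  shows "trace_endo (\<lambda>z. d (br (br u v) z)) = K (d u) v"
proof -
  have ld: "linear d" and d: "\<And>x y. d (br x y) = br (d x) y + br x (d y)"
    using assms by (auto simp: derivation_def)
  have "trace_endo (\<lambda>z. d (br (br u v) z)) = trace_endo (\<lambda>z. d (br u (br v z))) - trace_endo (\<lambda>z. d (br v (br u z)))"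
    by (simp add: ad_br linear_diff[OF ld] trace_endo_diff)
  moreover have "trace_endo (\<lambda>z. d (br v (br u z))) = trace_endo (\<lambda>z. br u (d (br v z)))"
    using trace_endo_commute[OF linear_compose[OF linear_ad[of v] ld] linear_ad[of u]] by (simp add: o_def)
  moreover have "trace_endo (\<lambda>z. d (br u (br v z))) = trace_endo (\<lambda>z. br (d u) (br v z)) + trace_endo (\<lambda>z. br u (d (br v z)))"
    unfolding d[of u] by (rule trace_endo_add)
  ultimately show ?thesis unfolding K_def' by linarith
qed

lemma K_invariant: "K (br x y) z = K x (br y z)"
  unfolding K_def'[of x "br y z"] by (rule trace_derivation_br[OF derivation_ad, symmetric])

subsection \<open>Jordan components of inner derivations\<close>

definition brc :: "'a \<times> 'a \<Rightarrow> 'a \<times> 'a \<Rightarrow> 'a \<times> 'a" where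
  "brc v w = (br (fst v) (fst w) - br (snd v) (snd w), br (fst v) (snd w) + br (snd v) (fst w))"

lemma brc_simps:
  "brc (u + v) w = brc u w + brc v w" "brc w (u + v) = brc w u + brc w v"
  "brc (u - v) w = brc u w - brc v w" "brc w (u - v) = brc w u - brc w v"
  "brc (cscale z v) w = cscale z (brc v w)" "brc w (cscale z v) = cscale z (brc w v)"
  "brc 0 w = 0" "brc w 0 = 0"
  by (simp_all add: brc_def cscale_def br_simps algebra_simps zero_prod_def)

lemma brc_sum: "brc (\<Sum>i\<in>I. f i) w = (\<Sum>i\<in>I. brc (f i) w)" "brc w (\<Sum>i\<in>I. f i) = (\<Sum>i\<in>I. brc w (f i))"
  by (induction I rule: infinite_finite_induct) (auto simp: brc_simps)

lemma ad_brc: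
  "map_prod (br x) (br x) (brc v w) = brc (map_prod (br x) (br x) v) w + brc v (map_prod (br x) (br x) w)"
proof -
  have "br x (br a b) = br (br x a) b + br a (br x b)" for a b by (rule jacobi)
  then show ?thesis by (cases v, cases w) (simp add: brc_def br_simps)
qed

text \<open>By the Leibniz rule D - (l + m) sends [u, v] to [(D - l) u, v] + [u, (D - m) v], which
  lowers one exponent in each summand; the induction runs over a + b.\<close>

lemma weight_brc:
  defines "D x \<equiv> map_prod (br x) (br x)"
  assumes "((\<lambda>v. D x v - cscale l v) ^^ a) u = 0" "((\<lambda>v. D x v - cscale m v) ^^ b) v = 0"
  shows "((\<lambda>w. D x w - cscale (l + m) w) ^^ (a + b)) (brc u v) = 0"
proof -
  define S where "S l v = D x v - cscale l v" for l v
  have lin: "linear (S l ^^ k)" for l k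
    unfolding D_def S_def[abs_def]
    by (intro linear_funpow clinearD(1) clinear_diff clinear_cscale clinear_map_prod linear_ad)
  have step: "S (l + m) (brc u v) = brc (S l u) v + brc u (S m v)" for u v
    unfolding D_def S_def by (simp add: ad_brc brc_simps cscale_add_left)
  have "(S (l + m) ^^ (a + b)) (brc u v) = 0" if "(S l ^^ a) u = 0" "(S m ^^ b) v = 0"
    using that
  proof (induction "a + b" arbitrary: a b u v)
    case 0
    then show ?case by (simp add: brc_simps)
  next
    case (Suc k)
    show ?case
    proof (cases "a = 0 \<or> b = 0")
      case True
      then have "u = 0 \<or> v = 0" using Suc.prems by auto
      then have "brc u v = 0" by (auto simp: brc_simps)
      then show ?thesis using linear_0[OF lin] by simp
    next
      case False
      then obtain a' b' where ab: "a = Suc a'" "b = Suc b'" by (metis not0_implies_Suc)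
      have "(S (l + m) ^^ (a' + b)) (brc (S l u) v) = 0"
        using Suc.prems ab Suc.hyps(2) by (intro Suc.hyps(1)) (auto simp: funpow_swap1)
      moreover have "(S (l + m) ^^ (a + b')) (brc u (S m v)) = 0"
        using Suc.prems ab Suc.hyps(2) by (intro Suc.hyps(1)) (auto simp: funpow_swap1)
      moreover have "a' + b = k" "a + b' = k" using Suc.hyps(2) ab by auto
      ultimately have "(S (l + m) ^^ k) (S (l + m) (brc u v)) = 0"
        unfolding step linear_add[OF lin] by (simp only: add_0)
      then show ?thesis using Suc.hyps(2) by (metis funpow_Suc_right o_apply)
    qed
  qed
  then show ?thesis using assms(2,3) unfolding S_def by blast
qed

text \<open>Weights add under the bracket, so multiplying each weight space by an additive function
  of the weight obeys the Leibniz rule. The functions used are \<open>cnj\<close> and the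
  identity.\<close>

lemma spectral_sum_derivation:
  assumes sp: "spectral (map_prod (br x) (br x)) \<Lambda> N Q"
    and additive: "\<And>a b. \<phi> (a + b) = \<phi> a + \<phi> b"
  shows "spectral.spectral_sum (map_prod (br x) (br x)) \<Lambda> Q \<phi> (brc v w)
    = brc (spectral.spectral_sum (map_prod (br x) (br x)) \<Lambda> Q \<phi> v) w
      + brc v (spectral.spectral_sum (map_prod (br x) (br x)) \<Lambda> Q \<phi> w)"
proof -
  interpret spectral "map_prod (br x) (br x)" \<Lambda> N Q by fact
  let ?P = "\<lambda>l. pop (map_prod (br x) (br x)) (Q l)" and ?\<delta> = "spectral_sum \<phi>"
  have 1: "?\<delta> (brc (?P l v) (?P m w)) = brc (?\<delta> (?P l v)) (?P m w) + brc (?P l v) (?\<delta> (?P m w))"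
    if "l \<in> \<Lambda>" "m \<in> \<Lambda>" for l m
    using spectral_sum_apply[OF weight_brc[OF ann_proj[OF that(1)] ann_proj[OF that(2)]]]
      spectral_sum_apply[OF ann_proj[OF that(1)]] spectral_sum_apply[OF ann_proj[OF that(2)]]
    by (simp add: brc_simps additive cscale_add_left)
  note lin = clinearD[OF clinear_spectral_sum[of \<phi>]]
  have "?\<delta> (brc v w) = ?\<delta> (brc (\<Sum>l\<in>\<Lambda>. ?P l v) (\<Sum>m\<in>\<Lambda>. ?P m w))" by (simp only: sum_proj)
  also have "\<dots> = (\<Sum>l\<in>\<Lambda>. \<Sum>m\<in>\<Lambda>. ?\<delta> (brc (?P l v) (?P m w)))" by (simp only: brc_sum(1) lin(8)) (simp only: brc_sum(2) lin(8))
  also have "\<dots> = (\<Sum>l\<in>\<Lambda>. \<Sum>m\<in>\<Lambda>. brc (?\<delta> (?P l v)) (?P m w) + brc (?P l v) (?\<delta> (?P m w)))"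
    using 1 by (intro sum.cong) auto
  also have "\<dots> = brc (?\<delta> (\<Sum>l\<in>\<Lambda>. ?P l v)) (\<Sum>m\<in>\<Lambda>. ?P m w) + brc (\<Sum>l\<in>\<Lambda>. ?P l v) (?\<delta> (\<Sum>m\<in>\<Lambda>. ?P m w))"
    by (simp only: brc_sum(1) lin(8)) (simp only: brc_sum(2) sum.distrib)
  finally show ?thesis by (simp only: sum_proj)
qed

lemma derivation_re_part:
  assumes "clinear \<delta>" "\<And>v w. \<delta> (brc v w) = brc (\<delta> v) w + brc v (\<delta> w)"
  shows "derivation br (re_part \<delta>)"
proof -
  have "brc (a, 0) (b, 0) = (br a b, 0)" for a b by (simp add: brc_def br_simps)
  then have "re_part \<delta> (br a b) = br (re_part \<delta> a) b + br a (re_part \<delta> b)" for a b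
    using assms(2)[of "(a, 0)" "(b, 0)"] by (simp add: re_part_def) (simp add: brc_def br_simps)
  then show ?thesis using linear_re_part[OF assms(1)] by (simp add: derivation_def)
qed

text \<open>The test derivation is the real part of the operator that multiplies weight spaces by
  conjugate weights. The hypothesis ranges over all derivations because this one is not known to be
  inner at this stage: that follows only from the non-degeneracy of K.\<close>

lemma ad_nilpotent_if_trace_derivation_zero:
  assumes "\<And>d. derivation br d \<Longrightarrow> trace_endo (\<lambda>z. d (br x z)) = 0"
  shows "\<exists>n. \<forall>z. (br x ^^ n) z = 0"
proof -
  let ?D = "map_prod (br x) (br x)"
  have D: "clinear ?D" by (rule clinear_map_prod[OF linear_ad])
  obtain \<Lambda> N Q where sp: "spectral ?D \<Lambda> N Q" using spectral_exists[OF D] by blast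
  then interpret spectral ?D \<Lambda> N Q .
  have der: "derivation br (re_part (spectral_sum cnj))"
    by (rule derivation_re_part[OF clinear_spectral_sum spectral_sum_derivation[OF sp]]) simp
  have "re_part (\<lambda>w. spectral_sum cnj (?D w)) = (\<lambda>z. re_part (spectral_sum cnj) (br x z))"
    by (simp add: re_part_def fun_eq_iff br_simps)
  then have "trace_endo (\<lambda>w. spectral_sum cnj (?D w)) = 0"
    using trace_endo_clinear[OF clinear_compose[OF clinear_spectral_sum D]] assms[OF der] by simp
  then have 0: "(?D ^^ N) w = 0" for w by (rule nilpotent_if_trace_cnj_zero)
  have "(?D ^^ N) (z, z) = ((br x ^^ N) z, (br x ^^ N) z)" for z by (induction N) auto
  then show ?thesis using 0 by (metis fst_conv fst_zero)
qed

subsection \<open>Engel's theorem and Cartan's criterion\<close>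

lemma subspace_insert_max:
  fixes U V :: "'a set"
  assumes "subspace U" "v \<notin> U" "y \<in> span (insert v U)"
  obtains u c where "u \<in> U" "y = u + c *\<^sub>R v"
  using assms span_breakdown_eq[of y v U] by (metis diff_add_cancel span_eq_iff)

lemma max_dim_exists:
  fixes P :: "'b::euclidean_space set \<Rightarrow> bool"
  assumes "P U"
  shows "\<exists>M. P M \<and> (\<forall>M'. P M' \<longrightarrow> dim M' \<le> dim M)"
proof -
  have "\<forall>M. P M \<longrightarrow> dim M < Suc DIM('b)" by (simp add: less_Suc_eq_le dim_subset_UNIV)
  then show ?thesis using ex_has_greatest_nat[of P U dim, OF assms] by blast
qed

lemma dim_insert_less:
  fixes U :: "'b::euclidean_space set"
  assumes "subspace U" "v \<notin> U"
  shows "dim U < dim (span (insert v U))"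
  using assms by (simp add: dim_insert span_eq_iff[THEN iffD2])

text \<open>A relative form, in which v represents a common null vector of H in V / U. Within the
  induction it is also used for a subalgebra M acting on H modulo M, where it produces an element
  normalizing M.\<close>

lemma engel:
  assumes "subspace H" "\<And>x y. x \<in> H \<Longrightarrow> y \<in> H \<Longrightarrow> br x y \<in> H"
    and "H \<subseteq> L" and nil: "\<And>y. y \<in> L \<Longrightarrow> \<exists>n. \<forall>z\<in>L. (br y ^^ n) z = 0"
    and "subspace U" "subspace V" "U \<subseteq> V" "U \<noteq> V" "V \<subseteq> L"
    and "\<And>x y. x \<in> H \<Longrightarrow> y \<in> U \<Longrightarrow> br x y \<in> U" "\<And>x y. x \<in> H \<Longrightarrow> y \<in> V \<Longrightarrow> br x y \<in> V"
  shows "\<exists>v\<in>V - U. \<forall>y\<in>H. br y v \<in> U"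
  using assms(1-3,5-)
proof (induction "dim H" arbitrary: H U V rule: less_induct)
  case less
  show ?case
  proof (cases "H = {0}")
    case True
    then show ?thesis using less.prems subspace_0[OF less.prems(4)] by (auto simp: br_simps)
  next
    case False
    \<comment> \<open>A maximal proper subalgebra M has codimension one: adjoining an element h that
      normalizes it gives a larger subalgebra, which must be H.\<close>
    define P where "P = (\<lambda>M. subspace M \<and> (\<forall>x\<in>M. \<forall>y\<in>M. br x y \<in> M) \<and> M \<subset> H)"
    have "P {0}" using False subspace_0[OF less.prems(1)] by (auto simp: P_def br_simps)
    then obtain M where "P M" and Mmax: "\<And>M'. P M' \<Longrightarrow> dim M' \<le> dim M"
      using max_dim_exists[of P "{0}"] by blast
    then have M: "subspace M" "M \<subset> H" "\<And>x y. x \<in> M \<Longrightarrow> y \<in> M \<Longrightarrow> br x y \<in> M"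
      by (auto simp: P_def)
    have dM: "dim M < dim H" using M less.prems(1) by (intro dim_psubset) (simp add: span_eq_iff[THEN iffD2])
    have "\<exists>h\<in>H - M. \<forall>y\<in>M. br y h \<in> M"
      using M less.prems(1-3) by (intro less.hyps[OF dM]) auto
    then obtain h where h: "h \<in> H" "h \<notin> M" "\<And>y. y \<in> M \<Longrightarrow> br y h \<in> M" by blast
    let ?M' = "span (insert h M)"
    have M'H: "?M' \<subseteq> H" using M h(1) less.prems(1) by (intro span_minimal) auto
    have "dim M < dim ?M'"
      using M h(2) by (intro dim_insert_less) auto
    moreover have "br x y \<in> ?M'" if xy: "x \<in> ?M'" "y \<in> ?M'" for x y
    proof -
      obtain u c where x: "u \<in> M" "x = u + c *\<^sub>R h" using subspace_insert_max[OF _ h(2) xy(1)] M by blast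
      obtain v d where y: "v \<in> M" "y = v + d *\<^sub>R h" using subspace_insert_max[OF _ h(2) xy(2)] M by blast
      have "br x y = br u v + d *\<^sub>R br u h - c *\<^sub>R br v h"
        using x(2) y(2) br_anti[of h v] by (simp add: br_simps)
      also have "\<dots> \<in> M" using M h(3) x(1) y(1) by (intro subspace_diff subspace_add subspace_mul) auto
      finally show ?thesis by (metis span_base insertI2)
    qed
    ultimately have H_eq: "H = ?M'" using Mmax[of ?M'] M'H by (force simp: P_def)
    have "\<exists>v\<in>V - U. \<forall>y\<in>M. br y v \<in> U"
      using M less.prems by (intro less.hyps[OF dM]) auto
    then obtain v where v: "v \<in> V" "v \<notin> U" "\<And>y. y \<in> M \<Longrightarrow> br y v \<in> U" by blast
    \<comment> \<open>Vectors sent into U by M remain so under ad h, because [M, h] lies in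
      M.\<close>
    have iter: "(br h ^^ k) v \<in> V \<and> (\<forall>y\<in>M. br y ((br h ^^ k) v) \<in> U)" for k
    proof (induction k)
      case (Suc k)
      have "br y (br h w) \<in> U" if "y \<in> M" "\<forall>y\<in>M. br y w \<in> U" for y w
      proof -
        have "br y (br h w) = br (br y h) w + br h (br y w)" by (rule jacobi)
        then show ?thesis using that h less.prems(4,9) by (auto intro: subspace_add)
      qed
      then show ?case using Suc h(1) less.prems(10) by auto
    qed (use v in auto)
    obtain n where "(br h ^^ n) v = 0" using nil[of h] h(1) v(1) less.prems(3,8) by blast
    then have ex: "\<exists>n. (br h ^^ n) v \<in> U" using subspace_0[OF less.prems(4)] by metis
    \<comment> \<open>Since v is outside U the exponent k is positive, and the iterate just before
      it is sent into U by h as well as by M.\<close>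
    define k where "k = (LEAST n. (br h ^^ n) v \<in> U)"
    have kU: "(br h ^^ k) v \<in> U" unfolding k_def using ex by (rule LeastI_ex)
    then obtain j where j: "k = Suc j" using v(2) by (cases k) auto
    let ?w = "(br h ^^ j) v"
    have "?w \<notin> U" using j not_less_Least[of j "\<lambda>n. (br h ^^ n) v \<in> U"] by (auto simp: k_def)
    moreover have "br y ?w \<in> U" if yH: "y \<in> H" for y
    proof -
      obtain u c where "u \<in> M" "y = u + c *\<^sub>R h"
        using subspace_insert_max[OF M(1) h(2), of y] yH H_eq by blast
      then show ?thesis using iter[of j] kU j less.prems(4)
        by (auto simp: br_simps intro: subspace_add subspace_mul)
    qed
    ultimately show ?thesis using iter[of j] by blast
  qed
qed

lemma lie_ideal_bracket_span:
  assumes "lie_ideal br I"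
  shows "lie_ideal br (bracket_span br I I)" "bracket_span br I I \<subseteq> I"
proof -
  have I: "subspace I" "\<And>x y. y \<in> I \<Longrightarrow> br x y \<in> I" using assms by (auto simp: lie_ideal_def)
  let ?S = "{br x y |x y. x \<in> I \<and> y \<in> I}"
  show "bracket_span br I I \<subseteq> I"
    unfolding bracket_span_def using I by (intro span_minimal) auto
  have "br z w \<in> span ?S" if "w \<in> span ?S" for z w
    using that
  proof (induction rule: span_induct)
    show "subspace {w. br z w \<in> span ?S}"
      by (auto simp: subspace_def br_simps span_add span_scale span_zero)
  next
    fix w assume "w \<in> ?S"
    then obtain x y where xy: "w = br x y" "x \<in> I" "y \<in> I" by blast
    then show "br z w \<in> span ?S"
      unfolding xy(1) jacobi[of z x y] using I(2) by (intro span_add span_base) auto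
  qed
  then show "lie_ideal br (bracket_span br I I)"
    by (auto simp: lie_ideal_def bracket_span_def)
qed

end

locale semisimple_lie = lie +
  assumes semisimple: "semisimple_lie_algebra br"
begin

text \<open>Cartan's criterion for the radical I of K. If I were nonzero, its derived series would
  become stationary at a nonzero J = [J, J]. Elements of J act nilpotently by the trace criterion,
  and Engel's theorem then puts [J, J] into a proper subspace of J.\<close>

lemma killing_nondegenerate:
  assumes "\<And>y. K x y = 0"
  shows "x = 0"
proof -
  define I where "I = {x. \<forall>y. K x y = 0}"
  define S where "S n = ((\<lambda>J. bracket_span br J J) ^^ n) I" for n
  have "K (br z x) y = 0" if "\<And>y. K x y = 0" for x y z
    using that[of "br z y"] br_anti[of z x] by (simp add: K_invariant K_simps)
  then have idI: "lie_ideal br I"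
    by (auto simp: lie_ideal_def I_def subspace_def K_simps)
  have ids: "lie_ideal br (S n)" for n
    unfolding S_def by (induction n) (auto simp: idI lie_ideal_bracket_span)
  have dec: "S (Suc n) \<subseteq> S n" for n
    using lie_ideal_bracket_span(2)[OF ids[of n]] by (simp add: S_def)
  have SI: "S n \<subseteq> I" for n
    by (induction n) (use dec in \<open>auto simp: S_def\<close>)
  have "I = {0}"
  proof (rule ccontr)
    assume "I \<noteq> {0}"
    then have nonsolv: "S n \<noteq> {0}" for n
      using semisimple idI unfolding semisimple_lie_algebra_def lie_solvable_def S_def by blast
    obtain n where n: "\<And>m. dim (S n) \<le> dim (S m)"
      using ex_has_least_nat[of "\<lambda>_. True" _ "\<lambda>n. dim (S n)"] by blast
    define J where "J = S n"
    have J: "subspace J" "\<And>x y. y \<in> J \<Longrightarrow> br x y \<in> J" "J \<noteq> {0}"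
      using ids[of n] nonsolv by (auto simp: J_def lie_ideal_def)
    have JK: "K y v = 0" if "v \<in> J" for y v
      using SI that K_commute[of y v] by (auto simp: J_def I_def)
    have "S (Suc n) = S n"
      using n[of "Suc n"] dec[of n] ids[of n] ids[of "Suc n"]
      by (intro subspace_dim_equal) (auto simp: lie_ideal_def)
    then have Jspan: "J = span {br x y |x y. x \<in> J \<and> y \<in> J}"
      unfolding J_def by (simp add: S_def bracket_span_def)
    have nil: "\<exists>k. \<forall>z\<in>J. (br x ^^ k) z = 0" if "x \<in> J" for x
    proof -
      have "trace_endo (\<lambda>z. d (br x z)) = 0" if d: "derivation br d" for d
      proof -
        have ld: "linear d" using d by (simp add: derivation_def)
        define F where "F x = trace_endo (\<lambda>z. d (br x z))" for x
        have "linear F"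
          unfolding F_def by (rule linearI)
            (simp_all add: br_simps linear_add[OF ld] linear_scale[OF ld] trace_endo_add trace_endo_scale)
        moreover have "x \<in> span {br x y |x y. x \<in> J \<and> y \<in> J}" using \<open>x \<in> J\<close> unfolding Jspan[symmetric] .
        moreover have "F y = 0" if "y \<in> {br x y |x y. x \<in> J \<and> y \<in> J}" for y
          using that JK by (auto simp: F_def trace_derivation_br[OF d])
        ultimately have "F x = 0" using linear_eq_0_on_span[of F "{br x y |x y. x \<in> J \<and> y \<in> J}" x] by blast
        then show ?thesis by (simp add: F_def)
      qed
      then have "\<exists>k. \<forall>z. (br x ^^ k) z = 0" by (rule ad_nilpotent_if_trace_derivation_zero)
      then show ?thesis by blast
    qed
    \<comment> \<open>For a maximal proper J-stable subspace U, the span of U and an Engel vector v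
      is again J-stable, hence all of J; this forces [J, J] into U.\<close>
    define P where "P = (\<lambda>U. subspace U \<and> U \<subset> J \<and> (\<forall>x\<in>J. \<forall>y\<in>U. br x y \<in> U))"
    have "P {0}" using J subspace_0[OF J(1)] by (auto simp: P_def br_simps)
    then obtain U where "P U" and Umax: "\<And>U'. P U' \<Longrightarrow> dim U' \<le> dim U"
      using max_dim_exists[of P "{0}"] by blast
    then have U: "subspace U" "U \<subset> J" "\<And>x y. x \<in> J \<Longrightarrow> y \<in> U \<Longrightarrow> br x y \<in> U"
      by (auto simp: P_def)
    have "\<exists>v\<in>J - U. \<forall>y\<in>J. br y v \<in> U"
      using U(2) by (intro engel[where L = J] J(1,2) nil U(1,3) order_refl) auto
    then obtain v where v: "v \<in> J" "v \<notin> U" "\<And>y. y \<in> J \<Longrightarrow> br y v \<in> U" by blast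
    have brU: "br x y \<in> U" if xy: "x \<in> J" "y \<in> span (insert v U)" for x y
    proof -
      obtain u c where "u \<in> U" "y = u + c *\<^sub>R v"
        using subspace_insert_max[OF U(1) v(2) xy(2)] by blast
      then show ?thesis using U v(3) xy(1) by (simp add: br_simps subspace_add subspace_mul)
    qed
    have "dim U < dim (span (insert v U))"
      using U v(2) by (intro dim_insert_less) auto
    moreover have sub: "span (insert v U) \<subseteq> J" using U v(1) J(1) by (intro span_minimal) auto
    moreover have "br x y \<in> span (insert v U)" if "x \<in> J" "y \<in> span (insert v U)" for x y
      using brU[OF that] by (intro span_base) simp
    then have "P (span (insert v U))" if "span (insert v U) \<noteq> J"
      unfolding P_def using that sub by blast
    ultimately have "span (insert v U) = J"
      using Umax[of "span (insert v U)"] by force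
    then have "{br x y |x y. x \<in> J \<and> y \<in> J} \<subseteq> U" using brU by auto
    then have "J \<subseteq> U" by (subst Jspan, intro span_minimal) (use U in auto)
    then show False using U by blast
  qed
  moreover have "x \<in> I" using assms by (simp add: I_def)
  ultimately show ?thesis by simp
qed

end

lemma funpow_compose_commute:
  assumes "\<And>x. f (g x) = g (f x)"
  shows "((\<lambda>x. f (g x)) ^^ n) x = (f ^^ n) ((g ^^ n) x)"
proof (induction n)
  case (Suc n)
  have "g ((f ^^ n) y) = (f ^^ n) (g y)" for y
    by (rule funpow_commute[where f = f and g = g, symmetric]) (rule assms)
  then show ?case using Suc by simp
qed simp

section \<open>Perturbation of linear maps\<close>

text \<open>The constant does not depend on the parameter; this uniformity later bounds the inverses
  in the local frame.\<close>

lemma eventually_bounded_below: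
  fixes G :: "'p \<Rightarrow> 'a::euclidean_space \<Rightarrow> 'a"
  assumes "\<And>x. linear (G x)" "linear g" "inj g"
    and lim: "\<And>b. b \<in> Basis \<Longrightarrow> ((\<lambda>x. G x b) \<longlongrightarrow> g b) F"
  shows "\<exists>c>0. \<forall>\<^sub>F x in F. \<forall>v. c * norm v \<le> norm (G x v)"
proof -
  obtain c where c: "c > 0" "\<And>v. c * norm v \<le> norm (g v)"
    using linear_inj_bounded_below_pos[OF assms(2,3)] by (metis mult.commute)
  \<comment> \<open>Each of the \<open>DIM('a)\<close> coordinates contributes an error of at most e
    times the norm of v, which adds up to half of the bound c.\<close>
  define e where "e = c / (2 * DIM('a))"
  have e: "e > 0" using c(1) by (simp add: e_def)
  have "\<forall>\<^sub>F x in F. \<forall>b\<in>Basis. dist (G x b) (g b) < e"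
    using lim e by (intro eventually_ball_finite) (auto simp: tendsto_iff)
  then have "\<forall>\<^sub>F x in F. \<forall>v. c / 2 * norm v \<le> norm (G x v)"
  proof eventually_elim
    case (elim x)
    show ?case
    proof
      fix v
      have "G x v - g v = (\<Sum>b\<in>Basis. (v \<bullet> b) *\<^sub>R (G x b - g b))"
      proof -
        have "f v = (\<Sum>b\<in>Basis. (v \<bullet> b) *\<^sub>R f b)" if "linear f" for f :: "'a \<Rightarrow> 'a"
          by (subst euclidean_representation[of v, symmetric]) (simp only: linear_sum[OF that] linear_scale[OF that])
        then show ?thesis
          using assms(1,2) by (simp add: sum_subtractf scaleR_diff_right)
      qed
      also have "norm \<dots> \<le> (\<Sum>b\<in>(Basis :: 'a set). norm v * e)"
      proof (rule order_trans[OF norm_sum], rule sum_mono)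
        fix b :: 'a assume b: "b \<in> Basis"
        then have "norm (G x b - g b) \<le> e" using elim by (auto simp: dist_norm intro: less_imp_le)
        then show "norm ((v \<bullet> b) *\<^sub>R (G x b - g b)) \<le> norm v * e"
          using Basis_le_norm[OF b, of v] by (auto intro!: mult_mono)
      qed
      also have "\<dots> = c / 2 * norm v" by (simp add: e_def)
      finally have "norm (G x v - g v) \<le> c / 2 * norm v" .
      moreover have "norm (g v) \<le> norm (G x v) + norm (G x v - g v)"
        using norm_triangle_sub[of "g v" "G x v"] by (simp add: norm_minus_commute)
      ultimately show "c / 2 * norm v \<le> norm (G x v)" using c(2)[of v] by linarith
    qed
  qed
  then show ?thesis using c(1) by (intro exI[of _ "c / 2"]) simp
qed

lemma eventually_inj:
  fixes G :: "'p \<Rightarrow> 'a::euclidean_space \<Rightarrow> 'a"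
  assumes "\<And>x. linear (G x)" "linear g" "inj g"
    and lim: "\<And>b. b \<in> Basis \<Longrightarrow> ((\<lambda>x. G x b) \<longlongrightarrow> g b) F"
  shows "\<forall>\<^sub>F x in F. inj (G x)"
proof -
  obtain c where c: "c > 0" "\<forall>\<^sub>F x in F. \<forall>v. c * norm v \<le> norm (G x v)"
    using eventually_bounded_below[OF assms(1-4)] by blast
  show ?thesis
    using c(2)
  proof eventually_elim
    case (elim x)
    have "v = 0" if "G x v = 0" for v
    proof -
      have "c * norm v \<le> 0" using elim[rule_format, of v] that by simp
      then show ?thesis using c(1) by (simp add: mult_le_0_iff)
    qed
    then show ?case using linear_inj_iff_eq_0[OF assms(1)] by blast
  qed
qed

text \<open>With \<open>h\<close> a pseudo-inverse of \<open>t\<close>, invertibility of \<open>h \<circ> T + (1 - h \<circ> t)\<close> bounds the kernel of \<open>T\<close>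
  by that of \<open>t\<close>; at \<open>T = t\<close> this map is the identity.\<close>

lemma dim_kernel_le_if_inj:
  fixes T t h :: "'a::euclidean_space \<Rightarrow> 'a"
  assumes T: "linear T" and t: "linear t" and h: "linear h" "\<And>v. t (h (t v)) = t v"
    and "inj (\<lambda>v. h (T v) + (v - h (t v)))"
  shows "dim {v. T v = 0} \<le> dim {v. t v = 0}"
proof -
  let ?G = "\<lambda>v. h (T v) + (v - h (t v))"
  have G: "linear ?G"
    by (rule linearI) (simp_all add: linear_add[OF T] linear_add[OF t] linear_add[OF h(1)]
        linear_scale[OF T] linear_scale[OF t] linear_scale[OF h(1)] algebra_simps)
  have "?G ` {v. T v = 0} \<subseteq> {v. t v = 0}"
    using h(2) by (auto simp: linear_diff[OF t] linear_0[OF h(1)])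
  then have "dim (?G ` {v. T v = 0}) \<le> dim {v. t v = 0}" by (rule dim_subset)
  moreover have "dim (?G ` {v. T v = 0}) = dim {v. T v = 0}"
    by (rule dim_image_eq[OF G]) (rule inj_on_subset[OF assms(5)], simp)
  ultimately show ?thesis by simp
qed

lemma eventually_dim_kernel_le:
  fixes T :: "'p \<Rightarrow> 'a::euclidean_space \<Rightarrow> 'a"
  assumes T: "\<And>x. linear (T x)" and t: "linear t"
    and lim: "\<And>b. b \<in> Basis \<Longrightarrow> ((\<lambda>x. T x b) \<longlongrightarrow> t b) F"
  shows "\<forall>\<^sub>F x in F. dim {v. T x v = 0} \<le> dim {v. t v = 0}"
proof -
  obtain h where h: "linear h" "\<And>v. t (h (t v)) = t v"
    using linear_pseudo_inverse[OF t] by blast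
  have "\<forall>\<^sub>F x in F. inj (\<lambda>v. h (T x v) + (v - h (t v)))"
  proof (rule eventually_inj[where g = "\<lambda>v. v"])
    show "linear (\<lambda>v. h (T x v) + (v - h (t v)))" for x
      by (rule linearI) (simp_all add: linear_add[OF T] linear_add[OF t] linear_add[OF h(1)]
        linear_scale[OF T] linear_scale[OF t] linear_scale[OF h(1)] algebra_simps)
    fix b :: 'a assume "b \<in> Basis"
    then have "((\<lambda>x. h (T x b) + (b - h (t b))) \<longlongrightarrow> h (t b) + (b - h (t b))) F"
      by (intro tendsto_add tendsto_const linear_lim_0 bounded_linear.tendsto[OF linear_conv_bounded_linear[THEN iffD1, OF h(1)]] lim)
    then show "((\<lambda>x. h (T x b) + (b - h (t b))) \<longlongrightarrow> b) F" by simp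
  qed (simp_all add: linear_id[unfolded id_def])
  then show ?thesis
    by eventually_elim (rule dim_kernel_le_if_inj[OF T t h])
qed

section \<open>Polynomial curves of vectors and generic invertibility\<close>

definition poly_vec :: "(real \<Rightarrow> 'a::euclidean_space) \<Rightarrow> bool" where
  "poly_vec f \<longleftrightarrow> (\<forall>u. \<exists>p. \<forall>t. f t \<bullet> u = poly p t)"

lemma poly_vec_const: "poly_vec (\<lambda>t. v)"
  unfolding poly_vec_def by (metis mult_zero_right add_0_right poly_pCons poly_0)

lemma poly_vec_add:
  assumes "poly_vec f" "poly_vec g" shows "poly_vec (\<lambda>t. f t + g t)"
  using assms unfolding poly_vec_def by (metis inner_add_left poly_add)

lemma poly_vec_diff:
  assumes "poly_vec f" "poly_vec g" shows "poly_vec (\<lambda>t. f t - g t)"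
  using assms unfolding poly_vec_def by (metis inner_diff_left poly_diff)

lemma poly_vec_scale:
  assumes "poly_vec f" shows "poly_vec (\<lambda>t. poly q t *\<^sub>R f t)"
  using assms unfolding poly_vec_def by (metis inner_scaleR_left poly_mult)

text \<open>Since \<open>poly_vec\<close> tests against every vector u and not only against a basis,
  L can be moved to the test vector by taking its adjoint.\<close>

lemma poly_vec_linear:
  assumes "poly_vec f" "linear L" shows "poly_vec (\<lambda>t. L (f t))"
  using assms unfolding poly_vec_def by (metis adjoint_works)

lemma poly_vec_zero:
  assumes "poly_vec f" "infinite {t. f t = 0}"
  shows "f t = 0"
proof -
  obtain p where p: "\<And>s. f s \<bullet> f t = poly p s" using assms(1) unfolding poly_vec_def by blast
  have "{t. f t = 0} \<subseteq> {s. poly p s = 0}" by (auto simp: p[symmetric])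
  then have "infinite {s. poly p s = 0}" using assms(2) finite_subset by blast
  then have "p = 0" using poly_roots_finite by blast
  then show ?thesis using p[of t] by simp
qed

text \<open>Fraction-free Gaussian elimination in place of a determinant. With u =
  \<open>w j t0\<close> as pivot direction, the combinations \<open>v i\<close> are orthogonal to u
  at every parameter; the only parameters lost in a step are the zeros of the pivot polynomial,
  which is nonzero at t0.\<close>

lemma finite_dependent_parameters:
  fixes w :: "'i \<Rightarrow> real \<Rightarrow> 'a::euclidean_space"
  assumes "finite I" "\<And>i. i \<in> I \<Longrightarrow> poly_vec (w i)"
    and "\<And>c. (\<Sum>i\<in>I. c i *\<^sub>R w i t0) = 0 \<Longrightarrow> \<forall>i\<in>I. c i = 0"
  shows "finite {t. \<exists>c. (\<Sum>i\<in>I. c i *\<^sub>R w i t) = 0 \<and> (\<exists>i\<in>I. c i \<noteq> 0)}"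
  using assms
proof (induction I arbitrary: w rule: finite_induct)
  case (insert j I)
  have wj: "w j t0 \<noteq> 0"
  proof
    assume "w j t0 = 0"
    then have "(\<Sum>i\<in>insert j I. (if i = j then 1 else 0) *\<^sub>R w i t0) = 0"
      by (intro sum.neutral) auto
    from insert.prems(2)[OF this] show False by auto
  qed
  let ?u = "w j t0"
  have "\<forall>i\<in>insert j I. \<exists>q. \<forall>t. w i t \<bullet> ?u = poly q t"
    using insert.prems(1) unfolding poly_vec_def by blast
  then obtain p where "\<forall>i\<in>insert j I. \<forall>t. w i t \<bullet> ?u = poly (p i) t"
    by (rule bchoice[THEN exE])
  then have p: "\<And>i t. i \<in> insert j I \<Longrightarrow> w i t \<bullet> ?u = poly (p i) t" by blast
  have pj: "poly (p j) t0 \<noteq> 0"  proof -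
    have "poly (p j) t0 = ?u \<bullet> ?u" using p[of j t0] by simp
    then show ?thesis using wj by simp
  qed
  define v where "v i t = poly (p j) t *\<^sub>R w i t - poly (p i) t *\<^sub>R w j t" for i t
  have vsum: "(\<Sum>i\<in>I. c i *\<^sub>R v i t) = poly (p j) t *\<^sub>R (\<Sum>i\<in>I. c i *\<^sub>R w i t) - (\<Sum>i\<in>I. c i * poly (p i) t) *\<^sub>R w j t" for c t
    by (simp add: v_def scaleR_diff_right sum_subtractf scaleR_sum_right scaleR_sum_left mult.commute)
  have fin: "finite {t. \<exists>c. (\<Sum>i\<in>I. c i *\<^sub>R v i t) = 0 \<and> (\<exists>i\<in>I. c i \<noteq> 0)}"
  proof (rule insert.IH)
    show "poly_vec (v i)" if "i \<in> I" for i
      unfolding v_def[abs_def] using that insert.prems(1) by (intro poly_vec_diff poly_vec_scale) auto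
    fix c assume 0: "(\<Sum>i\<in>I. c i *\<^sub>R v i t0) = 0"
    define d where "d i = (if i = j then - (\<Sum>i\<in>I. c i * poly (p i) t0) else poly (p j) t0 * c i)" for i
    have "(\<Sum>i\<in>I. d i *\<^sub>R w i t0) = (\<Sum>i\<in>I. (poly (p j) t0 * c i) *\<^sub>R w i t0)"
      using insert.hyps(2) by (intro sum.cong) (auto simp: d_def)
    then have "(\<Sum>i\<in>insert j I. d i *\<^sub>R w i t0) = (\<Sum>i\<in>I. c i *\<^sub>R v i t0)"
      using insert.hyps unfolding vsum by (simp add: d_def scaleR_sum_right)
    then have "\<forall>i\<in>insert j I. d i = 0" using 0 by (intro insert.prems(2)) simp
    then show "\<forall>i\<in>I. c i = 0" using pj insert.hyps(2) by (auto simp: d_def split: if_splits)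
  qed
  have "t \<in> {t. poly (p j) t = 0} \<or> (\<exists>c. (\<Sum>i\<in>I. c i *\<^sub>R v i t) = 0 \<and> (\<exists>i\<in>I. c i \<noteq> 0))"
    if c: "(\<Sum>i\<in>insert j I. c i *\<^sub>R w i t) = 0" and ne: "\<exists>i\<in>insert j I. c i \<noteq> 0" for c t
  proof (cases "poly (p j) t = 0")
    case False
    have s: "(\<Sum>i\<in>I. c i *\<^sub>R w i t) = - (c j *\<^sub>R w j t)"
      using c insert.hyps by (simp add: add_eq_0_iff)
    have "(\<Sum>i\<in>I. c i * poly (p i) t) = (\<Sum>i\<in>I. c i *\<^sub>R w i t) \<bullet> ?u"
      using p by (simp add: inner_sum_left)
    also have "\<dots> = - c j * poly (p j) t" unfolding s using p by simp
    finally have "(\<Sum>i\<in>I. c i *\<^sub>R v i t) = 0"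
      unfolding vsum s by simp
    moreover have "\<exists>i\<in>I. c i \<noteq> 0"
    proof (rule ccontr)
      assume "\<not> (\<exists>i\<in>I. c i \<noteq> 0)"
      then have "c j *\<^sub>R w j t = 0" "c j \<noteq> 0" using s ne by auto
      then have "w j t = 0" by simp
      then show False using False p[of j t] by simp
    qed
    ultimately show ?thesis by blast
  qed simp
  then have "{t. \<exists>c. (\<Sum>i\<in>insert j I. c i *\<^sub>R w i t) = 0 \<and> (\<exists>i\<in>insert j I. c i \<noteq> 0)}
     \<subseteq> {t. poly (p j) t = 0} \<union> {t. \<exists>c. (\<Sum>i\<in>I. c i *\<^sub>R v i t) = 0 \<and> (\<exists>i\<in>I. c i \<noteq> 0)}"
    by blast
  moreover have "finite {t. poly (p j) t = 0}"
    using pj by (intro poly_roots_finite) auto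
  ultimately show ?case using fin finite_subset by blast
qed simp

lemma finite_singular_parameters:
  fixes G :: "real \<Rightarrow> 'a::euclidean_space \<Rightarrow> 'a"
  assumes G: "\<And>t. linear (G t)" and P: "\<And>b. poly_vec (\<lambda>t. G t b)" and inj: "inj (G t0)"
  shows "finite {t. \<not> inj (G t)}"
proof -
  have rep: "(\<Sum>b\<in>Basis. c b *\<^sub>R G t b) = G t (\<Sum>b\<in>Basis. c b *\<^sub>R b)" for c t
    by (simp only: linear_sum[OF G] linear_scale[OF G])
  have z: "\<forall>b\<in>Basis. c b = 0" if "(\<Sum>b\<in>Basis. c b *\<^sub>R b) = (0::'a)" for c
  proof
    fix b :: 'a assume "b \<in> Basis"
    then have "c b = (\<Sum>b\<in>Basis. c b *\<^sub>R b) \<bullet> b" by (simp add: inner_sum_left_Basis)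
    then show "c b = 0" using that by simp
  qed
  have "finite {t. \<exists>c. (\<Sum>b\<in>Basis. c b *\<^sub>R G t b) = 0 \<and> (\<exists>b\<in>Basis. c b \<noteq> 0)}"
  proof (rule finite_dependent_parameters[OF finite_Basis P])
    fix c assume "(\<Sum>b\<in>Basis. c b *\<^sub>R G t0 b) = 0"
    then show "\<forall>b\<in>Basis. c b = 0"
      unfolding rep using inj z linear_inj_iff_eq_0[OF G[of t0]] by blast
  qed
  moreover have "\<exists>c. (\<Sum>b\<in>Basis. c b *\<^sub>R G t b) = 0 \<and> (\<exists>b\<in>Basis. c b \<noteq> 0)" if ni: "\<not> inj (G t)" for t
  proof -
    obtain v where v: "G t v = 0" "v \<noteq> 0" using ni linear_inj_iff_eq_0[OF G[of t]] by blast
    have "(\<Sum>b\<in>Basis. (v \<bullet> b) *\<^sub>R G t b) = 0" unfolding rep using v(1) by (simp add: euclidean_representation)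
    moreover have "\<exists>b\<in>Basis. v \<bullet> b \<noteq> 0" using v(2) euclidean_all_zero_iff by blast
    ultimately show ?thesis by (intro exI[of _ "\<lambda>b. v \<bullet> b"]) blast
  qed
  then have "{t. \<not> inj (G t)} \<subseteq> {t. \<exists>c. (\<Sum>b\<in>Basis. c b *\<^sub>R G t b) = 0 \<and> (\<exists>b\<in>Basis. c b \<noteq> 0)}"
    by blast
  ultimately show ?thesis by (rule finite_subset[rotated])
qed

text \<open>Up to the least exponent m with f^m v = 0 the kernels of the powers of f grow strictly,
  so m is at most the dimension. Hence the fixed exponent \<open>DIM('a)\<close> can stand for an
  unspecified one.\<close>

lemma funpow_kernel_stable:
  fixes f :: "'a::euclidean_space \<Rightarrow> 'a"
  assumes f: "linear f" and "(f ^^ k) v = 0"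
  shows "(f ^^ DIM('a)) v = 0"
proof -
  define m where "m = (LEAST k. (f ^^ k) v = 0)"
  have m0: "(f ^^ m) v = 0" unfolding m_def using assms(2) by (rule LeastI)
  have m1: "(f ^^ i) v \<noteq> 0" if "i < m" for i using not_less_Least that unfolding m_def by blast
  define Ker where "Ker j = {u. (f ^^ j) u = 0}" for j
  have sub: "subspace (Ker j)" for j
    unfolding Ker_def using linear_subspace_kernel[OF linear_funpow[OF f]] by blast
  have "j \<le> m \<Longrightarrow> j \<le> dim (Ker j)" for j
  proof (induction j)
    case (Suc j)
    let ?u = "(f ^^ (m - Suc j)) v"
    have "(f ^^ Suc j) ?u = (f ^^ m) v" "(f ^^ j) ?u = (f ^^ (m - 1)) v"
      using Suc.prems by (simp_all flip: funpow_add_apply del: funpow.simps)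
    then have "?u \<in> Ker (Suc j)" "?u \<notin> Ker j" using m0 m1[of "m - 1"] Suc.prems by (auto simp: Ker_def simp del: funpow.simps)
    moreover have "Ker j \<subseteq> Ker (Suc j)" unfolding Ker_def using linear_0[OF f] by auto
    ultimately have "Ker j \<subset> Ker (Suc j)" by blast
    then have "dim (Ker j) < dim (Ker (Suc j))"
      by (intro dim_psubset) (simp add: span_eq_iff[THEN iffD2, OF sub])
    then show ?case using Suc by simp
  qed simp
  then have "m \<le> dim (Ker m)" by simp
  then have "m \<le> DIM('a)" using dim_subset_UNIV[of "Ker m"] by simp
  then show ?thesis by (rule linear_funpow_zero_mono[OF f m0])
qed

lemma range_eq_if_kernel_stable:
  fixes f :: "'a::euclidean_space \<Rightarrow> 'a"
  assumes f: "linear f" and "\<And>v. f (f v) = 0 \<Longrightarrow> f v = 0"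
  obtains v where "f w = f (f v)"
proof -
  have sub: "subspace (range f)" by (rule linear_subspace_image[OF f subspace_UNIV])
  have "inj_on f (range f)"
  proof (rule inj_onI)
    fix a b assume "a \<in> range f" "b \<in> range f" "f a = f b"
    then obtain c where "a - b = f c" using f by (metis imageE linear_diff)
    moreover have "f (a - b) = 0" using \<open>f a = f b\<close> by (simp add: linear_diff[OF f])
    ultimately show "a = b" using assms(2)[of c] by simp
  qed
  then have "dim (f ` range f) = dim (range f)"
    by (intro dim_image_eq[OF f]) (simp add: span_eq_iff[THEN iffD2, OF sub])
  then have "f ` range f = range f"
    using linear_subspace_image[OF f sub] sub by (intro subspace_dim_equal) auto
  then show thesis using that by (metis (no_types, lifting) imageE rangeI)
qed


section \<open>Elements with minimal Fitting null component\<close>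

context lie
begin

lemma tendsto_br:
  assumes "(f \<longlongrightarrow> a) F" "(g \<longlongrightarrow> b) F"
  shows "((\<lambda>x. br (f x) (g x)) \<longlongrightarrow> br a b) F"
  using bounded_bilinear.tendsto[OF bilinear_conv_bounded_bilinear[THEN iffD1, OF bilinear] assms] .

lemma tendsto_ad_pow:
  assumes "(f \<longlongrightarrow> a) F"
  shows "((\<lambda>x. (br (f x) ^^ k) v) \<longlongrightarrow> (br a ^^ k) v) F"
  by (induction k) (auto intro: tendsto_br assms)

lemma linear_ad_pow: "linear (br x ^^ k)"
  by (rule linear_funpow[OF linear_ad])

lemma poly_vec_ad_pow: "poly_vec (\<lambda>t. (br (x + t *\<^sub>R y) ^^ k) v)"
proof (induction k)
  case (Suc k)
  have "poly_vec (\<lambda>t. br x ((br (x + t *\<^sub>R y) ^^ k) v) + poly [:0, 1:] t *\<^sub>R br y ((br (x + t *\<^sub>R y) ^^ k) v))"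
    by (intro poly_vec_add poly_vec_scale poly_vec_linear[OF Suc linear_ad])
  moreover have "(br (x + t *\<^sub>R y) ^^ Suc k) v
    = br x ((br (x + t *\<^sub>R y) ^^ k) v) + poly [:0, 1:] t *\<^sub>R br y ((br (x + t *\<^sub>R y) ^^ k) v)" for t
    unfolding funpow.simps o_apply by (subst br_simps(1), subst br_simps(5)) simp
  ultimately show ?case by presburger
qed (simp add: poly_vec_const)

definition null_comp :: "'a \<Rightarrow> 'a set" where
  "null_comp x = {v. (br x ^^ DIM('a)) v = 0}"

definition fitting_regular :: "'a set" where
  "fitting_regular = {x. \<forall>y. dim (null_comp x) \<le> dim (null_comp y)}"

lemma null_compI: "(br x ^^ k) v = 0 \<Longrightarrow> v \<in> null_comp x"
  unfolding null_comp_def using funpow_kernel_stable[OF linear_ad] by blast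

lemma subspace_null_comp: "subspace (null_comp x)"
  unfolding null_comp_def by (rule linear_subspace_kernel[OF linear_ad_pow])

lemma centralizer_subset_null_comp: "centralizer br x \<subseteq> null_comp x"
  using null_compI[where k = 1] by (auto simp: centralizer_def)

lemma self_in_null_comp: "x \<in> null_comp x"
  by (rule null_compI[where k = 1]) simp

lemma subspace_centralizer: "subspace (centralizer br x)"
  unfolding centralizer_def by (rule linear_subspace_kernel[OF linear_ad])

lemma fitting_regular_nonempty: "fitting_regular \<noteq> {}"
proof -
  obtain x where "\<forall>y. dim (null_comp x) \<le> dim (null_comp y)"
    using ex_has_least_nat[of "\<lambda>_. True" undefined "\<lambda>x. dim (null_comp x)"] by blast
  then show ?thesis by (auto simp: fitting_regular_def)
qed

lemma open_fitting_regular: "open fitting_regular"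
proof (subst open_subopen, intro ballI)
  fix x assume x: "x \<in> fitting_regular"
  have "\<forall>\<^sub>F y in nhds x. dim (null_comp y) \<le> dim (null_comp x)"
    unfolding null_comp_def
    by (intro eventually_dim_kernel_le linear_ad_pow tendsto_ad_pow) (simp add: filterlim_ident)
  then obtain S where S: "open S" "x \<in> S" "\<And>y. y \<in> S \<Longrightarrow> dim (null_comp y) \<le> dim (null_comp x)"
    unfolding eventually_nhds by blast
  have "S \<subseteq> fitting_regular"
    using S(3) x le_trans unfolding fitting_regular_def by blast
  then show "\<exists>T. open T \<and> x \<in> T \<and> T \<subseteq> fitting_regular" using S by blast
qed

text \<open>On the line from y to a point x of minimality the operator \<open>?G t\<close> is
  polynomial in t and the identity at t = 1. It is therefore invertible, and the null component
  minimal, for all but finitely many t, in particular for some small positive t.\<close>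

lemma closure_fitting_regular: "closure fitting_regular = UNIV"
proof -
  obtain x where x: "x \<in> fitting_regular" using fitting_regular_nonempty by blast
  have "\<exists>z\<in>fitting_regular. dist z y < e" if e: "e > 0" for y e
  proof -
    define T where "T t = br (y + t *\<^sub>R (x - y)) ^^ DIM('a)" for t
    have T: "linear (T t)" for t unfolding T_def by (rule linear_ad_pow)
    have T1: "T 1 = br x ^^ DIM('a)" by (simp add: T_def)
    obtain h where h: "linear h" "\<And>v. T 1 (h (T 1 v)) = T 1 v"
      using linear_pseudo_inverse[OF T] by blast
    let ?G = "\<lambda>t v. h (T t v) + (v - h (T 1 v))"
    have fin: "finite {t. \<not> inj (?G t)}"
    proof (rule finite_singular_parameters[of ?G 1])
      show "linear (?G t)" for t
        by (rule linearI) (simp_all add: linear_add[OF T] linear_add[OF h(1)]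
          linear_scale[OF T] linear_scale[OF h(1)] algebra_simps)
      show "poly_vec (\<lambda>t. ?G t b)" for b
        unfolding T_def by (intro poly_vec_add poly_vec_const poly_vec_linear[OF _ h(1)] poly_vec_ad_pow)
    qed (simp add: inj_def)
    \<comment> \<open>The summand 1 covers the case x = y.\<close>
    define d where "d = e / (norm (x - y) + 1)"
    have n: "norm (x - y) + 1 > 0" by (simp add: add_nonneg_pos)
    have d: "d > 0" "d * norm (x - y) < e"
      using e n by (simp_all add: d_def pos_divide_less_eq)
    have "infinite {0<..<d}" using d(1) by simp
    then have "\<not> {0<..<d} \<subseteq> {t. \<not> inj (?G t)}"
      using fin finite_subset by blast
    then obtain t where "t \<in> {0<..<d}" and t3: "inj (?G t)" by blast
    then have t: "0 < t" "t < d" by auto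
    define z where "z = y + t *\<^sub>R (x - y)"
    have "dim {v. T t v = 0} \<le> dim {v. T 1 v = 0}"
      by (rule dim_kernel_le_if_inj[OF T T h t3])
    then have "dim (null_comp z) \<le> dim (null_comp x)"
      by (simp add: T1 null_comp_def) (simp add: T_def z_def)
    then have "z \<in> fitting_regular" using x unfolding fitting_regular_def by (auto intro: le_trans)
    moreover have "dist z y < e"
    proof -
      have "dist z y = t * norm (x - y)" using t(1) by (simp add: z_def dist_norm)
      also have "\<dots> \<le> d * norm (x - y)" using t(2) by (intro mult_right_mono) auto
      finally show ?thesis using d(2) by simp
    qed
    ultimately show ?thesis by blast
  qed
  then show ?thesis by (auto simp: closure_approachable)
qed

lemma br_null_comp:
  assumes "u \<in> null_comp x" "v \<in> null_comp x"
  shows "br u v \<in> null_comp x"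
proof -
  let ?S = "\<lambda>w. map_prod (br x) (br x) w - cscale 0 w"
  have S: "(?S ^^ k) (u, 0) = ((br x ^^ k) u, 0)" for u k
    by (induction k) (auto simp: br_simps)
  have 1: "(?S ^^ DIM('a)) (u, 0) = 0" and 2: "(?S ^^ DIM('a)) (v, 0) = 0"
    unfolding S using assms by (auto simp: null_comp_def zero_prod_def)
  have "(?S ^^ (DIM('a) + DIM('a))) (brc (u, 0) (v, 0)) = 0"
    using weight_brc[OF 1 2] unfolding add_0_right .
  moreover have "brc (u, 0) (v, 0) = (br u v, 0)" by (simp add: brc_def br_simps)
  ultimately have "(br x ^^ (DIM('a) + DIM('a))) (br u v) = 0"
    using S[of "DIM('a) + DIM('a)" "br u v"] by (metis fst_conv fst_zero)
  then show ?thesis by (rule null_compI)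
qed

lemma K_ad_pow: "K u ((br x ^^ k) w) = (-1) ^ k * K ((br x ^^ k) u) w"
proof (induction k arbitrary: w)
  case (Suc k)
  have "K u ((br x ^^ Suc k) w) = (-1) ^ k * K ((br x ^^ k) u) (br x w)"
    using Suc[of "br x w"] by (simp add: funpow_swap1)
  also have "K ((br x ^^ k) u) (br x w) = - K ((br x ^^ Suc k) u) w"
    using K_invariant[of "(br x ^^ k) u" x w] br_anti[of "(br x ^^ k) u" x] by (simp add: K_simps)
  finally show ?case by simp
qed simp

lemma fitting_decomposition:
  obtains u v where "w = u + (br x ^^ DIM('a)) v" "u \<in> null_comp x"
proof -
  let ?f = "br x ^^ DIM('a)"
  have "?f v = 0" if "?f (?f v) = 0" for v
    using that null_compI[where x = x and v = v and k = "DIM('a) + DIM('a)"] by (simp add: funpow_add null_comp_def)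
  then obtain v where "?f w = ?f (?f v)"
    using range_eq_if_kernel_stable[OF linear_ad_pow] by metis
  then have "w - ?f v \<in> null_comp x" by (simp add: null_comp_def linear_diff[OF linear_ad_pow])
  then show thesis using that[of "w - ?f v" v] by simp
qed

end

context semisimple_lie
begin

lemma center_trivial:
  assumes "\<And>v. br z v = 0" shows "z = 0"
proof (rule killing_nondegenerate)
  have "br z = (\<lambda>v. 0)" using assms by auto
  then show "K z y = 0" for y by (simp add: K_def')
qed

text \<open>Powers of ad x are self-adjoint for K up to sign, so the null component is orthogonal to
  the range of \<open>br x ^^ DIM('a)\<close>, and the two span the algebra.\<close>

lemma killing_nondegenerate_null_comp:
  assumes "u \<in> null_comp x" "\<And>h. h \<in> null_comp x \<Longrightarrow> K u h = 0"
  shows "u = 0"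
proof (rule killing_nondegenerate)
  fix w
  obtain h v where w: "w = h + (br x ^^ DIM('a)) v" "h \<in> null_comp x"
    using fitting_decomposition by blast
  then show "K u w = 0"
    using assms by (simp add: K_simps K_ad_pow) (simp add: null_comp_def K_simps)
qed

lemma killing_represents:
  assumes l\<tau>: "linear \<tau>"
  obtains z where "K z = \<tau>"
proof -
  define B where "B z = (\<Sum>b\<in>Basis. K z b *\<^sub>R b)" for z
  have lB: "linear B"
    unfolding B_def by (rule linearI) (simp_all add: K_simps scaleR_add_left sum.distrib scaleR_sum_right)
  have Bb: "B z \<bullet> b = K z b" if "b \<in> Basis" for z b
    unfolding B_def using that by (simp add: inner_sum_left_Basis)
  have "z = 0" if "B z = 0" for z
  proof (rule killing_nondegenerate)
    have "K z b = 0" if "b \<in> Basis" for b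
      using Bb[OF that, of z] \<open>B z = 0\<close> by simp
    then have "K z = (\<lambda>_. 0)" by (intro linear_eq_stdbasis[OF linear_K linear_zero])
    then show "K z y = 0" for y by simp
  qed
  then have "surj B"
    using linear_inj_iff_eq_0[OF lB] linear_injective_imp_surjective[OF lB] by blast
  then obtain z where z: "(\<Sum>b\<in>Basis. \<tau> b *\<^sub>R b) = B z" by blast
  have "K z b = \<tau> b" if "b \<in> Basis" for b
    using Bb[OF that, of z] that unfolding z[symmetric] by (simp add: inner_sum_left_Basis)
  then have "K z = \<tau>" by (intro linear_eq_stdbasis[OF linear_K l\<tau>])
  then show thesis by (rule that)
qed

text \<open>Let z represent the functional that sends w to the trace of d (ad w). Then K (d u) v is
  its value at [u, v], that is K z [u, v] = K [z, u] v, for all v.\<close>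

lemma derivation_inner:
  assumes d: "derivation br d"
  obtains z where "d = br z"
proof -
  have ld: "linear d" and dd: "\<And>x y. d (br x y) = br (d x) y + br x (d y)"
    using d by (auto simp: derivation_def)
  define \<tau> where "\<tau> w = trace_endo (\<lambda>v. d (br w v))" for w
  have l\<tau>: "linear \<tau>"
    unfolding \<tau>_def
    by (rule linearI) (simp_all add: br_simps linear_add[OF ld] linear_scale[OF ld] trace_endo_add trace_endo_scale)
  obtain z where "K z = \<tau>" using killing_represents[OF l\<tau>] by blast
  then have Kz: "K z w = \<tau> w" for w by simp
  have "d u - br z u = 0" for u
  proof (rule killing_nondegenerate)
    fix v
    have "K (d u) v = \<tau> (br u v)" using trace_derivation_br[OF d, of u v] by (simp add: \<tau>_def)
    also have "\<dots> = K (br z u) v" unfolding Kz[symmetric] by (rule K_invariant[symmetric])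
    finally show "K (d u - br z u) v = 0" by (simp add: K_simps)
  qed
  then have "d = br z" by (auto intro!: ext)
  then show thesis by (rule that)
qed

end

section \<open>Structure of a minimal null component\<close>

locale fitting_regular_point = semisimple_lie +
  fixes x
  assumes x: "x \<in> fitting_regular"
begin

abbreviation H :: "'a set" where "H \<equiv> null_comp x"

text \<open>For small t the n-th power of ad (x + t y) stays injective on a complement of H, so the
  null component of x + t y lies in H and equals H by minimality. Passing to the multiple y + s x
  with s = 1 / t, the polynomial curve (ad (y + s x))^n h vanishes for infinitely many s, hence also
  at s = 0.\<close>

lemma ad_nilpotent_on_H:
  assumes y: "y \<in> H" and h: "h \<in> H"
  shows "(br y ^^ DIM('a)) h = 0"
proof -
  let ?n = "DIM('a)" and ?V = "range (br x ^^ DIM('a))"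
  define A where "A t = br (x + t *\<^sub>R y)" for t
  have A: "linear (A t ^^ k)" for t k unfolding A_def by (rule linear_ad_pow)
  have AH: "(A t ^^ k) u \<in> H" if "u \<in> H" for t u k
  proof (induction k)
    case (Suc k)
    have "x + t *\<^sub>R y \<in> H"
      using self_in_null_comp y subspace_null_comp by (simp add: subspace_add subspace_mul)
    then show ?case using Suc by (simp add: A_def br_null_comp)
  qed (use that in simp)
  \<comment> \<open>W serves as an invariant complement: \<open>A t\<close> maps it to itself by
    invariance of K, and it meets H only in 0 because K is non-degenerate on H.\<close>
  define W where "W = {v. \<forall>u\<in>H. K u v = 0}"
  have VW: "(br x ^^ ?n) v \<in> W" for v
    unfolding W_def by (auto simp: K_ad_pow) (simp add: null_comp_def K_simps)
  have HW: "u = 0" if "u \<in> H" "u \<in> W" for u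
    using killing_nondegenerate_null_comp[OF that(1)] that(2) K_commute[of u] by (auto simp: W_def)
  have AW: "(A t ^^ k) v \<in> W" if "v \<in> W" for t v k
  proof (induction k)
    case (Suc k)
    have "K u (br (x + t *\<^sub>R y) w) = 0" if "u \<in> H" "w \<in> W" for u w
    proof -
      have "br u (x + t *\<^sub>R y) \<in> H"
        using that(1) self_in_null_comp y subspace_null_comp by (simp add: br_null_comp subspace_add subspace_mul)
      then show ?thesis using that(2) by (auto simp: W_def simp flip: K_invariant)
    qed
    then show ?case using Suc by (auto simp: A_def W_def)
  qed (use that in simp)
  let ?f = "br x ^^ ?n"
  have subV: "subspace ?V" by (rule linear_subspace_image[OF linear_ad_pow subspace_UNIV])
  obtain g where g: "range g \<subseteq> ?V" "linear g" "\<forall>v\<in>?f ` ?V. ?f (g v) = v"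
    using linear_exists_right_inverse_on[OF linear_ad_pow subV] by blast
  \<comment> \<open>The projection along H onto the range of (ad x)^n. The operator shown to be
    injective below is \<open>A t ^^ ?n\<close> on that range and the identity on H.\<close>
  define p where "p w = g (?f w)" for w
  have lp: "linear p" unfolding p_def using linear_compose[OF linear_ad_pow g(2)] by (simp add: o_def)
  have pW: "p w \<in> W" for w
  proof -
    have "p w \<in> ?V" unfolding p_def using g(1) by (rule subsetD) (rule rangeI)
    then obtain v where "p w = ?f v" by (rule rangeE)
    then show ?thesis using VW by simp
  qed
  have fp: "?f (p w) = ?f w" for w
  proof -
    obtain u v where w: "w = u + ?f v" "u \<in> H" using fitting_decomposition by blast
    then have "?f w = ?f (?f v)" by (simp add: linear_add[OF linear_ad_pow] null_comp_def)
    then have "?f w \<in> ?f ` ?V" by simp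
    then show ?thesis using g(3) unfolding p_def by blast
  qed
  have pH: "w - p w \<in> H" for w
    using fp by (simp add: null_comp_def linear_diff[OF linear_ad_pow])
  have lG: "linear (\<lambda>v. (A t ^^ ?n) (p v) + (v - p v))" for t
    by (rule linearI) (simp_all add: linear_add[OF lp] linear_scale[OF lp] linear_add[OF A] linear_scale[OF A] algebra_simps)
  have "\<forall>\<^sub>F t in at (0::real). inj (\<lambda>v. (A t ^^ ?n) (p v) + (v - p v))"
  proof (rule eventually_inj[OF lG lG[of 0]])
    have "v = 0" if "(A 0 ^^ ?n) (p v) + (v - p v) = 0" for v
    proof -
      have e: "(A 0 ^^ ?n) (p v) = - (v - p v)" using that by (rule eq_neg_iff_add_eq_0[THEN iffD2])
      have "- (v - p v) \<in> H" using pH subspace_null_comp subspace_neg by blast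
      moreover have "- (v - p v) \<in> W" using AW[OF pW[of v], where t = 0 and k = "?n"] unfolding e .
      ultimately have "- (v - p v) = 0" by (rule HW)
      then have "v - p v = 0" by (simp only: neg_equal_0_iff_equal)
      moreover have "p v = 0"
      proof (rule HW[OF _ pW])
        have "?f (p v) = 0" using e \<open>v - p v = 0\<close> by (simp add: A_def)
        then show "p v \<in> H" by (simp add: null_comp_def)
      qed
      ultimately show ?thesis by simp
    qed
    then show "inj (\<lambda>v. (A 0 ^^ ?n) (p v) + (v - p v))" using linear_inj_iff_eq_0[OF lG[of 0]] by blast
    have "((\<lambda>t. x + t *\<^sub>R y) \<longlongrightarrow> x + 0 *\<^sub>R y) (at 0)"
      by (intro tendsto_add tendsto_scaleR tendsto_const tendsto_ident_at)
    then show "((\<lambda>t. (A t ^^ ?n) (p b) + (b - p b)) \<longlongrightarrow> (A 0 ^^ ?n) (p b) + (b - p b)) (at 0)" for b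
      unfolding A_def by (intro tendsto_add[OF tendsto_ad_pow tendsto_const])
  qed
  then obtain d where d: "d > 0" "\<And>t. t \<noteq> 0 \<Longrightarrow> \<bar>t\<bar> < d \<Longrightarrow> inj (\<lambda>v. (A t ^^ ?n) (p v) + (v - p v))"
    unfolding eventually_at by (auto simp: dist_real_def)
  have small: "(A t ^^ ?n) h = 0" if t: "t \<noteq> 0" "\<bar>t\<bar> < d" for t
  proof -
    have "v \<in> H" if v: "(A t ^^ ?n) v = 0" for v
    proof -
      have "(A t ^^ ?n) (p v) + (A t ^^ ?n) (v - p v) = 0"
        using v by (simp flip: linear_add[OF A])
      then have e: "(A t ^^ ?n) (p v) = - (A t ^^ ?n) (v - p v)" by (rule eq_neg_iff_add_eq_0[THEN iffD2])
      have "- (A t ^^ ?n) (v - p v) \<in> H" using AH[OF pH] subspace_null_comp subspace_neg by blast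
      then have z: "(A t ^^ ?n) (p v) = 0" using HW[of "(A t ^^ ?n) (p v)"] AW[OF pW[of v], where t = t and k = "?n"] unfolding e by blast
      have pp: "p (p v) = p v" by (simp add: p_def fp[unfolded p_def])
      have "(A t ^^ ?n) (p (p v)) + (p v - p (p v)) = 0" unfolding pp using z by simp
      then have "p v = 0" using d(2)[OF t] linear_inj_iff_eq_0[OF lG[of t]] by blast
      then show ?thesis using pH[of v] by simp
    qed
    then have sub: "null_comp (x + t *\<^sub>R y) \<subseteq> H" by (auto simp: null_comp_def A_def)
    moreover have "dim H \<le> dim (null_comp (x + t *\<^sub>R y))" using x by (auto simp: fitting_regular_def)
    ultimately have "null_comp (x + t *\<^sub>R y) = H"
      by (intro subspace_dim_equal subspace_null_comp)
    then have "h \<in> null_comp (x + t *\<^sub>R y)" using h by simp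
    then show ?thesis by (simp add: null_comp_def A_def)
  qed
  have "(br (y + s *\<^sub>R x) ^^ ?n) h = 0" if s: "s > 1 / d" for s
  proof -
    have s0: "s > 0" using s d(1) by (meson less_trans zero_less_divide_1_iff)
    have "y + s *\<^sub>R x = s *\<^sub>R (x + (1 / s) *\<^sub>R y)" using s0 by (simp add: scaleR_add_right)
    then have "br (y + s *\<^sub>R x) v = s *\<^sub>R A (1 / s) v" for v unfolding A_def by (simp only: br_simps)
    then have "(br (y + s *\<^sub>R x) ^^ k) h = s ^ k *\<^sub>R (A (1 / s) ^^ k) h" for k
      by (induction k) (auto simp: A_def br_simps)
    moreover have "(A (1 / s) ^^ ?n) h = 0"
      using s s0 d(1) by (intro small) (auto simp: divide_simps mult.commute)
    ultimately show ?thesis by simp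
  qed
  then have "{1 / d<..} \<subseteq> {s. (br (y + s *\<^sub>R x) ^^ ?n) h = 0}" by auto
  then have "infinite {s. (br (y + s *\<^sub>R x) ^^ ?n) h = 0}"
    by (rule infinite_super) (rule infinite_Ioi)
  then have "(br (y + 0 *\<^sub>R x) ^^ ?n) h = 0" by (rule poly_vec_zero[OF poly_vec_ad_pow])
  then show ?thesis by simp
qed

text \<open>By Engel's theorem a nonzero \<open>[H,H]\<close> contains a nonzero \<open>c\<close> centralizing \<open>H\<close>. All powers of
  \<open>ad c\<close> have trace zero, so \<open>ad c\<close> is nilpotent and \<open>c\<close> is Killing-orthogonal to \<open>H\<close>.\<close>

lemma H_abelian:
  assumes "u \<in> H" "v \<in> H"
  shows "br u v = 0"
proof (rule ccontr)
  assume nz: "br u v \<noteq> 0"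
  define C where "C = span {br a b |a b. a \<in> H \<and> b \<in> H}"
  have gen: "br a b \<in> C" if "a \<in> H" "b \<in> H" for a b
    unfolding C_def using that by (intro span_base) blast
  have CH: "C \<subseteq> H"
    unfolding C_def by (rule span_minimal[OF _ subspace_null_comp]) (auto simp: br_null_comp)
  have sC: "subspace C" unfolding C_def by (rule subspace_span)
  have "\<exists>c\<in>C - {0}. \<forall>y\<in>H. br y c \<in> {0}"
  proof (rule engel[OF subspace_null_comp br_null_comp order_refl _ subspace_single_0 sC _ _ CH])
    show "{0} \<noteq> C" using gen[OF assms] nz by blast
    show "{0} \<subseteq> C" using subspace_0[OF sC] by simp
    show "br y c \<in> {0}" if "c \<in> {0}" for y c using that by (simp add: br_simps)
    show "\<exists>n. \<forall>z\<in>H. (br y ^^ n) z = 0" if "y \<in> H" for y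
      using ad_nilpotent_on_H[OF that] by blast
    show "br y c \<in> C" if "y \<in> H" "c \<in> C" for y c
      by (rule gen[OF that(1) subsetD[OF CH that(2)]])
  qed
  then obtain c where c: "c \<in> C" "c \<noteq> 0" "\<And>y. y \<in> H \<Longrightarrow> br y c = 0" by blast
  have comm: "br c (br a v) = br a (br c v)" if "a \<in> H" for a v
    using jacobi[of a c v] c(3)[OF that] by (simp add: br_simps)
  have pow: "trace_endo (br c ^^ k) = 0" if k: "k \<ge> 1" for k
  proof -
    obtain j where j: "k = Suc j" using k by (cases k) auto
    \<comment> \<open>F vanishes on brackets of elements of H because ad c commutes with ad b. As c
      is a combination of such brackets, F c, the trace of the k-th power of ad c, is zero.\<close>
    define F where "F a = trace_endo (\<lambda>v. br a ((br c ^^ j) v))" for a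
    have lF: "linear F"
      unfolding F_def by (rule linearI) (simp_all add: br_simps trace_endo_add trace_endo_scale)
    have "F (br a b) = 0" if ab: "a \<in> H" "b \<in> H" for a b
    proof -
      have cb: "(br c ^^ j) (br b v) = br b ((br c ^^ j) v)" for v
        by (rule funpow_commute[where f = "br c" and g = "br b"]) (rule comm[OF ab(2)])
      have lin: "linear (\<lambda>v. br a ((br c ^^ j) v))"
        using linear_compose[OF linear_ad_pow linear_ad] by (simp add: o_def)
      have "trace_endo (\<lambda>v. br b (br a ((br c ^^ j) v))) = trace_endo (\<lambda>v. br a (br b ((br c ^^ j) v)))"
        using trace_endo_commute[OF linear_ad[of b] lin] unfolding cb .
      then show ?thesis by (simp add: F_def ad_br trace_endo_diff)
    qed
    then have "F y = 0" if "y \<in> {br a b |a b. a \<in> H \<and> b \<in> H}" for y using that by blast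
    then have "F c = 0"
      using linear_eq_0_on_span[of F "{br a b |a b. a \<in> H \<and> b \<in> H}" c] lF c(1) unfolding C_def by blast
    moreover have "br c ^^ k = (\<lambda>v. br c ((br c ^^ j) v))" by (simp add: j o_def)
    ultimately show ?thesis by (simp add: F_def)
  qed
  obtain n where n: "\<And>v. (br c ^^ n) v = 0"
    using nilpotent_if_power_traces_zero[OF linear_ad pow] by blast
  have "K c h = 0" if h: "h \<in> H" for h
  proof -
    have "((\<lambda>v. br c (br h v)) ^^ k) v = (br c ^^ k) ((br h ^^ k) v)" for k v
      by (rule funpow_compose_commute) (rule comm[OF h])
    then have "((\<lambda>v. br c (br h v)) ^^ n) v = 0" for v using n by simp
    moreover have "linear (\<lambda>v. br c (br h v))"
      using linear_compose[OF linear_ad linear_ad] by (simp add: o_def)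
    ultimately show ?thesis unfolding K_def' by (intro trace_endo_nilpotent) auto
  qed
  then have "c = 0" using c(1) CH by (intro killing_nondegenerate_null_comp[of c x]) auto
  then show False using c(2) by simp
qed

text \<open>The nilpotent part of \<open>ad x\<close> is a derivation of the complexification. It is inner, commutes with
  \<open>ad H\<close>, hence comes from \<open>H\<close>, and is Killing-orthogonal to \<open>H\<close>.\<close>

lemma ad_diagonalizable:
  obtains \<Lambda> N Q where "spectral (map_prod (br x) (br x)) \<Lambda> N Q"
    "\<And>l w. l \<in> \<Lambda> \<Longrightarrow> map_prod (br x) (br x) (pop (map_prod (br x) (br x)) (Q l) w)
       = cscale l (pop (map_prod (br x) (br x)) (Q l) w)"
proof -
  let ?D = "map_prod (br x) (br x)"
  have D: "clinear ?D" by (rule clinear_map_prod[OF linear_ad])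
  obtain \<Lambda> N Q where sp: "spectral ?D \<Lambda> N Q" using spectral_exists[OF D] by blast
  then interpret spectral ?D \<Lambda> N Q .
  \<comment> \<open>The values 1 and - \<i> of the scalar c recover the two real components of the
    nilpotent part.\<close>
  have re0: "re_part (\<lambda>w. cscale c (nil_part w)) u = 0" for c u
  proof -
    let ?F = "\<lambda>w. cscale c (nil_part w)"
    have F: "clinear ?F" by (rule clinear_compose[OF clinear_cscale clinear_nil_part])
    have "nil_part (brc v w) = brc (nil_part v) w + brc v (nil_part w)" for v w
      unfolding nil_part_def ad_brc
      by (subst spectral_sum_derivation[OF sp]) (simp_all add: brc_simps)
    then have "derivation br (re_part ?F)"
      by (intro derivation_re_part[OF F]) (simp add: brc_simps cscale_add_right)
    then obtain z where z: "re_part ?F = br z" using derivation_inner by blast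
    have comm: "nil_part (map_prod (br h) (br h) w) = map_prod (br h) (br h) (nil_part w)" if h: "h \<in> H" for h w
    proof -
      have "br h (br x v) = br x (br h v)" for v
        using jacobi[of h x v] H_abelian[OF h self_in_null_comp] by (simp add: br_simps)
      then have "map_prod (br h) (br h) (?D w) = ?D (map_prod (br h) (br h) w)" for w
        by (cases w) simp
      then show ?thesis using nil_part_commute[OF clinear_map_prod[OF linear_ad]] by simp
    qed
    have commF: "?F (map_prod (br h) (br h) w) = map_prod (br h) (br h) (?F w)" if "h \<in> H" for h w
      using comm[OF that] clinearD(2)[OF clinear_map_prod[OF linear_ad]] by simp
    have zb: "br z (br h v) = br h (br z v)" if "h \<in> H" for h v
    proof -
      have "re_part ?F (br h v) = br h (re_part ?F v)"
        using commF[OF that, of "(v, 0)"] unfolding re_part_def by (simp add: br_simps)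
      then show ?thesis unfolding z .
    qed
    \<comment> \<open>ad z and ad h commute, so [h, z] acts as zero, and the centre is
      trivial.\<close>
    have zh: "br h z = 0" if "h \<in> H" for h
      by (rule center_trivial) (simp only: ad_br zb[OF that] diff_self)
    have "br x z = 0" by (rule zh[OF self_in_null_comp])
    then have zH: "z \<in> H" by (intro null_compI[where k = 1]) simp
    have "K z h = 0" if h: "h \<in> H" for h
    proof -
      let ?E = "\<lambda>w. ?F (map_prod (br h) (br h) w)"
      have E: "clinear ?E" by (rule clinear_compose[OF F clinear_map_prod[OF linear_ad]])
      let ?G = "\<lambda>w. cscale c (map_prod (br h) (br h) w)"
      have G: "clinear ?G" by (rule clinear_compose[OF clinear_cscale clinear_map_prod[OF linear_ad]])
      have "?G (nil_part w) = nil_part (?G w)" for w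
        by (simp only: comm[OF h] clinearD(2)[OF clinear_nil_part])
      then have "((\<lambda>w. ?G (nil_part w)) ^^ N) w = (?G ^^ N) ((nil_part ^^ N) w)" for w
        by (rule funpow_compose_commute)
      moreover have "?E = (\<lambda>w. ?G (nil_part w))" by (simp only: comm[OF h])
      ultimately have "(?E ^^ N) w = 0" for w
        by (simp only: nil_part_nilpotent linear_0[OF linear_funpow[OF clinearD(1)[OF G]]])
      then have "trace_endo ?E = 0" by (rule trace_endo_nilpotent[OF clinearD(1)[OF E]])
      then have "trace_endo (re_part ?E) = 0" using trace_endo_clinear[OF E] by simp
      moreover have "re_part ?E = (\<lambda>v. br z (br h v))"
      proof
        fix v
        have "re_part ?E v = re_part ?F (br h v)" by (simp add: re_part_def br_simps)
        then show "re_part ?E v = br z (br h v)" unfolding z .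
      qed
      ultimately show ?thesis by (simp add: K_def')
    qed
    then have "z = 0" using killing_nondegenerate_null_comp[OF zH] by blast
    then show ?thesis using z by (simp add: br_simps)
  qed
  have "nil_part w = 0" for w
    using clinear_zero_if_re_part[OF clinear_nil_part] re0[of 1] re0[of "- \<i>"] by simp
  then have "?D w = spectral_sum (\<lambda>l. l) w" for w unfolding nil_part_def right_minus_eq .
  then have "?D (pop ?D (Q l) w) = cscale l (pop ?D (Q l) w)" if "l \<in> \<Lambda>" for l w
    using spectral_sum_apply[OF ann_proj[OF that], of "\<lambda>l. l" w] by (simp only:)
  then show thesis by (rule that[OF sp])
qed

text \<open>An invariant projection onto \<open>V\<close> arises from an arbitrary projection \<open>\<pi>\<close> as
  \<open>\<Sum>\<^sub>l P\<^sub>l \<pi> P\<^sub>l\<close>, followed by taking the real part.\<close>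

lemma semisimple_endo_ad: "semisimple_endo (br x)"
  unfolding semisimple_endo_def
proof (intro conjI allI impI linear_ad)
  fix V assume V: "subspace V \<and> br x ` V \<subseteq> V"
  let ?D = "map_prod (br x) (br x)"
  obtain \<Lambda> N Q where sp: "spectral ?D \<Lambda> N Q"
    and eig: "\<And>l w. l \<in> \<Lambda> \<Longrightarrow> ?D (pop ?D (Q l) w) = cscale l (pop ?D (Q l) w)"
    using ad_diagonalizable by blast
  interpret spectral ?D \<Lambda> N Q by (rule sp)
  obtain \<pi> where \<pi>: "linear \<pi>" "\<And>u. \<pi> u \<in> V" "\<And>u. u \<in> V \<Longrightarrow> \<pi> u = u"
    using orthogonal_projection_exists[OF conjunct1[OF V]] by metis
  define VC where "VC = {w. fst w \<in> V \<and> snd w \<in> V}"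
  have sVC: "subspace VC" using V by (auto simp: VC_def subspace_def)
  have cVC: "cscale z w \<in> VC" if "w \<in> VC" for z w
    using that V by (auto simp: VC_def cscale_def intro!: subspace_add subspace_diff subspace_mul)
  have DVC: "?D w \<in> VC" if "w \<in> VC" for w using that V by (auto simp: VC_def)
  have PVC: "pop ?D q w \<in> VC" if "w \<in> VC" for q w
    using pop_in_subspace[OF clinear_D sVC cVC DVC that] .
  define p where "p w = (\<Sum>l\<in>\<Lambda>. pop ?D (Q l) (map_prod \<pi> \<pi> (pop ?D (Q l) w)))" for w
  have cp: "clinear p"
    unfolding p_def by (intro clinear_sum clinear_compose[OF clinear_proj] clinear_compose[OF clinear_map_prod[OF \<pi>(1)]] clinear_proj)
  have pVC: "p w \<in> VC" for w
    unfolding p_def by (intro subspace_sum[OF sVC] PVC) (simp add: VC_def \<pi>(2))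
  have pid: "p w = w" if "w \<in> VC" for w
  proof -
    have "map_prod \<pi> \<pi> (pop ?D (Q l) w) = pop ?D (Q l) w" for l
      using PVC[OF that, of "Q l"] \<pi>(3) by (auto simp: VC_def prod_eq_iff)
    then have "p w = (\<Sum>l\<in>\<Lambda>. pop ?D (Q l) w)" unfolding p_def using proj_proj by (intro sum.cong) auto
    then show ?thesis by (simp add: sum_proj)
  qed
  have pD: "p (?D w) = ?D (p w)" for w
  proof -
    have comm: "pop ?D (Q l) (?D w) = cscale l (pop ?D (Q l) w)" if "l \<in> \<Lambda>" for l
      using pop_commute[OF clinear_D clinear_D, of "Q l" w] eig[OF that] by simp
    have "p (?D w) = (\<Sum>l\<in>\<Lambda>. cscale l (pop ?D (Q l) (map_prod \<pi> \<pi> (pop ?D (Q l) w))))"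
      unfolding p_def using comm
      by (intro sum.cong) (simp_all add: clinearD(2)[OF clinear_map_prod[OF \<pi>(1)]] clinearD(2)[OF clinear_proj])
    also have "\<dots> = ?D (p w)"
      unfolding p_def clinearD(8)[OF clinear_D] using eig by (intro sum.cong) auto
    finally show ?thesis .
  qed
  define A where "A = re_part p"
  have lA: "linear A" unfolding A_def by (rule linear_re_part[OF cp])
  have AV: "A u \<in> V" for u using pVC[of "(u, 0)"] by (simp add: A_def re_part_def VC_def)
  have Aid: "A u = u" if "u \<in> V" for u
    using pid[of "(u, 0)"] that subspace_0[OF conjunct1[OF V]] by (simp add: A_def re_part_def VC_def)
  have Abr: "A (br x u) = br x (A u)" for u
    using pD[of "(u, 0)"] unfolding A_def re_part_def by (simp add: br_simps)
  define W where "W = {u. A u = 0}"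
  have "subspace W" unfolding W_def by (rule linear_subspace_kernel[OF lA])
  moreover have "br x ` W \<subseteq> W" by (auto simp: W_def Abr br_simps)
  moreover have "V \<inter> W = {0}"
    using Aid V subspace_0[of V] linear_0[OF lA] by (auto simp: W_def)
  moreover have "{v + w |v w. v \<in> V \<and> w \<in> W} = UNIV"
  proof -
    have "u = A u + (u - A u) \<and> A u \<in> V \<and> u - A u \<in> W" for u
      using AV Aid by (simp add: W_def linear_diff[OF lA])
    then show ?thesis by blast
  qed
  ultimately show "\<exists>W. subspace W \<and> br x ` W \<subseteq> W \<and> V \<inter> W = {0} \<and> {v + w |v w. v \<in> V \<and> w \<in> W} = UNIV"
    by blast
qed

lemma centralizer_eq_H: "centralizer br x = H"
  using centralizer_subset_null_comp[of x] H_abelian[OF self_in_null_comp] by (auto simp: centralizer_def)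

end

section \<open>Identification of the regular elements\<close>

context semisimple_lie
begin

lemma fitting_regular_pointI: "x \<in> fitting_regular \<Longrightarrow> fitting_regular_point br x"
  by unfold_locales

text \<open>The definition is applied to the kernel of f: if f (f u) = 0, then f u lies both in the
  kernel and in its invariant complement.\<close>

lemma semisimple_endo_kernel:
  assumes "semisimple_endo f"
  shows "f (f u) = 0 \<Longrightarrow> f u = 0" "\<exists>v w. u = v + f w \<and> f v = 0"
proof -
  have f: "linear f" using assms by (simp add: semisimple_endo_def)
  show 1: "f u = 0" if "f (f u) = 0" for u
  proof -
    have "subspace {v. f v = 0}" by (rule linear_subspace_kernel[OF f])
    moreover have "f ` {v. f v = 0} \<subseteq> {v. f v = 0}" using linear_0[OF f] by auto
    ultimately obtain W where W: "f ` W \<subseteq> W" "{v. f v = 0} \<inter> W = {0}"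
      "{v + w | v w. v \<in> {v. f v = 0} \<and> w \<in> W} = UNIV"
      using assms unfolding semisimple_endo_def by blast
    have "u \<in> {v + w | v w. v \<in> {v. f v = 0} \<and> w \<in> W}" using W(3) by simp
    then obtain v w where "u = v + w" "f v = 0" "w \<in> W" by blast
    then have "f u \<in> W" using W(1) by (auto simp: linear_add[OF f])
    then show ?thesis using that W(2) by blast
  qed
  show "\<exists>v w. u = v + f w \<and> f v = 0"
  proof -
    obtain w where "f u = f (f w)" using range_eq_if_kernel_stable[OF f 1] by blast
    then show ?thesis by (intro exI[of _ "u - f w"] exI[of _ w]) (simp add: linear_diff[OF f])
  qed
qed

text \<open>The centralizer dimension cannot increase near y, and by density some z of minimal null
  component is near y. For such z the centralizer is the null component, whose dimension is the same
  for all of them.\<close>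

lemma dim_centralizer_ge:
  assumes "x \<in> fitting_regular"
  shows "dim (centralizer br x) \<le> dim (centralizer br y)"
proof -
  have "\<forall>\<^sub>F z in nhds y. dim (centralizer br z) \<le> dim (centralizer br y)"
    unfolding centralizer_def
    by (intro eventually_dim_kernel_le linear_ad tendsto_br tendsto_const) (simp add: filterlim_ident)
  then obtain S where S: "open S" "y \<in> S" "\<And>z. z \<in> S \<Longrightarrow> dim (centralizer br z) \<le> dim (centralizer br y)"
    unfolding eventually_nhds by blast
  have "S \<inter> fitting_regular \<noteq> {}"
    using open_Int_closure_eq_empty[OF S(1), of fitting_regular] S(2) closure_fitting_regular by auto
  then obtain z where z: "z \<in> S" "z \<in> fitting_regular" by blast
  have "dim (centralizer br x) = dim (centralizer br z)"
    unfolding fitting_regular_point.centralizer_eq_H[OF fitting_regular_pointI[OF assms]]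
      fitting_regular_point.centralizer_eq_H[OF fitting_regular_pointI[OF z(2)]]
    using assms z(2) by (simp add: fitting_regular_def le_antisym)
  then show ?thesis using S(3)[OF z(1)] by simp
qed

text \<open>For a regular x semisimplicity collapses the null component to the centralizer, and
  comparison with one element of \<open>fitting_regular\<close> shows its dimension to be
  minimal.\<close>

lemma regular_elements_eq: "regular_elements br = fitting_regular"
proof
  show "fitting_regular \<subseteq> regular_elements br"
    unfolding regular_elements_def
    by (intro subsetI CollectI conjI allI dim_centralizer_ge
        fitting_regular_point.semisimple_endo_ad[OF fitting_regular_pointI])
  show "regular_elements br \<subseteq> fitting_regular"
  proof
    fix x assume x: "x \<in> regular_elements br"
    have ker: "br x v = 0" if "(br x ^^ k) v = 0" for k v
      using that
    proof (induction k)
      case 0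
      then show ?case by (simp add: br_simps)
    next
      case (Suc k)
      show ?case
      proof (cases k)
        case 0
        then show ?thesis using Suc.prems by simp
      next
        case (Suc j)
        have "br x (br x ((br x ^^ j) v)) = 0" using Suc.prems Suc by simp
        then have "br x ((br x ^^ j) v) = 0"
          using semisimple_endo_kernel(1) x unfolding regular_elements_def by blast
        then show ?thesis using Suc.IH Suc by simp
      qed
    qed
    then have "null_comp x = centralizer br x"
      using centralizer_subset_null_comp[of x] by (auto simp: null_comp_def centralizer_def)
    moreover obtain z where z: "z \<in> fitting_regular" using fitting_regular_nonempty by blast
    moreover have "dim (centralizer br x) \<le> dim (centralizer br z)" using x by (simp add: regular_elements_def)
    moreover have "centralizer br z = null_comp z"
      by (rule fitting_regular_point.centralizer_eq_H[OF fitting_regular_pointI[OF z]])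
    ultimately show "x \<in> fitting_regular" unfolding fitting_regular_def by (auto intro: le_trans)
  qed
qed

lemma open_regular: "open (regular_elements br)"
  and closure_regular: "closure (regular_elements br) = UNIV"
  unfolding regular_elements_eq by (rule open_fitting_regular closure_fitting_regular)+

lemma centralizer_abelian:
  assumes "x \<in> regular_elements br" "u \<in> centralizer br x" "v \<in> centralizer br x"
  shows "br u v = 0"
proof -
  interpret fitting_regular_point br x
    using assms(1) unfolding regular_elements_eq by (rule fitting_regular_pointI)
  show ?thesis using H_abelian assms(2,3) unfolding centralizer_eq_H by blast
qed

lemma regular_diagonalizable:
  assumes "x \<in> regular_elements br"
  obtains \<Lambda> N Q where "spectral (map_prod (br x) (br x)) \<Lambda> N Q"
    "\<And>l w. l \<in> \<Lambda> \<Longrightarrow> map_prod (br x) (br x) (pop (map_prod (br x) (br x)) (Q l) w)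
       = cscale l (pop (map_prod (br x) (br x)) (Q l) w)"
  using fitting_regular_point.ad_diagonalizable[OF fitting_regular_pointI] assms
  unfolding regular_elements_eq by blast

lemma regular_decomposition:
  assumes "x \<in> regular_elements br"
  obtains h w where "v = h + br x w" "h \<in> centralizer br x"
  using semisimple_endo_kernel(2)[of "br x" v] assms
  unfolding regular_elements_def centralizer_def by blast

end

section \<open>The exponential of an endomorphism\<close>

definition flow :: "('a::euclidean_space \<Rightarrow> 'a) \<Rightarrow> real \<Rightarrow> 'a \<Rightarrow> 'a" where
  "flow f t = endo_exp (\<lambda>v. t *\<^sub>R f v)"

lemma summable_endo_exp:
  fixes f :: "'a::euclidean_space \<Rightarrow> 'a"
  assumes "linear f"
  shows "summable (\<lambda>n. (f ^^ n) y /\<^sub>R fact n)"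
proof -
  obtain B where B: "B > 0" "\<And>x. norm (f x) \<le> B * norm x"
    using linear_bounded_pos[OF assms] by blast
  have "norm ((f ^^ n) y) \<le> B ^ n * norm y" for n
  proof (induction n)
    case (Suc n)
    have "norm ((f ^^ Suc n) y) \<le> B * norm ((f ^^ n) y)" using B(2) by simp
    also have "\<dots> \<le> B * (B ^ n * norm y)" using Suc B(1) by (intro mult_left_mono) auto
    finally show ?case by (simp add: mult.assoc)
  qed simp
  then have le: "norm ((f ^^ n) y /\<^sub>R fact n) \<le> B ^ n /\<^sub>R fact n * norm y" for n
    by (simp add: divide_simps mult.commute)
  have "summable (\<lambda>n. B ^ n /\<^sub>R fact n * norm y)"
    by (intro summable_mult2 summable_exp_generic)
  then show ?thesis by (rule summable_comparison_test'[where N = 0]) (rule le)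
qed

lemma funpow_scaleR:
  fixes f :: "'a::real_vector \<Rightarrow> 'a"
  assumes "linear f"
  shows "((\<lambda>v. t *\<^sub>R f v) ^^ n) y = t ^ n *\<^sub>R (f ^^ n) y"
  by (induction n) (simp_all add: linear_scale[OF assms])

context
  fixes f :: "'a::euclidean_space \<Rightarrow> 'a"
  assumes f: "linear f"
begin

lemma linear_scaled: "linear (\<lambda>v. t *\<^sub>R f v)"
  by (rule linearI) (simp_all add: linear_add[OF f] linear_scale[OF f] scaleR_add_right)

text \<open>Coordinates turn the exponential into a real power series in t, which can be
  differentiated term by term.\<close>

lemma flow_inner: "flow f t y \<bullet> b = (\<Sum>n. ((f ^^ n) y \<bullet> b / fact n) * t ^ n)"
  unfolding flow_def endo_exp_def
  by (subst bounded_linear.suminf[OF bounded_linear_inner_left summable_endo_exp[OF linear_scaled]])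
    (simp add: funpow_scaleR[OF f] field_simps)

lemma summable_flow_inner: "summable (\<lambda>n. ((f ^^ n) y \<bullet> b / fact n) * t ^ n)"
  using bounded_linear.summable[OF bounded_linear_inner_left[of b] summable_endo_exp[OF linear_scaled[of t], of y]]
  by (simp add: funpow_scaleR[OF f] field_simps)

lemma flow_0: "flow f 0 y = y"
proof (rule euclidean_eqI)
  fix b :: 'a
  show "flow f 0 y \<bullet> b = y \<bullet> b"
    unfolding flow_inner powser_zero by simp
qed

lemma linear_flow: "linear (flow f t)"
proof (rule linearI)
  show "flow f t (x + y) = flow f t x + flow f t y" for x y
    unfolding flow_def endo_exp_def
    by (subst suminf_add[OF summable_endo_exp[OF linear_scaled] summable_endo_exp[OF linear_scaled]])
      (simp add: linear_add[OF linear_funpow[OF linear_scaled]] scaleR_add_right)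
  show "flow f t (r *\<^sub>R x) = r *\<^sub>R flow f t x" for r x
    unfolding flow_def endo_exp_def
    by (subst suminf_scaleR_right[OF summable_endo_exp[OF linear_scaled]])
      (simp add: linear_scale[OF linear_funpow[OF linear_scaled]] mult.commute)
qed

lemma flow_commute: "f (flow f t y) = flow f t (f y)"
proof -
  have "((\<lambda>v. t *\<^sub>R f v) ^^ n) (f y) = f (((\<lambda>v. t *\<^sub>R f v) ^^ n) y)" for n
    by (rule funpow_commute[where f = "\<lambda>v. t *\<^sub>R f v" and g = f]) (simp add: linear_scale[OF f])
  moreover have "bounded_linear f" using f by (simp add: linear_conv_bounded_linear)
  ultimately show ?thesis
    unfolding flow_def endo_exp_def
    by (subst bounded_linear.suminf[OF _ summable_endo_exp[OF linear_scaled]])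
      (simp_all add: linear_scale[OF f])
qed

lemma flow_has_vector_derivative: "((\<lambda>t. flow f t y) has_vector_derivative flow f t (f y)) (at t)"
proof -
  have "((\<lambda>t. flow f t y \<bullet> b) has_real_derivative flow f t (f y) \<bullet> b) (at t)" for b
  proof -
    let ?c = "\<lambda>n. (f ^^ n) y \<bullet> b / fact n"
    have "diffs ?c = (\<lambda>n. (f ^^ n) (f y) \<bullet> b / fact n)"
      by (rule ext) (simp add: diffs_def funpow_swap1 del: of_nat_Suc)
    then show ?thesis
      unfolding flow_inner
      using termdiffs_strong_converges_everywhere[OF summable_flow_inner, of y b t] by simp
  qed
  moreover have "(\<lambda>s. (s *\<^sub>R v) \<bullet> b) = (*) (v \<bullet> b)" for v b :: 'a
    by (rule ext) simp
  ultimately show ?thesis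
    unfolding has_vector_derivative_def
    by (subst has_derivative_componentwise_within) (simp only: has_field_derivative_def, simp)
qed

lemma flow_moving_has_vector_derivative:
  assumes "(u has_vector_derivative u') (at t)"
  shows "((\<lambda>s. flow f s (u s)) has_vector_derivative flow f t (f (u t)) + flow f t u') (at t)"
proof -
  have rep: "L v = (\<Sum>b\<in>Basis. (v \<bullet> b) *\<^sub>R L b)" if "linear L" for L :: "'a \<Rightarrow> 'a" and v
    by (subst euclidean_representation[of v, symmetric]) (simp only: linear_sum[OF that] linear_scale[OF that])
  have lff: "linear (\<lambda>v. flow f t (f v))"
    using linear_compose[OF f linear_flow] by (simp add: o_def)
  have ub: "((\<lambda>s. u s \<bullet> b) has_vector_derivative u' \<bullet> b) (at t)" for b
    using bounded_linear.has_vector_derivative[OF bounded_linear_inner_left assms] .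
  have "((\<lambda>s. \<Sum>b\<in>Basis. (u s \<bullet> b) *\<^sub>R flow f s b) has_vector_derivative
      (\<Sum>b\<in>Basis. (u t \<bullet> b) *\<^sub>R flow f t (f b) + (u' \<bullet> b) *\<^sub>R flow f t b)) (at t)"
    by (intro has_vector_derivative_sum bounded_bilinear.has_vector_derivative[OF bounded_bilinear_scaleR ub flow_has_vector_derivative])
  moreover have "(\<lambda>s. \<Sum>b\<in>Basis. (u s \<bullet> b) *\<^sub>R flow f s b) = (\<lambda>s. flow f s (u s))"
    by (rule ext) (rule rep[OF linear_flow, symmetric])
  moreover have "(\<Sum>b\<in>Basis. (u t \<bullet> b) *\<^sub>R flow f t (f b) + (u' \<bullet> b) *\<^sub>R flow f t b)
     = flow f t (f (u t)) + flow f t u'"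
    unfolding rep[OF lff, of "u t"] rep[OF linear_flow, of t u'] by (rule sum.distrib)
  ultimately show ?thesis by simp
qed

end

lemma flow_inverse:
  fixes f :: "'a::euclidean_space \<Rightarrow> 'a"
  assumes f: "linear f"
  shows "flow (\<lambda>v. - f v) t (flow f t y) = y"
proof -
  let ?g = "\<lambda>v. - f v"
  have g: "linear ?g" by (rule linearI) (simp_all add: linear_add[OF f] linear_scale[OF f])
  have "((\<lambda>s. flow ?g s (flow f s y)) has_vector_derivative 0) (at s)" for s
  proof -
    have "flow ?g s (?g (flow f s y)) + flow ?g s (flow f s (f y)) = 0"
      using linear_neg[OF linear_flow[OF g]] by (simp add: flow_commute[OF f])
    then show ?thesis
      using flow_moving_has_vector_derivative[OF g flow_has_vector_derivative[OF f, of y s]] by simp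
  qed
  then obtain c where "\<And>s. flow ?g s (flow f s y) = c"
    using has_vector_derivative_zero_constant[of UNIV "\<lambda>s. flow ?g s (flow f s y)"] by auto
  from this[of t] this[of 0] show ?thesis by (simp add: flow_0[OF f] flow_0[OF g])
qed

section \<open>Automorphisms of the Lie algebra\<close>

definition lie_automorphism :: "('a::euclidean_space \<Rightarrow> 'a \<Rightarrow> 'a) \<Rightarrow> ('a \<Rightarrow> 'a) \<Rightarrow> bool" where
  "lie_automorphism br g \<longleftrightarrow> linear g \<and> bij g \<and> (\<forall>x y. g (br x y) = br (g x) (g y))"

context lie
begin

lemma has_vector_derivative_br:
  assumes "(u has_vector_derivative u') (at t)" "(v has_vector_derivative v') (at t)"
  shows "((\<lambda>s. br (u s) (v s)) has_vector_derivative br (u t) v' + br u' (v t)) (at t)"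
  by (rule bounded_bilinear.has_vector_derivative[OF bilinear_conv_bounded_bilinear[THEN iffD1, OF bilinear] assms])

text \<open>Conjugating back, exp (-s ad w) [exp (s ad w) y, exp (s ad w) z] has derivative zero in
  s by the Jacobi identity, and equals [y, z] at s = 0.\<close>

lemma flow_automorphism: "lie_automorphism br (flow (br w) t)"
proof -
  let ?E = "flow (br w)" and ?g = "\<lambda>v. - br w v"
  have g: "linear ?g" by (rule linearI) (simp_all add: br_simps)
  have inv1: "flow ?g t (?E t y) = y" for t y by (rule flow_inverse[OF linear_ad])
  have inv2: "?E t (flow ?g t y) = y" for t y using flow_inverse[OF g, of t y] by simp
  have bij: "bij (?E t)" by (rule bijI') (use inv1 inv2 in metis)+
  have "flow ?g t (br (?E t y) (?E t z)) = br y z" for y z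
  proof -
    let ?h = "\<lambda>s. flow ?g s (br (?E s y) (?E s z))"
    have "(?h has_vector_derivative 0) (at s)" for s
    proof -
      let ?u = "?E s y" and ?v = "?E s z"
      have "((\<lambda>s. br (?E s y) (?E s z)) has_vector_derivative br ?u (br w ?v) + br (br w ?u) ?v) (at s)"
        unfolding flow_commute[OF linear_ad]
        by (intro has_vector_derivative_br flow_has_vector_derivative linear_ad)
      from flow_moving_has_vector_derivative[OF g this]
      have "(?h has_vector_derivative flow ?g s (- br w (br ?u ?v)) + flow ?g s (br ?u (br w ?v) + br (br w ?u) ?v)) (at s)" .
      moreover have "flow ?g s (- br w (br ?u ?v)) + flow ?g s (br ?u (br w ?v) + br (br w ?u) ?v) = 0"
        unfolding linear_add[OF linear_flow[OF g], symmetric] jacobi[of w ?u ?v]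
        by (simp add: linear_0[OF linear_flow[OF g]])
      ultimately show ?thesis by simp
    qed
    then obtain c where "\<And>s. ?h s = c"
      using has_vector_derivative_zero_constant[of UNIV ?h] by auto
    from this[of t] this[of 0] show ?thesis by (simp add: flow_0[OF linear_ad] flow_0[OF g])
  qed
  then have "?E t (flow ?g t (br (?E t y) (?E t z))) = ?E t (br y z)" for y z by (simp only:)
  then have "?E t (br y z) = br (?E t y) (?E t z)" for y z unfolding inv2 by (rule sym)
  then show ?thesis using bij linear_flow[OF linear_ad] by (auto simp: lie_automorphism_def)
qed

lemma endo_exp_ad: "endo_exp (br (t *\<^sub>R w)) = flow (br w) t"
proof -
  have "br (t *\<^sub>R w) = (\<lambda>v. t *\<^sub>R br w v)" by (rule ext) (simp add: br_simps)
  then show ?thesis by (simp add: flow_def)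
qed

lemma adjoint_group_automorphism:
  assumes "g \<in> adjoint_group br" shows "lie_automorphism br g"
  using assms
proof induction
  case 1
  show ?case
    by (simp add: lie_automorphism_def id_def linear_id[unfolded id_def] bij_id[unfolded id_def])
next
  case (2 g x)
  have "lie_automorphism br (endo_exp (br x))"
    using flow_automorphism[of x 1] endo_exp_ad[of 1 x] by simp
  then show ?case
    using 2(2) linear_compose[of g "endo_exp (br x)"] bij_comp[of g "endo_exp (br x)"]
    unfolding lie_automorphism_def o_apply by auto
qed

lemma automorphismD:
  assumes "lie_automorphism br g"
  shows "linear g" "bij g" "g (br x y) = br (g x) (g y)"
  using assms by (auto simp: lie_automorphism_def)

lemma automorphism_inv:
  assumes g: "lie_automorphism br g"
  shows "lie_automorphism br (inv g)"
proof -
  note gi = bij_is_inj[OF automorphismD(2)[OF g]] bij_is_surj[OF automorphismD(2)[OF g]]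
  have fi: "g (inv g y) = y" for y using gi(2) by (simp add: surj_f_inv_f)
  have if': "inv g (g y) = y" for y using gi(1) by simp
  have "inv g (br x y) = br (inv g x) (inv g y)" for x y
    by (metis automorphismD(3)[OF g] fi if')
  moreover have "linear (inv g)"
  proof (rule linearI)
    show "inv g (x + y) = inv g x + inv g y" for x y
      by (metis linear_add[OF automorphismD(1)[OF g]] fi if')
    show "inv g (c *\<^sub>R x) = c *\<^sub>R inv g x" for c x
      by (metis linear_scale[OF automorphismD(1)[OF g]] fi if')
  qed
  ultimately show ?thesis
    using automorphismD(2)[OF g] by (simp add: lie_automorphism_def bij_imp_bij_inv)
qed

lemma killing_automorphism:
  assumes g: "lie_automorphism br g"
  shows "K (g u) (g v) = K u v"
proof -
  have fi: "g (inv g y) = y" for y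
    using bij_is_surj[OF automorphismD(2)[OF g]] by (simp add: surj_f_inv_f)
  have if': "inv g (g y) = y" for y
    using bij_is_inj[OF automorphismD(2)[OF g]] by simp
  have "K (g u) (g v) = trace_endo (\<lambda>z. g (br u (br v (inv g z))))"
    unfolding K_def' using fi by (simp add: automorphismD(3)[OF g])
  also have "\<dots> = trace_endo (\<lambda>z. br u (br v (inv g (g z))))"
  proof (rule trace_endo_commute[OF automorphismD(1)[OF g]])
    show "linear (\<lambda>z. br u (br v (inv g z)))"
      using linear_compose[OF linear_compose[OF automorphismD(1)[OF automorphism_inv[OF g]] linear_ad[of v]] linear_ad[of u]]
      by (simp add: o_def)
  qed
  finally show ?thesis by (simp add: K_def' if')
qed

lemma killing_automorphism_right:
  assumes g: "lie_automorphism br g"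
  shows "K u (g v) = K (inv g u) v"
proof -
  have "g (inv g u) = u" using bij_is_surj[OF automorphismD(2)[OF g]] by (simp add: surj_f_inv_f)
  then show ?thesis using killing_automorphism[OF g, of "inv g u" v] by simp
qed

lemma fitting_regular_automorphism:
  assumes g: "lie_automorphism br g" and x: "x \<in> fitting_regular"
  shows "g x \<in> fitting_regular"
proof -
  have pow: "(br (g x) ^^ k) (g v) = g ((br x ^^ k) v)" for k v
    by (induction k) (simp_all add: automorphismD(3)[OF g])
  have inj: "inj g" and surj: "surj g" using automorphismD(2)[OF g] by (auto simp: bij_def)
  have "g v = 0 \<longleftrightarrow> v = 0" for v using inj linear_0[OF automorphismD(1)[OF g]] by (metis injD)
  then have "v \<in> null_comp x \<longleftrightarrow> g v \<in> null_comp (g x)" for v by (simp add: null_comp_def pow)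
  then have "null_comp (g x) = g ` null_comp x" using surj by (auto simp: image_iff) (metis surjD)
  then have "dim (null_comp (g x)) = dim (null_comp x)"
    using dim_image_eq[OF automorphismD(1)[OF g]] inj by (metis inj_on_subset subset_UNIV)
  then show ?thesis using x by (simp add: fitting_regular_def)
qed

end

section \<open>Co-adjoint orbits\<close>

context semisimple_lie
begin

abbreviation \<iota> :: "'a \<Rightarrow> ('a \<Rightarrow>\<^sub>L real)" where "\<iota> \<equiv> killing_iso br"

definition \<kappa> :: "('a \<Rightarrow>\<^sub>L real) \<Rightarrow> 'a" where "\<kappa> = inv \<iota>"

lemma \<iota>_apply [simp]: "blinfun_apply (\<iota> x) y = K x y"
  unfolding killing_iso_def
  using linear_K by (simp add: bounded_linear_Blinfun_apply linear_conv_bounded_linear)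

lemma linear_\<iota>: "linear \<iota>"
  by (rule linearI) (auto intro!: blinfun_eqI simp: K_simps plus_blinfun.rep_eq scaleR_blinfun.rep_eq)

lemma bij_\<iota>: "bij \<iota>"
proof (rule bijI)
  have "x = 0" if "\<iota> x = 0" for x
  proof (rule killing_nondegenerate)
    show "K x y = 0" for y using arg_cong[OF that, of "\<lambda>b. blinfun_apply b y"] by simp
  qed
  then show "inj \<iota>" using linear_injective_0[OF linear_\<iota>] by blast
  have "\<xi> \<in> range \<iota>" for \<xi>
  proof -
    have "linear (blinfun_apply \<xi>)" by (rule bounded_linear.linear[OF blinfun.bounded_linear_right])
    then obtain z where "K z = blinfun_apply \<xi>" using killing_represents by blast
    then have "\<iota> z = \<xi>" by (intro blinfun_eqI) simp
    then show ?thesis by blast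
  qed
  then show "surj \<iota>" by blast
qed

lemma \<kappa>_\<iota> [simp]: "\<kappa> (\<iota> x) = x" and \<iota>_\<kappa> [simp]: "\<iota> (\<kappa> \<xi>) = \<xi>"
  using bij_\<iota> by (auto simp: \<kappa>_def bij_def surj_f_inv_f)

lemma \<iota>_eq_iff [simp]: "\<iota> x = \<iota> y \<longleftrightarrow> x = y"
  by (metis \<kappa>_\<iota>)

lemma bounded_linear_\<iota>: "bounded_linear \<iota>"
  using linear_\<iota> by (simp add: linear_conv_bounded_linear)

lemma linear_\<kappa>: "linear \<kappa>"
proof (rule linearI)
  show "\<kappa> (a + b) = \<kappa> a + \<kappa> b" for a b
    by (metis \<iota>_\<kappa> \<kappa>_\<iota> linear_add[OF linear_\<iota>])
  show "\<kappa> (c *\<^sub>R a) = c *\<^sub>R \<kappa> a" for c a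
    by (metis \<iota>_\<kappa> \<kappa>_\<iota> linear_scale[OF linear_\<iota>])
qed

text \<open>The norm of \<xi> bounds its values on the basis. These are the numbers K (\<kappa>
  \<xi>) b, and the injective map B that collects them is bounded below.\<close>

lemma bounded_linear_\<kappa>: "bounded_linear \<kappa>"
proof -
  define B where "B z = (\<Sum>b\<in>Basis. K z b *\<^sub>R b)" for z
  have lB: "linear B"
    unfolding B_def by (rule linearI) (simp_all add: K_simps scaleR_add_left sum.distrib scaleR_sum_right)
  have "z = 0" if "B z = 0" for z
  proof (rule killing_nondegenerate)
    have "K z b = B z \<bullet> b" if "b \<in> Basis" for b
      unfolding B_def using that by (simp add: inner_sum_left_Basis)
    then have "K z = (\<lambda>_. 0)" using that by (intro linear_eq_stdbasis[OF linear_K linear_zero]) simp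
    then show "K z y = 0" for y by simp
  qed
  then have "inj B" using linear_inj_iff_eq_0[OF lB] by blast
  then obtain c where c: "c > 0" "\<And>z. c * norm z \<le> norm (B z)"
    using linear_inj_bounded_below_pos[OF lB] by blast
  have "norm (\<kappa> \<xi>) \<le> norm \<xi> * (DIM('a) / c)" for \<xi>
  proof -
    have "c * norm (\<kappa> \<xi>) \<le> (\<Sum>b\<in>Basis. norm (K (\<kappa> \<xi>) b *\<^sub>R b))"
      using c(2)[of "\<kappa> \<xi>"] norm_sum order_trans unfolding B_def by blast
    also have "\<dots> \<le> (\<Sum>b\<in>(Basis :: 'a set). norm \<xi>)"
    proof (rule sum_mono)
      fix b :: 'a assume "b \<in> Basis"
      then show "norm (K (\<kappa> \<xi>) b *\<^sub>R b) \<le> norm \<xi>"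
        using norm_blinfun[of \<xi> b] by (simp flip: \<iota>_apply)
    qed
    finally show ?thesis using c(1) by (simp add: divide_simps mult.commute)
  qed
  then show ?thesis
    by (intro bounded_linear_intro[of \<kappa> "DIM('a) / c"]) (simp_all add: linear_add[OF linear_\<kappa>] linear_scale[OF linear_\<kappa>])
qed

lemma continuous_on_\<iota>: "continuous_on S \<iota>" and continuous_on_\<kappa>: "continuous_on T \<kappa>"
  using bounded_linear_\<iota> bounded_linear_\<kappa> by (simp_all add: linear_continuous_on)

lemma \<iota>_image_eq_vimage: "\<iota> ` S = \<kappa> -` S"
  by (auto simp: image_iff) (metis \<iota>_\<kappa>)

lemma open_\<iota>_image: "open S \<Longrightarrow> open (\<iota> ` S)"
  unfolding \<iota>_image_eq_vimage by (rule open_vimage[OF _ continuous_on_\<kappa>])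

lemma killing_dual_\<iota>: "killing_dual br (\<iota> u) (\<iota> v) = K u v"
  unfolding killing_dual_def \<kappa>_def[symmetric] by simp

lemma star_regular_iff: "star_regular br \<xi> \<longleftrightarrow> \<kappa> \<xi> \<in> regular_elements br"
  by (simp add: star_regular_def \<kappa>_def)

lemma regular_automorphism:
  "lie_automorphism br g \<Longrightarrow> x \<in> regular_elements br \<Longrightarrow> g x \<in> regular_elements br"
  unfolding regular_elements_eq by (rule fitting_regular_automorphism)

lemma \<iota>_comp_automorphism:
  assumes "lie_automorphism br g"
  shows "Blinfun (blinfun_apply (\<iota> x) \<circ> g) = \<iota> (inv g x)"
proof -
  have "blinfun_apply (\<iota> x) \<circ> g = K (inv g x)"
    by (rule ext) (simp add: killing_automorphism_right[OF assms])
  then show ?thesis by (simp add: killing_iso_def)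
qed

lemma coadjoint_orbit_\<iota>: "coadjoint_orbit br (\<iota> x) = {\<iota> (inv g x) |g. g \<in> adjoint_group br}"
  unfolding coadjoint_orbit_def
  by (intro Collect_cong ex_cong1 rev_conj_cong refl)
    (simp only: \<iota>_comp_automorphism[OF adjoint_group_automorphism])

lemma inv_adjoint_regular:
  assumes "g \<in> adjoint_group br" "x \<in> regular_elements br"
  shows "inv g x \<in> regular_elements br"
  by (rule regular_automorphism[OF automorphism_inv[OF adjoint_group_automorphism[OF assms(1)]] assms(2)])

lemma \<iota>_in_coadjoint_orbit: "\<iota> x \<in> coadjoint_orbit br (\<iota> x)"
  unfolding coadjoint_orbit_\<iota> using adjoint_group.intros(1)[of br]
  by (intro CollectI exI[of _ id]) simp

lemma coadjoint_orbit_subset: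
  assumes "x \<in> regular_elements br"
  shows "coadjoint_orbit br (\<iota> x) \<subseteq> \<iota> ` regular_elements br"
  unfolding coadjoint_orbit_\<iota> using inv_adjoint_regular[OF _ assms] by blast

lemma regular_dual_eq: "regular_dual br = \<iota> ` regular_elements br"
proof
  show "regular_dual br \<subseteq> \<iota> ` regular_elements br"
  proof
    fix \<mu> assume "\<mu> \<in> regular_dual br"
    then obtain \<xi> where \<xi>: "\<kappa> \<xi> \<in> regular_elements br" "\<mu> \<in> coadjoint_orbit br \<xi>"
      unfolding regular_dual_def star_regular_iff by blast
    then show "\<mu> \<in> \<iota> ` regular_elements br" using coadjoint_orbit_subset[OF \<xi>(1)] by (simp add: subset_iff)
  qed
  show "\<iota> ` regular_elements br \<subseteq> regular_dual br"
  proof clarify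
    fix x assume "x \<in> regular_elements br"
    then have "star_regular br (\<iota> x)" by (simp add: star_regular_iff)
    then show "\<iota> x \<in> regular_dual br"
      unfolding regular_dual_def using \<iota>_in_coadjoint_orbit by blast
  qed
qed

lemma Ck_on_flow: "Ck_on k U (\<lambda>t. \<iota> (flow (br w) t y))"
proof (induction k arbitrary: y)
  have der: "((\<lambda>t. \<iota> (flow (br w) t y)) has_vector_derivative \<iota> (flow (br w) t (br w y))) (at t)" for t y
    by (rule bounded_linear.has_vector_derivative[OF bounded_linear_\<iota> flow_has_vector_derivative[OF linear_ad]])
  {
    case 0
    show ?case
      using der by (auto intro!: continuous_at_imp_continuous_on has_vector_derivative_continuous)
  next
    case (Suc k)
    have "frechet_derivative (\<lambda>t. \<iota> (flow (br w) t y)) (at t) v = \<iota> (flow (br w) t (br w (v *\<^sub>R y)))" for t v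
    proof -
      have "(\<lambda>s. s *\<^sub>R \<iota> (flow (br w) t (br w y))) = frechet_derivative (\<lambda>t. \<iota> (flow (br w) t y)) (at t)"
        by (rule frechet_derivative_at) (rule der[unfolded has_vector_derivative_def])
      then have "frechet_derivative (\<lambda>t. \<iota> (flow (br w) t y)) (at t) v = v *\<^sub>R \<iota> (flow (br w) t (br w y))"
        by metis
      then show ?thesis
        by (simp add: br_simps linear_scale[OF linear_\<iota>] linear_scale[OF linear_flow[OF linear_ad]])
    qed
    then show ?case using Suc differentiableI_vector[OF der] by simp
  }
qed

lemma Ck_on_continuous: "Ck_on k U f \<Longrightarrow> continuous_on U f"
  by (cases k) (auto intro!: continuous_at_imp_continuous_on differentiable_imp_continuous_within)

subsection \<open>The tangent space of a regular orbit\<close>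

lemma pop_conjugate:
  assumes "clinear D" "clinear D'" "clinear G" "\<And>w. G (D w) = D' (G w)"
  shows "G (pop D p w) = pop D' p (G w)"
  by (induction p) (simp_all add: pop_pCons assms clinearD)

text \<open>First-order perturbation theory: the derivative of \<open>p(ad y(t))\<close>, compressed to an eigenspace.\<close>

lemma pop_has_vector_derivative:
  assumes y: "(y has_vector_derivative b) (at t)" and l: "map_prod (br (y t)) (br (y t)) w = cscale l w"
    and P: "clinear P" "\<And>w. P (map_prod (br (y t)) (br (y t)) w) = cscale l (P w)"
  shows "\<exists>d. ((\<lambda>s. pop (map_prod (br (y s)) (br (y s))) p w) has_vector_derivative d) (at t)
    \<and> P d = cscale (poly (pderiv p) l) (P (map_prod (br b) (br b) w))"
proof (induction p)
  case 0
  show ?case using P(1) by (intro exI[of _ 0]) (simp add: clinearD)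
next
  case (pCons a p)
  let ?D = "\<lambda>s. map_prod (br (y s)) (br (y s))" and ?B = "map_prod (br b) (br b)"
  have D: "clinear (?D s)" and B: "clinear ?B" for s by (rule clinear_map_prod[OF linear_ad])+
  have popw: "pop (?D t) p w = cscale (poly p l) w"
    by (induction p) (simp_all add: pop_pCons[OF D] clinearD[OF D] l cscale_cscale cscale_add_left mult.commute)
  obtain d where d: "((\<lambda>s. pop (?D s) p w) has_vector_derivative d) (at t)"
    "P d = cscale (poly (pderiv p) l) (P (?B w))" using pCons.IH by blast
  let ?u = "\<lambda>s. pop (?D s) p w"
  have "((\<lambda>s. (br (y s) (fst (?u s)), br (y s) (snd (?u s)))) has_vector_derivative
      (br (y t) (fst d) + br b (fst (?u t)), br (y t) (snd d) + br b (snd (?u t)))) (at t)"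
    by (intro has_vector_derivative_Pair has_vector_derivative_br y
      bounded_linear.has_vector_derivative[OF bounded_linear_fst d(1)]
      bounded_linear.has_vector_derivative[OF bounded_linear_snd d(1)])
  then have "((\<lambda>s. ?D s (?u s)) has_vector_derivative ?D t d + ?B (?u t)) (at t)"
    by (simp add: map_prod_def case_prod_beta)
  then have "((\<lambda>s. pop (?D s) (pCons a p) w) has_vector_derivative 0 + (?D t d + ?B (?u t))) (at t)"
    unfolding pop_pCons[OF D] by (intro has_vector_derivative_add has_vector_derivative_const)
  moreover have "P (0 + (?D t d + ?B (?u t))) = cscale (poly (pderiv (pCons a p)) l) (P (?B w))"
    unfolding popw add_0
    by (simp add: clinearD[OF P(1)] P(2) d(2) clinearD(2)[OF B] pderiv_pCons cscale_add_left cscale_cscale add.commute)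
  ultimately show ?case by blast
qed

lemma orbit_curve_velocity:
  assumes x: "x \<in> regular_elements br" and e: "e > 0"
    and y: "\<And>t. t \<in> {-e<..<e} \<Longrightarrow> \<exists>g. lie_automorphism br g \<and> y t = g x"
    and y0: "y 0 = x" and dy: "(y has_vector_derivative b) (at 0)"
  shows "b \<in> range (br x)"
proof -
  let ?D = "map_prod (br x) (br x)"
  obtain \<Lambda> N Q where sp: "spectral ?D \<Lambda> N Q"
    and eig: "\<And>l w. l \<in> \<Lambda> \<Longrightarrow> ?D (pop ?D (Q l) w) = cscale l (pop ?D (Q l) w)"
    using regular_diagonalizable[OF x] by blast
  interpret spectral ?D \<Lambda> N Q by (rule sp)
  let ?P = "\<lambda>l. pop ?D (Q l)"
  have PD: "?P l (?D w) = cscale l (?P l w)" if "l \<in> \<Lambda>" for l w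
    using pop_commute[OF clinear_D clinear_D, of "Q l" w] eig[OF that] by simp
  \<comment> \<open>ad x acts as l on the image of the l-th projection, so the product of distinct
    linear factors annihilates it; distinctness makes p' nonzero on \<Lambda>.\<close>
  define p where "p = (\<Prod>m\<in>\<Lambda>. [:-m, 1:])"
  have pl: "pop ?D [:-l, 1:] (?P l w) = 0" if "l \<in> \<Lambda>" for l w
    using eig[OF that] by (simp add: pop_pCons[OF clinear_D] cscale_minus_left clinearD(5)[OF clinear_D])
  have p_split: "p = (\<Prod>m\<in>\<Lambda>-{l}. [:-m, 1:]) * [:-l, 1:]" if "l \<in> \<Lambda>" for l
    unfolding p_def using that finite_\<Lambda> by (simp only: prod.remove mult.commute)
  have "pop ?D p (?P l w) = 0" if "l \<in> \<Lambda>" for l w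
    unfolding p_split[OF that] pop_mult[OF clinear_D] pl[OF that] by (rule clinearD(5)[OF clinear_pop[OF clinear_D]])
  then have "(\<Sum>l\<in>\<Lambda>. pop ?D p (?P l w)) = 0" for w by (intro sum.neutral) blast
  then have pD0: "pop ?D p w = 0" for w
    unfolding clinearD(8)[OF clinear_pop[OF clinear_D], symmetric] sum_proj .
  \<comment> \<open>\<open>br (y t)\<close> is conjugate to \<open>br x\<close> by the automorphism
    g, so the same polynomial annihilates it.\<close>
  have pt0: "pop (map_prod (br (y t)) (br (y t))) p w = 0" if "t \<in> {-e<..<e}" for t w
  proof -
    obtain g where g: "lie_automorphism br g" "y t = g x" using y[OF \<open>t \<in> {-e<..<e}\<close>] by blast
    let ?G = "map_prod g g"
    have G: "clinear ?G" by (rule clinear_map_prod[OF automorphismD(1)[OF g(1)]])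
    have GD: "?G (?D w) = map_prod (br (y t)) (br (y t)) (?G w)" for w
      by (cases w) (simp add: g(2) automorphismD(3)[OF g(1)])
    have "?G (pop ?D p v) = pop (map_prod (br (y t)) (br (y t))) p (?G v)" for v
      by (rule pop_conjugate[OF clinear_D clinear_map_prod[OF linear_ad] G GD])
    then have "pop (map_prod (br (y t)) (br (y t))) p (?G v) = 0" for v
      using pD0 clinearD(5)[OF G] by simp
    moreover have "w = ?G (inv g (fst w), inv g (snd w))"
      using bij_is_surj[OF automorphismD(2)[OF g(1)]] by (simp add: surj_f_inv_f)
    ultimately show ?thesis by metis
  qed
  have pd: "poly (pderiv p) l \<noteq> 0" if "l \<in> \<Lambda>" for l
  proof -
    have "poly (pderiv p) l = poly (\<Prod>m\<in>\<Lambda>-{l}. [:-m, 1:]) l"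
      unfolding p_split[OF that] pderiv_mult by (simp add: pderiv_pCons)
    then show ?thesis using finite_\<Lambda> by (simp add: poly_prod)
  qed
  let ?B = "map_prod (br b) (br b)"
  \<comment> \<open>The derivative of p (ad (y s)) at 0, compressed to the eigenspace of l, is p'(l)
    times the diagonal block of ad b. It vanishes because p (ad (y s)) is zero near 0.\<close>
  have PBP: "?P l (?B (?P l w)) = 0" if l: "l \<in> \<Lambda>" for l w
  proof -
    have "\<exists>d. ((\<lambda>s. pop (map_prod (br (y s)) (br (y s))) p (?P l w)) has_vector_derivative d) (at 0)
      \<and> ?P l d = cscale (poly (pderiv p) l) (?P l (?B (?P l w)))"
      using eig[OF l] PD[OF l] by (intro pop_has_vector_derivative[OF dy]) (simp_all add: y0 clinear_proj)
    then obtain d where d: "((\<lambda>s. pop (map_prod (br (y s)) (br (y s))) p (?P l w)) has_vector_derivative d) (at 0)"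
      "?P l d = cscale (poly (pderiv p) l) (?P l (?B (?P l w)))" by blast
    have "((\<lambda>s. pop (map_prod (br (y s)) (br (y s))) p (?P l w)) has_vector_derivative 0) (at 0)"
    proof (rule has_vector_derivative_transform_within_open[of "\<lambda>s. 0"])
      show "0 \<in> {-e<..<e}" using e by simp
    qed (simp_all add: pt0)
    then have "d = 0" using d(1) vector_derivative_unique_at by blast
    then have "cscale (poly (pderiv p) l) (?P l (?B (?P l w))) = 0"
      using d(2) clinearD(5)[OF clinear_proj] by simp
    then show ?thesis using pd[OF l] by (simp add: cscale_eq_0_iff)
  qed
  obtain h c where b: "b = h + br x c" and h: "h \<in> centralizer br x"
    using regular_decomposition[OF x] by blast
  have xh: "br x h = 0" using h by (simp add: centralizer_def)
  let ?H = "map_prod (br h) (br h)" and ?C = "map_prod (br c) (br c)"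
  \<comment> \<open>ad [x, c] is a commutator with ad x and has zero diagonal blocks, so those of ad
    h vanish. As ad h commutes with ad x, it is block diagonal and hence zero.\<close>
  have Bsplit: "?B w = ?H w + (?D (?C w) - ?C (?D w))" for w
    by (cases w) (simp add: b br_simps ad_br)
  have HD: "?H (?D w) = ?D (?H w)" for w
    using jacobi[of x h] xh by (cases w) (simp add: br_simps)
  have "?H (?P l w) = 0" if l: "l \<in> \<Lambda>" for l w
  proof -
    have "?P l (?D (?C (?P l w)) - ?C (?D (?P l w))) = 0"
      by (simp add: clinearD(4)[OF clinear_proj] PD[OF l] eig[OF l] clinearD(2)[OF clinear_map_prod[OF linear_ad]] clinearD(2)[OF clinear_proj])
    then have "?P l (?H (?P l w)) = 0"
      using PBP[OF l, of w] unfolding Bsplit clinearD(3)[OF clinear_proj] by (simp only: add_0_right)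
    then show ?thesis
      using pop_commute[OF clinear_D clinear_map_prod[OF linear_ad[of h]] HD] proj_proj[OF l l] by simp
  qed
  then have "(\<Sum>l\<in>\<Lambda>. ?H (?P l w)) = 0" for w by (intro sum.neutral) blast
  then have H0: "?H w = 0" for w
    unfolding clinearD(8)[OF clinear_map_prod[OF linear_ad], symmetric] sum_proj .
  have "h = 0"
  proof (rule center_trivial)
    show "br h v = 0" for v using H0[of "(v, 0)"] by (simp add: zero_prod_def)
  qed
  then show ?thesis by (simp add: b)
qed

lemma orbit_tangent_regular:
  assumes x: "x \<in> regular_elements br"
  shows "orbit_tangent br (\<iota> x) = \<iota> ` range (br x)"
proof
  show "\<iota> ` range (br x) \<subseteq> orbit_tangent br (\<iota> x)"
  proof clarify
    fix w
    \<comment> \<open>Composing \<iota> x with exp (t ad w) moves x by the inverse automorphism,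
      hence the sign; the velocity is -[w, x] = [x, w].\<close>
    let ?\<gamma> = "\<lambda>t. \<iota> (flow (br (- w)) t x)"
    have orb: "?\<gamma> t \<in> coadjoint_orbit br (\<iota> x)" for t
    proof -
      let ?g = "endo_exp (br (t *\<^sub>R w)) \<circ> id"
      have g: "?g \<in> adjoint_group br" by (intro adjoint_group.intros)
      have ge: "?g = flow (br w) t" by (simp add: endo_exp_ad)
      have minus: "(\<lambda>v. - br w v) = br (- w)" by (rule ext) (simp add: br_simps)
      have "flow (br (- w)) t (?g y) = y" for y
        unfolding ge using flow_inverse[OF linear_ad, of w t y] unfolding minus .
      moreover have "bij ?g" using automorphismD(2)[OF adjoint_group_automorphism[OF g]] .
      moreover obtain z where z: "x = ?g z" using bij_is_surj[OF \<open>bij ?g\<close>] by (rule surjE)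
      moreover have "inv ?g (?g z) = z" by (rule inv_f_f[OF bij_is_inj[OF \<open>bij ?g\<close>]])
      ultimately have "flow (br (- w)) t x = inv ?g x" by simp
      then have "\<iota> (flow (br (- w)) t x) = \<iota> (inv ?g x)" by (rule arg_cong)
      then show ?thesis unfolding coadjoint_orbit_\<iota> using g by blast
    qed
    have "smooth_on {-1<..<1} ?\<gamma>" by (simp add: smooth_on_def Ck_on_flow)
    moreover have "continuous_map (top_of_set {-1<..<1}) (top_of_set (coadjoint_orbit br (\<iota> x))) ?\<gamma>"
      using orb Ck_on_continuous[OF Ck_on_flow] by (auto simp: continuous_map_in_subtopology)
    moreover have "?\<gamma> 0 = \<iota> x" by (simp add: flow_0[OF linear_ad])
    moreover have "(?\<gamma> has_vector_derivative \<iota> (br x w)) (at 0)"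
      using bounded_linear.has_vector_derivative[OF bounded_linear_\<iota> flow_has_vector_derivative[OF linear_ad, of "- w" x 0]]
        br_anti[of x w] by (simp add: flow_0[OF linear_ad] br_simps)
    ultimately show "\<iota> (br x w) \<in> orbit_tangent br (\<iota> x)"
      unfolding orbit_tangent_def tangent_space_def by (intro CollectI exI[of _ ?\<gamma>] exI[of _ 1]) simp
  qed
  show "orbit_tangent br (\<iota> x) \<subseteq> \<iota> ` range (br x)"
  proof
    fix v assume "v \<in> orbit_tangent br (\<iota> x)"
    then obtain \<gamma> e where \<gamma>: "e > 0"
      "continuous_map (top_of_set {-e<..<e}) (top_of_set (coadjoint_orbit br (\<iota> x))) \<gamma>"
      "\<gamma> 0 = \<iota> x" "(\<gamma> has_vector_derivative v) (at 0)"
      unfolding orbit_tangent_def tangent_space_def by blast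
    have "\<kappa> v \<in> range (br x)"
    proof (rule orbit_curve_velocity[OF x \<gamma>(1)])
      show "\<exists>g. lie_automorphism br g \<and> \<kappa> (\<gamma> t) = g x" if "t \<in> {-e<..<e}" for t
      proof -
        have "\<gamma> t \<in> coadjoint_orbit br (\<iota> x)"
          using \<gamma>(2) that by (auto simp: continuous_map_in_subtopology)
        then obtain g where "g \<in> adjoint_group br" "\<gamma> t = \<iota> (inv g x)" unfolding coadjoint_orbit_\<iota> by blast
        then show ?thesis
          using automorphism_inv[OF adjoint_group_automorphism] by (intro exI[of _ "inv g"]) simp
      qed
      show "\<kappa> (\<gamma> 0) = x" by (simp add: \<gamma>(3))
      show "((\<lambda>t. \<kappa> (\<gamma> t)) has_vector_derivative \<kappa> v) (at 0)"
        by (rule bounded_linear.has_vector_derivative[OF bounded_linear_\<kappa> \<gamma>(4)])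
    qed
    then show "v \<in> \<iota> ` range (br x)" by (rule image_eqI[rotated]) simp
  qed
qed

lemma poisson_characteristic_\<iota>: "poisson_characteristic br (\<iota> x) = \<iota> ` range (br x)"
proof -
  have "lie_poisson br (\<iota> x) u = K (br x u)" for u
    by (rule ext) (simp add: lie_poisson_def K_invariant)
  then show ?thesis by (simp add: poisson_characteristic_def killing_iso_def image_image)
qed

text \<open>[x, g] is orthogonal to C(x) for K, and together they span the algebra; a vector of
  [x, g] orthogonal to [x, g] is thus orthogonal to everything.\<close>

lemma nondegenerate_orbit_tangent:
  assumes x: "x \<in> regular_elements br"
  shows "nondegenerate_on (killing_dual br) (orbit_tangent br (\<iota> x))"
  unfolding nondegenerate_on_def orbit_tangent_regular[OF x]
proof clarify
  fix a assume "\<forall>v\<in>\<iota> ` range (br x). killing_dual br (\<iota> (br x a)) v = 0"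
  then have 0: "K (br x a) (br x c) = 0" for c by (auto simp: killing_dual_\<iota>)
  have "br x a = 0"
  proof (rule killing_nondegenerate)
    fix y
    obtain h c where y: "y = h + br x c" "h \<in> centralizer br x" by (rule regular_decomposition[OF x])
    have "K (br x a) h = - K a (br x h)"
      using K_invariant[of a x h] br_anti[of x a] by (simp add: K_simps)
    then show "K (br x a) y = 0" using y 0 by (simp add: K_simps centralizer_def)
  qed
  then show "\<iota> (br x a) = 0" by (simp add: linear_0[OF linear_\<iota>])
qed

text \<open>K z [x, c] = K [z, x] c vanishes for all c exactly if z commutes with x.\<close>

lemma normal_distribution_regular:
  assumes x: "x \<in> regular_elements br"
  shows "normal_distribution br (\<iota> x) = \<iota> ` centralizer br x"
proof -
  have "(\<forall>c. K z (br x c) = 0) \<longleftrightarrow> z \<in> centralizer br x" for z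
  proof -
    have "(\<forall>c. K (br z x) c = 0) \<longleftrightarrow> br z x = 0"
      using killing_nondegenerate by (auto simp: K_simps)
    moreover have "br z x = 0 \<longleftrightarrow> br x z = 0" using br_anti[of z x] by simp
    ultimately show ?thesis unfolding K_invariant centralizer_def by simp
  qed
  then have "\<mu> \<in> normal_distribution br (\<iota> x) \<longleftrightarrow> \<kappa> \<mu> \<in> centralizer br x" for \<mu>
    unfolding normal_distribution_def orbit_tangent_regular[OF x]
    using killing_dual_\<iota>[of "\<kappa> \<mu>"] by simp
  then show ?thesis unfolding \<iota>_image_eq_vimage by blast
qed

subsection \<open>Constancy of the signature\<close>

lemma dim_\<iota>_image: "dim (\<iota> ` S) = dim S"
  using bij_\<iota> by (intro dim_image_eq[OF linear_\<iota>]) (auto simp: bij_def intro: inj_on_subset)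

text \<open>Q stands for positivity or negativity of the form on a vector. The map \<iota> \<circ> g
  \<circ> \<kappa> carries each competing subspace W to one of the same dimension. Used for an
  automorphism and its inverse, this makes the sets of dimensions in \<open>signature_on\<close>
  coincide.\<close>

lemma signature_dims_subset:
  assumes g: "lie_automorphism br g" and Q: "\<And>u. Q u \<Longrightarrow> Q (\<iota> (g (\<kappa> u)))" and V: "\<And>u. u \<in> V \<Longrightarrow> \<iota> (g (\<kappa> u)) \<in> V'"
  shows "{dim W |W. subspace W \<and> W \<subseteq> V \<and> (\<forall>w\<in>W - {0}. Q w)}
    \<subseteq> {dim W |W. subspace W \<and> W \<subseteq> V' \<and> (\<forall>w\<in>W - {0}. Q w)}"
proof clarify
  fix W assume W: "subspace W" "W \<subseteq> V" "\<forall>w\<in>W - {0}. Q w"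
  define \<Phi> where "\<Phi> u = \<iota> (g (\<kappa> u))" for u
  have l\<Phi>: "linear \<Phi>"
    unfolding \<Phi>_def using linear_compose[OF linear_compose[OF linear_\<kappa> automorphismD(1)[OF g]] linear_\<iota>] by (simp add: o_def)
  have W_eq: "W = \<iota> ` (\<kappa> ` W)" by (simp add: image_image)
  have "dim (\<Phi> ` W) = dim (g ` (\<kappa> ` W))"
    unfolding \<Phi>_def using dim_\<iota>_image[of "g ` (\<kappa> ` W)"] by (simp add: image_image)
  also have "\<dots> = dim (\<kappa> ` W)"
    by (rule dim_image_eq[OF automorphismD(1)[OF g]]) (rule inj_on_subset[OF bij_is_inj[OF automorphismD(2)[OF g]]], simp)
  also have "\<dots> = dim W" using dim_\<iota>_image[of "\<kappa> ` W"] W_eq by simp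
  finally have "dim W = dim (\<Phi> ` W)" ..
  moreover have "subspace (\<Phi> ` W)" by (rule linear_subspace_image[OF l\<Phi> W(1)])
  moreover have "\<Phi> ` W \<subseteq> V'" using W(2) V by (auto simp: \<Phi>_def)
  moreover have "\<forall>w\<in>\<Phi> ` W - {0}. Q w" using W(3) Q linear_0[OF l\<Phi>] by (auto simp: \<Phi>_def)
  ultimately show "\<exists>W'. dim W = dim W' \<and> subspace W' \<and> W' \<subseteq> V' \<and> (\<forall>w\<in>W' - {0}. Q w)" by blast
qed

lemma signature_orbit:
  assumes x: "x \<in> regular_elements br" and \<mu>: "\<mu> \<in> coadjoint_orbit br (\<iota> x)"
  shows "signature_on (killing_dual br) (orbit_tangent br \<mu>) = signature_on (killing_dual br) (orbit_tangent br (\<iota> x))"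
proof -
  obtain g where g: "g \<in> adjoint_group br" "\<mu> = \<iota> (inv g x)" using \<mu> unfolding coadjoint_orbit_\<iota> by blast
  have a: "lie_automorphism br g" by (rule adjoint_group_automorphism[OF g(1)])
  have ai: "lie_automorphism br (inv g)" by (rule automorphism_inv[OF a])
  have gi: "g (inv g y) = y" for y using bij_is_surj[OF automorphismD(2)[OF a]] by (simp add: surj_f_inv_f)
  have x': "inv g x \<in> regular_elements br" by (rule inv_adjoint_regular[OF g(1) x])
  note t = orbit_tangent_regular[OF x] orbit_tangent_regular[OF x', folded g(2)]
  have K: "killing_dual br (\<iota> (h (\<kappa> u))) (\<iota> (h (\<kappa> u))) = killing_dual br u u" if "lie_automorphism br h" for h u
    using killing_dual_\<iota>[of "\<kappa> u" "\<kappa> u"] by (simp add: killing_dual_\<iota> killing_automorphism[OF that])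
  have V: "\<iota> (g (\<kappa> u)) \<in> orbit_tangent br (\<iota> x)" if "u \<in> orbit_tangent br \<mu>" for u
    using that unfolding t by (auto simp: automorphismD(3)[OF a] gi)
  have V': "\<iota> (inv g (\<kappa> u)) \<in> orbit_tangent br \<mu>" if "u \<in> orbit_tangent br (\<iota> x)" for u
    using that unfolding t by (auto simp: automorphismD(3)[OF ai])
  have "{dim W |W. subspace W \<and> W \<subseteq> orbit_tangent br \<mu> \<and> (\<forall>w\<in>W - {0}. Q w)}
      = {dim W |W. subspace W \<and> W \<subseteq> orbit_tangent br (\<iota> x) \<and> (\<forall>w\<in>W - {0}. Q w)}"
    if "\<And>h u. lie_automorphism br h \<Longrightarrow> Q u \<Longrightarrow> Q (\<iota> (h (\<kappa> u)))" for Q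
    by (rule equalityI; rule signature_dims_subset[where Q = Q]) (fact a ai that[OF a] that[OF ai] V V')+
  then show ?thesis unfolding signature_on_def by (simp add: K)
qed

end

section \<open>Smooth maps and charts\<close>

lemma Ck_on_cong:
  assumes "open U" "\<And>x. x \<in> U \<Longrightarrow> f x = g x" "Ck_on k U f"
  shows "Ck_on k U g"
  using assms(2,3)
proof (induction k arbitrary: f g)
  case 0
  then show ?case using continuous_on_cong[of U U f g] by simp
next
  case (Suc k)
  have d: "f differentiable (at x)" if "x \<in> U" for x using Suc.prems(2) that by simp
  have fr: "frechet_derivative f (at x) = frechet_derivative g (at x)" if "x \<in> U" for x
    using frechet_derivative_transform_within_open[OF d[OF that] assms(1) that] Suc.prems(1) by blast
  have "g differentiable (at x)" if x: "x \<in> U" for x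
  proof -
    obtain f' where "(f has_derivative f') (at x)" using d[OF x] unfolding differentiable_def by blast
    then have "(g has_derivative f') (at x)"
      by (rule has_derivative_transform_within_open[OF _ assms(1) x]) (rule Suc.prems(1))
    then show ?thesis unfolding differentiable_def by blast
  qed
  moreover have "Ck_on k U (\<lambda>x. frechet_derivative g (at x) v)" for v
  proof (rule Suc.IH)
    show "Ck_on k U (\<lambda>x. frechet_derivative f (at x) v)" using Suc.prems(2) by simp
  qed (simp only: fr)
  ultimately show ?case by simp
qed

lemma Ck_on_pred: "Ck_on (Suc k) U f \<Longrightarrow> Ck_on k U f"
proof (induction k arbitrary: f)
  case 0
  then show ?case by (auto intro!: continuous_at_imp_continuous_on differentiable_imp_continuous_within)
next
  case (Suc k)
  have "Ck_on k U (\<lambda>x. frechet_derivative f (at x) v)" for v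
    using Suc.prems by (intro Suc.IH) simp
  moreover have "\<forall>x\<in>U. f differentiable (at x)" using Suc.prems by simp
  ultimately show ?case by simp
qed

lemma Ck_on_Suc_I:
  assumes "open U" "\<And>x. x \<in> U \<Longrightarrow> (f has_derivative D x) (at x)" "\<And>v. Ck_on k U (\<lambda>x. D x v)"
  shows "Ck_on (Suc k) U f"
proof -
  have "D x = frechet_derivative f (at x)" if "x \<in> U" for x
    by (rule frechet_derivative_at[OF assms(2)[OF that]])
  then have "Ck_on k U (\<lambda>x. frechet_derivative f (at x) v)" for v
    by (intro Ck_on_cong[OF assms(1) _ assms(3)]) simp
  then show ?thesis using differentiableI[OF assms(2)] by simp
qed

lemma Ck_on_derivative: "Ck_on (Suc k) U f \<Longrightarrow> x \<in> U \<Longrightarrow> (f has_derivative frechet_derivative f (at x)) (at x)"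
  by (simp add: frechet_derivative_works)

lemma Ck_on_const: "open U \<Longrightarrow> Ck_on k U (\<lambda>x. c)"
proof (induction k arbitrary: c)
  case (Suc k)
  show ?case by (rule Ck_on_Suc_I[OF Suc.prems has_derivative_const Suc.IH[OF Suc.prems]])
qed simp

lemma Ck_on_linear:
  assumes L: "bounded_linear L" and "open U" "Ck_on k U f"
  shows "Ck_on k U (\<lambda>x. L (f x))"
  using assms(3)
proof (induction k arbitrary: f)
  case 0
  then show ?case using bounded_linear.continuous_on[OF L] by simp
next
  case (Suc k)
  show ?case
  proof (rule Ck_on_Suc_I[OF assms(2)])
    show "((\<lambda>x. L (f x)) has_derivative (\<lambda>v. L (frechet_derivative f (at x) v))) (at x)" if "x \<in> U" for x
      by (rule bounded_linear.has_derivative[OF L Ck_on_derivative[OF Suc.prems that]])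
    show "Ck_on k U (\<lambda>x. L (frechet_derivative f (at x) v))" for v
      using Suc.prems by (intro Suc.IH) simp
  qed
qed

lemma Ck_on_add:
  assumes "open U" "Ck_on k U f" "Ck_on k U g"
  shows "Ck_on k U (\<lambda>x. f x + g x)"
  using assms(2,3)
proof (induction k arbitrary: f g)
  case 0
  then show ?case by (simp add: continuous_on_add)
next
  case (Suc k)
  show ?case
  proof (rule Ck_on_Suc_I[OF assms(1)])
    show "((\<lambda>x. f x + g x) has_derivative (\<lambda>v. frechet_derivative f (at x) v + frechet_derivative g (at x) v)) (at x)" if "x \<in> U" for x
      using Suc.prems that by (intro has_derivative_add Ck_on_derivative)
    show "Ck_on k U (\<lambda>x. frechet_derivative f (at x) v + frechet_derivative g (at x) v)" for v
      using Suc.prems by (intro Suc.IH) simp_all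
  qed
qed

lemma Ck_on_sum:
  assumes "open U" "\<And>i. i \<in> I \<Longrightarrow> Ck_on k U (f i)"
  shows "Ck_on k U (\<lambda>x. \<Sum>i\<in>I. f i x)"
  using assms(2) by (induction I rule: infinite_finite_induct) (simp_all add: Ck_on_const Ck_on_add assms(1))

lemma Ck_on_bilinear:
  assumes B: "bounded_bilinear B" and "open U" "Ck_on k U f" "Ck_on k U g"
  shows "Ck_on k U (\<lambda>x. B (f x) (g x))"
  using assms(3,4)
proof (induction k arbitrary: f g)
  case 0
  then show ?case using bounded_bilinear.continuous_on[OF B] by simp
next
  case (Suc k)
  show ?case
  proof (rule Ck_on_Suc_I[OF assms(2)])
    show "((\<lambda>x. B (f x) (g x)) has_derivative
        (\<lambda>v. B (f x) (frechet_derivative g (at x) v) + B (frechet_derivative f (at x) v) (g x))) (at x)" if "x \<in> U" for x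
      by (rule bounded_bilinear.FDERIV[OF B Ck_on_derivative[OF Suc.prems(1) that] Ck_on_derivative[OF Suc.prems(2) that]])
    show "Ck_on k U (\<lambda>x. B (f x) (frechet_derivative g (at x) v) + B (frechet_derivative f (at x) v) (g x))" for v
    proof -
      have "Ck_on k U (\<lambda>x. frechet_derivative f (at x) v)" "Ck_on k U (\<lambda>x. frechet_derivative g (at x) v)"
        using Suc.prems by simp_all
      then show ?thesis
        by (intro Ck_on_add[OF assms(2)] Suc.IH Ck_on_pred[OF Suc.prems(1)] Ck_on_pred[OF Suc.prems(2)])
    qed
  qed
qed

lemma Ck_on_id: "open U \<Longrightarrow> Ck_on k U (\<lambda>x. x)"
proof (cases k)
  case (Suc j)
  assume "open U"
  then show ?thesis unfolding Suc by (intro Ck_on_Suc_I[OF _ has_derivative_ident] Ck_on_const)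
qed simp

text \<open>A chain rule for affine lines only: the derivative along the line is again a function
  composed with the same line, so the induction closes.\<close>

lemma Ck_on_line:
  fixes I :: "real set"
  assumes "open I" "\<And>s. s \<in> I \<Longrightarrow> a + s *\<^sub>R b \<in> U" "Ck_on k U f"
  shows "Ck_on k I (\<lambda>s. f (a + s *\<^sub>R b))"
  using assms(3)
proof (induction k arbitrary: f)
  case 0
  have "continuous_on I (\<lambda>s. a + s *\<^sub>R b)" by (intro continuous_intros)
  then show ?case using 0 assms(2) continuous_on_compose2[of U f I "\<lambda>s. a + s *\<^sub>R b"] by auto
next
  case (Suc k)
  show ?case
  proof (rule Ck_on_Suc_I[OF assms(1)])
    show "((\<lambda>s. f (a + s *\<^sub>R b)) has_derivative (\<lambda>v. frechet_derivative f (at (a + s *\<^sub>R b)) (v *\<^sub>R b))) (at s)"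
      if "s \<in> I" for s
    proof (rule has_derivative_compose[where f = "\<lambda>s. a + s *\<^sub>R b" and f' = "\<lambda>v. v *\<^sub>R b" and g = f])
      show "((\<lambda>s. a + s *\<^sub>R b) has_derivative (\<lambda>v. v *\<^sub>R b)) (at s)"
        by (auto intro!: derivative_eq_intros)
    qed (rule Ck_on_derivative[OF Suc.prems assms(2)[OF that]])
    show "Ck_on k I (\<lambda>s. frechet_derivative f (at (a + s *\<^sub>R b)) (v *\<^sub>R b))" for v
      using Suc.prems by (intro Suc.IH) simp
  qed
qed

lemma velocity_in_closed_subspace:
  fixes V :: "'b::real_normed_vector set"
  assumes V: "subspace V" "closed V" and e: "e > 0" "\<And>t. \<bar>t\<bar> < e \<Longrightarrow> \<sigma> t \<in> V"
    and d: "(\<sigma> has_vector_derivative v) (at 0)"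
  shows "v \<in> V"
proof (rule Lim_in_closed_set[OF V(2)])
  let ?q = "\<lambda>h::real. (\<sigma> h - \<sigma> 0) /\<^sub>R h"
  have "(\<lambda>h. norm (\<sigma> (0 + h) - \<sigma> 0 - h *\<^sub>R v) / norm h) \<midarrow>0\<rightarrow> 0"
    using d unfolding has_vector_derivative_def has_derivative_at by blast
  moreover have "\<forall>\<^sub>F h in at 0. norm (\<sigma> (0 + h) - \<sigma> 0 - h *\<^sub>R v) / norm h = norm (?q h - v)"
  proof (rule eventually_at_topological[THEN iffD2], intro exI[of _ UNIV] conjI ballI impI)
    fix h :: real assume "h \<noteq> 0"
    then have "\<sigma> h - \<sigma> 0 - h *\<^sub>R v = h *\<^sub>R (?q h - v)" by (simp add: scaleR_diff_right)
    then show "norm (\<sigma> (0 + h) - \<sigma> 0 - h *\<^sub>R v) / norm h = norm (?q h - v)"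
      using \<open>h \<noteq> 0\<close> by simp
  qed auto
  ultimately have "(\<lambda>h. norm (?q h - v)) \<midarrow>0\<rightarrow> 0" by (rule Lim_transform_eventually)
  then have "(\<lambda>h. ?q h - v) \<midarrow>0\<rightarrow> 0" by (rule tendsto_norm_zero_cancel)
  then show "?q \<midarrow>0\<rightarrow> v" by (rule LIM_zero_cancel)
  show "\<forall>\<^sub>F h in at 0. ?q h \<in> V"
    unfolding eventually_at using e V(1)
    by (intro exI[of _ e]) (auto simp: dist_real_def intro!: subspace_mul subspace_diff)
qed simp

section \<open>Charts of submanifolds and their tangent vectors\<close>

locale flat_chart =
  fixes S W :: "'b::real_normed_vector set" and \<Phi> \<Psi> :: "'b \<Rightarrow> 'b" and V :: "'b set"
  assumes open_W: "open W" and open_image: "open (\<Phi> ` W)"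
    and smooth_\<Phi>: "smooth_on W \<Phi>" and smooth_\<Psi>: "smooth_on (\<Phi> ` W) \<Psi>"
    and \<Psi>_\<Phi>: "\<And>x. x \<in> W \<Longrightarrow> \<Psi> (\<Phi> x) = x"
    and subspace_V: "subspace V" and flat: "\<Phi> ` (S \<inter> W) = \<Phi> ` W \<inter> V"
begin

lemma \<Phi>_derivative: "x \<in> W \<Longrightarrow> (\<Phi> has_derivative frechet_derivative \<Phi> (at x)) (at x)"
  using smooth_\<Phi> Ck_on_derivative unfolding smooth_on_def by blast

lemma \<Psi>_derivative: "z \<in> \<Phi> ` W \<Longrightarrow> (\<Psi> has_derivative frechet_derivative \<Psi> (at z)) (at z)"
  using smooth_\<Psi> Ck_on_derivative unfolding smooth_on_def by blast

lemma \<Psi>_flat: "z \<in> \<Phi> ` W \<inter> V \<Longrightarrow> \<Psi> z \<in> S \<inter> W"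
  unfolding flat[symmetric] using \<Psi>_\<Phi> by auto

lemma continuous_on_\<Phi>: "continuous_on W \<Phi>" and continuous_on_\<Psi>: "continuous_on (\<Phi> ` W) \<Psi>"
proof -
  have "Ck_on 0 W \<Phi>" "Ck_on 0 (\<Phi> ` W) \<Psi>" using smooth_\<Phi> smooth_\<Psi> unfolding smooth_on_def by blast+
  then show "continuous_on W \<Phi>" "continuous_on (\<Phi> ` W) \<Psi>" by simp_all
qed

text \<open>The image under \<Psi> of a segment in V is a curve in S. As S is open in T and carries
  the subspace topology, continuity in the ambient space gives continuity into T.\<close>

lemma chart_velocity:
  assumes T: "openin T S" "subtopology T S = top_of_set S" and z: "z \<in> \<Phi> ` W \<inter> V" and v: "v \<in> V"
  shows "frechet_derivative \<Psi> (at z) v \<in> tangent_space T (\<Psi> z)"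
proof -
  have "open ((\<lambda>s::real. z + s *\<^sub>R v) -` (\<Phi> ` W))"
    by (intro open_vimage open_image continuous_intros)
  moreover have "0 \<in> (\<lambda>s::real. z + s *\<^sub>R v) -` (\<Phi> ` W)" using z by simp
  ultimately obtain e where e: "e > 0" "ball 0 e \<subseteq> (\<lambda>s::real. z + s *\<^sub>R v) -` (\<Phi> ` W)"
    using open_contains_ball by metis
  have line: "z + s *\<^sub>R v \<in> \<Phi> ` W \<inter> V" if "s \<in> {-e<..<e}" for s
  proof -
    have "s \<in> ball 0 e" using that by (auto simp: dist_real_def)
    then show ?thesis using e(2) z v subspace_V by (auto intro: subspace_add subspace_mul)
  qed
  let ?\<gamma> = "\<lambda>s. \<Psi> (z + s *\<^sub>R v)"
  have Ck: "Ck_on k {-e<..<e} ?\<gamma>" for k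
    using smooth_\<Psi> line unfolding smooth_on_def by (intro Ck_on_line[where U = "\<Phi> ` W"]) auto
  have "continuous_on {-e<..<e} ?\<gamma>" using Ck[of 0] by simp
  then have "continuous_map (top_of_set {-e<..<e}) (subtopology T S) ?\<gamma>"
    unfolding T(2) using \<Psi>_flat[OF line] by (auto simp: continuous_map_in_subtopology)
  then have "continuous_map (top_of_set {-e<..<e}) T ?\<gamma>" by (rule continuous_map_into_fulltopology)
  moreover have "(?\<gamma> has_vector_derivative frechet_derivative \<Psi> (at z) v) (at 0)"
  proof -
    have "((\<lambda>s. \<Psi> (z + s *\<^sub>R v)) has_derivative (\<lambda>r. frechet_derivative \<Psi> (at z) (r *\<^sub>R v))) (at 0)"
    proof (rule has_derivative_compose[where f = "\<lambda>s. z + s *\<^sub>R v" and f' = "\<lambda>r. r *\<^sub>R v" and g = \<Psi>])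
      show "((\<lambda>s. z + s *\<^sub>R v) has_derivative (\<lambda>r. r *\<^sub>R v)) (at 0)"
        by (auto intro!: derivative_eq_intros)
      show "(\<Psi> has_derivative frechet_derivative \<Psi> (at z)) (at (z + 0 *\<^sub>R v))"
        using \<Psi>_derivative z by simp
    qed
    moreover have "linear (frechet_derivative \<Psi> (at z))"
      using \<Psi>_derivative z has_derivative_linear by blast
    ultimately show ?thesis unfolding has_vector_derivative_def by (simp add: linear_scale)
  qed
  ultimately show ?thesis
    unfolding tangent_space_def smooth_on_def using e(1) Ck
    by (intro CollectI exI[of _ ?\<gamma>] exI[of _ e]) simp
qed

text \<open>A curve continuous into T stays in the T-open set S \<inter> W for a short time. There
  \<Phi> maps it into the closed subspace V, which then also contains the velocity.\<close>

lemma tangent_subset_chart: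
  assumes T: "openin T S" "subtopology T S = top_of_set S" and V: "closed V" and p: "p \<in> S \<inter> W"
    and \<tau>: "\<tau> \<in> tangent_space T p"
  obtains v where "v \<in> V" "\<tau> = frechet_derivative \<Psi> (at (\<Phi> p)) v"
proof -
  obtain \<gamma> e where \<gamma>: "e > 0" "smooth_on {-e<..<e::real} \<gamma>" "continuous_map (top_of_set {-e<..<e}) T \<gamma>"
    "\<gamma> 0 = p" "(\<gamma> has_vector_derivative \<tau>) (at 0)"
    using \<tau> unfolding tangent_space_def by blast
  have "openin (subtopology T S) (S \<inter> W)" unfolding T(2) using open_W by (rule openin_open_Int)
  then have "openin T (S \<inter> W)" using T(1) openin_trans_full by blast
  from openin_continuous_map_preimage[OF \<gamma>(3) this]
  have "openin (top_of_set {-e<..<e}) {s \<in> {-e<..<e}. \<gamma> s \<in> S \<inter> W}"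
    by (simp only: topspace_euclidean_subtopology)
  then have "open {s \<in> {-e<..<e}. \<gamma> s \<in> S \<inter> W}"
    by (rule openin_open_trans) simp
  moreover have "0 \<in> {s \<in> {-e<..<e}. \<gamma> s \<in> S \<inter> W}" using \<gamma>(1,4) p by simp
  ultimately obtain d where d: "d > 0" "ball 0 d \<subseteq> {s \<in> {-e<..<e}. \<gamma> s \<in> S \<inter> W}"
    by (rule openE)
  have near: "\<gamma> s \<in> S \<inter> W" if "\<bar>s\<bar> < d" for s
    using d(2) that by (auto simp: subset_iff dist_real_def)
  define v where "v = frechet_derivative \<Phi> (at p) \<tau>"
  have "(\<Phi> \<circ> \<gamma> has_vector_derivative v) (at 0)"
    unfolding v_def using \<Phi>_derivative[of p] p \<gamma>(4,5)
    by (intro vector_derivative_diff_chain_within) (auto intro: has_derivative_at_withinI)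
  then have \<sigma>: "((\<lambda>s. \<Phi> (\<gamma> s)) has_vector_derivative v) (at 0)" by (simp add: o_def)
  have "v \<in> V"
    using near flat by (intro velocity_in_closed_subspace[OF subspace_V V d(1) _ \<sigma>]) blast
  moreover have "\<tau> = frechet_derivative \<Psi> (at (\<Phi> p)) v"
  proof -
    have "(\<Psi> \<circ> (\<lambda>s. \<Phi> (\<gamma> s)) has_vector_derivative frechet_derivative \<Psi> (at (\<Phi> p)) v) (at 0)"
      using \<Psi>_derivative[of "\<Phi> p"] p \<gamma>(4) \<sigma>
      by (intro vector_derivative_diff_chain_within) (auto intro: has_derivative_at_withinI)
    then have "(\<gamma> has_vector_derivative frechet_derivative \<Psi> (at (\<Phi> p)) v) (at 0)"
    proof (rule has_vector_derivative_transform_within_open[of _ _ _ "ball 0 d"])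
      show "(\<Psi> \<circ> (\<lambda>s. \<Phi> (\<gamma> s))) s = \<gamma> s" if "s \<in> ball 0 d" for s
        using near[of s] that \<Psi>_\<Phi> by (simp add: dist_real_def)
    qed (use d in auto)
    then show ?thesis using \<gamma>(5) vector_derivative_unique_at by blast
  qed
  ultimately show thesis by (rule that)
qed

end

lemma embedded_chart:
  fixes S :: "'b::real_normed_vector set"
  assumes "embedded_submanifold S" "p \<in> S"
  obtains W \<Phi> \<Psi> V where "flat_chart S W \<Phi> \<Psi> V" "p \<in> W"
proof -
  from bspec[OF assms(1)[unfolded embedded_submanifold_def] assms(2)] show thesis
  proof (elim exE conjE)
    fix W V :: "'b set" and \<Phi> \<Psi> :: "'b \<Rightarrow> 'b"
    assume *: "open W" "p \<in> W" "open (\<Phi> ` W)" "smooth_on W \<Phi>" "smooth_on (\<Phi> ` W) \<Psi>"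
      "\<forall>x\<in>W. \<Psi> (\<Phi> x) = x" "subspace V" "\<Phi> ` (S \<inter> W) = \<Phi> ` W \<inter> V"
    have "flat_chart S W \<Phi> \<Psi> V" by (rule flat_chart.intro) (use * in blast)+
    then show thesis using *(2) by (rule that)
  qed
qed

text \<open>Every point has a T-open neighbourhood carrying the subspace topology, so T is at least
  as fine as the ambient topology and the identity map transfers connectedness.\<close>

lemma immersed_connected:
  assumes "immersed_submanifold T" "connected_space T"
  shows "connected (topspace T)"
proof -
  have "continuous_map T euclidean (\<lambda>x. x)"
    unfolding continuous_map_def
  proof (intro conjI allI impI)
    fix O' :: "'a set" assume "openin euclidean O'"
    then have O': "open O'" by simp
    show "openin T {x \<in> topspace T. x \<in> O'}"
    proof (subst openin_subopen, intro ballI)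
      fix p assume p: "p \<in> {x \<in> topspace T. x \<in> O'}"
      then obtain U where U: "openin T U" "p \<in> U" "subtopology T U = top_of_set U"
        using assms(1) unfolding immersed_submanifold_def by blast
      have "openin (subtopology T U) (U \<inter> O')" unfolding U(3) by (rule openin_open_Int[OF O'])
      then have "openin T (U \<inter> O')" using U(1) openin_trans_full by blast
      then show "\<exists>N. openin T N \<and> p \<in> N \<and> N \<subseteq> {x \<in> topspace T. x \<in> O'}"
        using p U openin_subset[OF U(1)] by (intro exI[of _ "U \<inter> O'"]) auto
    qed
  qed auto
  then have "connectedin euclidean ((\<lambda>x. x) ` topspace T)"
    by (rule connectedin_continuous_map_image) (use assms(2) in \<open>simp add: connectedin_topspace\<close>)
  then show ?thesis by simp
qed

lemma topology_eq_local:
  assumes "topspace T = topspace T'"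
    and "\<And>p. p \<in> topspace T \<Longrightarrow> \<exists>N. p \<in> N \<and> openin T N \<and> openin T' N \<and> subtopology T N = subtopology T' N"
  shows "T = T'"
proof -
  have half: "openin T2 A" if A: "openin T1 A"
    and loc: "\<And>p. p \<in> topspace T1 \<Longrightarrow> \<exists>N. p \<in> N \<and> openin T1 N \<and> openin T2 N \<and> subtopology T1 N = subtopology T2 N"
    for T1 T2 :: "'a topology" and A
  proof (subst openin_subopen, intro ballI)
    fix p assume p: "p \<in> A"
    then obtain N where N: "p \<in> N" "openin T1 N" "openin T2 N" "subtopology T1 N = subtopology T2 N"
      using loc openin_subset[OF A] by blast
    have "openin (subtopology T1 N) (A \<inter> N)" unfolding openin_subtopology using A by blast
    then have "openin T2 (A \<inter> N)" unfolding N(4) using N(3) openin_trans_full by blast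
    then show "\<exists>B. openin T2 B \<and> p \<in> B \<and> B \<subseteq> A" using p N(1) by blast
  qed
  have "openin T A \<longleftrightarrow> openin T' A" for A
  proof
    show "openin T' A" if "openin T A" using half[OF that assms(2)] .
    show "openin T A" if "openin T' A"
    proof (rule half[OF that])
      fix p assume "p \<in> topspace T'"
      then obtain N where "p \<in> N \<and> openin T N \<and> openin T' N \<and> subtopology T N = subtopology T' N"
        using assms by metis
      then show "\<exists>N. p \<in> N \<and> openin T' N \<and> openin T N \<and> subtopology T' N = subtopology T N"
        by (intro exI[of _ N]) simp
    qed
  qed
  then show ?thesis by (simp add: topology_eq)
qed

section \<open>Cartan subalgebras and the normal distribution\<close>

context semisimple_lie
begin

text \<open>Nilpotency holds because C(x) is abelian. It is its own normalizer because [y, x] in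
  C(x) means (ad x)^2 y = 0, and semisimplicity reduces this to [x, y] = 0.\<close>

lemma cartan_centralizer:
  assumes x: "x \<in> regular_elements br"
  shows "cartan_subalgebra br (centralizer br x)"
proof -
  let ?C = "centralizer br x"
  have ab: "br u v = 0" if "u \<in> ?C" "v \<in> ?C" for u v by (rule centralizer_abelian[OF x that])
  have sC: "subspace ?C" by (rule subspace_centralizer)
  have 0: "0 \<in> ?C" by (rule subspace_0[OF sC])
  have "{br u v |u v. u \<in> ?C \<and> v \<in> ?C} \<subseteq> {0}" using ab by auto
  then have "span {br u v |u v. u \<in> ?C \<and> v \<in> ?C} \<subseteq> {0}" by (rule span_minimal[OF _ subspace_single_0])
  then have "bracket_span br ?C ?C = {0}" unfolding bracket_span_def using span_0 by blast
  then have "((\<lambda>J. bracket_span br ?C J) ^^ 1) ?C = {0}" by simp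
  then have "lie_nilpotent br ?C" unfolding lie_nilpotent_def by blast
  moreover have "lie_subalgebra br ?C" using sC ab 0 by (simp add: lie_subalgebra_def)
  moreover have "{y. \<forall>z\<in>?C. br y z \<in> ?C} = ?C"
  proof (intro equalityI subsetI)
    fix y assume "y \<in> {y. \<forall>z\<in>?C. br y z \<in> ?C}"
    then have "br y x \<in> ?C" by (simp add: centralizer_def)
    then have "br x (br x y) = 0" using br_anti[of y x] by (simp add: centralizer_def br_simps)
    then have "br x y = 0"
      using semisimple_endo_kernel(1)[of "br x"] x unfolding regular_elements_def by blast
    then show "y \<in> ?C" by (simp add: centralizer_def)
  next
    fix y assume "y \<in> ?C"
    then show "y \<in> {y. \<forall>z\<in>?C. br y z \<in> ?C}" using ab 0 by simp
  qed
  ultimately show ?thesis unfolding cartan_subalgebra_def by blast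
qed

text \<open>Nilpotency of H puts H into the null component of x, which is C(x). Being abelian, C(x)
  normalizes H, and H is its own normalizer.\<close>

lemma cartan_eq_centralizer:
  assumes H: "cartan_subalgebra br H" and x: "x \<in> H" "x \<in> regular_elements br"
  shows "H = centralizer br x"
proof -
  have sub: "subspace H" using H by (simp add: cartan_subalgebra_def lie_subalgebra_def)
  have norm: "{y. \<forall>z\<in>H. br y z \<in> H} = H" using H by (simp add: cartan_subalgebra_def)
  obtain n where n: "((\<lambda>J. bracket_span br H J) ^^ n) H = {0}"
    using H by (auto simp: cartan_subalgebra_def lie_nilpotent_def)
  have "(br x ^^ k) h \<in> ((\<lambda>J. bracket_span br H J) ^^ k) H" if "h \<in> H" for h k
  proof (induction k)
    case (Suc k)
    then show ?case
      unfolding funpow.simps o_apply bracket_span_def using x(1) by (intro span_base) blast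
  qed (use that in simp)
  then have "(br x ^^ n) h = 0" if "h \<in> H" for h using n that by blast
  then have "H \<subseteq> null_comp x" using null_compI by blast
  then have HC: "H \<subseteq> centralizer br x"
    using fitting_regular_point.centralizer_eq_H[OF fitting_regular_pointI] x(2) unfolding regular_elements_eq by blast
  have "br y z \<in> H" if "y \<in> centralizer br x" "z \<in> H" for y z
    using centralizer_abelian[OF x(2) that(1)] HC that(2) subspace_0[OF sub] by auto
  then have "centralizer br x \<subseteq> {y. \<forall>z\<in>H. br y z \<in> H}" by blast
  then show ?thesis using HC norm by simp
qed

lemma self_in_centralizer: "x \<in> centralizer br x"
  by (simp add: centralizer_def)

lemma centralizer_eq_if_member:
  assumes "x \<in> regular_elements br" "y \<in> regular_elements br" "y \<in> centralizer br x"
  shows "centralizer br y = centralizer br x"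
  using cartan_eq_centralizer[OF cartan_centralizer[OF assms(1)] assms(3,2)] by simp

lemma dim_centralizer_regular:
  assumes "x \<in> regular_elements br" "y \<in> regular_elements br"
  shows "dim (centralizer br x) = dim (centralizer br y)"
  using assms by (simp add: regular_elements_def le_antisym)

text \<open>The derivative is that of an operator inverse, -G^-1 (dG) G^-1, where dG in direction w
  is ad w. It belongs to the notion because both the smoothness of the distribution and the
  constancy along its integral curves are read off from it.\<close>

definition local_frame :: "'a \<Rightarrow> 'a set \<Rightarrow> ('a \<Rightarrow> 'a \<Rightarrow> 'a) \<Rightarrow> bool" where
  "local_frame x0 S R \<longleftrightarrow> open S \<and> x0 \<in> S \<and> S \<subseteq> regular_elements br \<and> (\<forall>x\<in>S. linear (R x))
    \<and> (\<forall>x\<in>S. centralizer br x = R x ` centralizer br x0)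
    \<and> (\<forall>x\<in>S. \<forall>h. ((\<lambda>x. R x h) has_derivative (\<lambda>w. - R x (br w (R x h)))) (at x))"

lemma local_frameD:
  assumes "local_frame x0 S R"
  shows "open S" "x0 \<in> S" "S \<subseteq> regular_elements br" "x \<in> S \<Longrightarrow> linear (R x)"
    "x \<in> S \<Longrightarrow> centralizer br x = R x ` centralizer br x0"
    "x \<in> S \<Longrightarrow> ((\<lambda>x. R x h) has_derivative (\<lambda>w. - R x (br w (R x h)))) (at x)"
  using assms unfolding local_frame_def by blast+

text \<open>With \<open>q\<close> the projection onto \<open>C(x\<^sub>0)\<close> along \<open>[x\<^sub>0, g]\<close>, the operator \<open>ad x + q\<close> is invertible near \<open>x\<^sub>0\<close>,
  and its inverse \<open>R x\<close> maps \<open>C(x\<^sub>0)\<close> onto \<open>C(x)\<close>. By the derivative formula, \<open>R x h\<close> is stationary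
  in directions commuting with \<open>R x h\<close>.\<close>

lemma local_frame_exists:
  assumes x0: "x0 \<in> regular_elements br"
  shows "\<exists>S R. local_frame x0 S R"
proof -
  let ?C = "centralizer br x0" and ?f = "br x0"
  have ss: "?f (?f u) = 0 \<Longrightarrow> ?f u = 0" for u
    using semisimple_endo_kernel(1)[of ?f] x0 unfolding regular_elements_def by blast
  have lff: "linear (\<lambda>v. ?f (?f v))"
    using linear_compose[OF linear_ad[of x0] linear_ad[of x0]] by (simp add: o_def)
  obtain r where r: "linear r" "\<And>v. ?f (?f (r (?f (?f v)))) = ?f (?f v)"
    using linear_pseudo_inverse[OF lff] by blast
  \<comment> \<open>Any v differs from some [x0, w] by an element of C(x0), so ad x0 v lies in the
    range of (ad x0)^2, where r is a right inverse; this gives ad x0 (q v) = 0.\<close>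
  define q where "q v = v - ?f (r (?f v))" for v
  have lq: "linear q"
    unfolding q_def by (rule linearI) (simp_all add: br_simps linear_add[OF r(1)] linear_scale[OF r(1)] algebra_simps)
  have qC: "q v \<in> ?C" for v
  proof -
    obtain h w where v: "v = h + ?f w" "h \<in> ?C" by (rule regular_decomposition[OF x0])
    then have "?f v = ?f (?f w)" by (simp add: br_simps centralizer_def)
    then have "?f (q v) = 0" using r(2)[of w] by (simp add: q_def br_simps)
    then show ?thesis by (simp add: centralizer_def)
  qed
  have qid: "q v = v" if "v \<in> ?C" for v
    using that linear_0[OF r(1)] by (simp add: q_def centralizer_def br_simps)
  define G where "G x v = br x v + q v" for x v
  have lG: "linear (G x)" for x
    unfolding G_def[abs_def] by (rule linear_compose_add[OF linear_ad lq])
  have "v = 0" if "G x0 v = 0" for v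
  proof -
    have "?f (G x0 v) = 0" using that by (simp add: br_simps)
    then have "?f (?f v) = 0" using qC[of v] by (simp add: G_def br_simps centralizer_def)
    then have "?f v = 0" by (rule ss)
    then show ?thesis using that qid[of v] by (simp add: G_def centralizer_def)
  qed
  then have injG: "inj (G x0)" using linear_inj_iff_eq_0[OF lG] by blast
  have lim: "((\<lambda>x. G x b) \<longlongrightarrow> G x0 b) (nhds x0)" for b
    unfolding G_def by (intro tendsto_add tendsto_const tendsto_br) (simp add: filterlim_ident)
  obtain c where c: "c > 0" "\<forall>\<^sub>F x in nhds x0. \<forall>v. c * norm v \<le> norm (G x v)"
    using eventually_bounded_below[OF lG lG injG lim] by blast
  obtain S0 where S0: "open S0" "x0 \<in> S0" "\<And>x v. x \<in> S0 \<Longrightarrow> c * norm v \<le> norm (G x v)"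
    using c(2) unfolding eventually_nhds by blast
  define S where "S = S0 \<inter> regular_elements br"
  define R where "R x = inv (G x)" for x
  have S: "open S" "x0 \<in> S" "S \<subseteq> regular_elements br"
    unfolding S_def using S0(1,2) open_regular x0 by auto
  have below: "c * norm v \<le> norm (G x v)" if "x \<in> S" for x v using S0(3) that by (simp add: S_def)
  have bij: "bij (G x)" if x: "x \<in> S" for x
  proof -
    have "v = 0" if "G x v = 0" for v
      using below[OF x, of v] that c(1) by (simp add: mult_le_0_iff)
    then have "inj (G x)" using linear_inj_iff_eq_0[OF lG] by blast
    then show ?thesis using linear_injective_imp_surjective[OF lG] by (simp add: bij_def)
  qed
  have GR: "G x (R x v) = v" and RG: "R x (G x v) = v" if "x \<in> S" for x v
    using bij[OF that] by (auto simp: R_def bij_def surj_f_inv_f)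
  have lR: "linear (R x)" if x: "x \<in> S" for x
  proof (rule linearI)
    show "R x (a + b) = R x a + R x b" for a b
      using RG[OF x, of "R x a + R x b"] by (simp add: linear_add[OF lG] GR[OF x])
    show "R x (k *\<^sub>R a) = k *\<^sub>R R x a" for k a
      using RG[OF x, of "k *\<^sub>R R x a"] by (simp add: linear_scale[OF lG] GR[OF x])
  qed
  have nR: "norm (R x v) \<le> norm v / c" if "x \<in> S" for x v
    using below[OF that, of "R x v"] c(1) by (simp add: GR[OF that] pos_le_divide_eq mult.commute)
  \<comment> \<open>If [x, y] = 0, then \<open>G x y\<close> = q y lies in C(x0), so C(x) is
    contained in the image; equality follows because centralizers of regular elements have equal
    dimension.\<close>
  have CR: "centralizer br x = R x ` ?C" if x: "x \<in> S" for x
  proof -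
    have "y \<in> R x ` ?C" if "y \<in> centralizer br x" for y
    proof -
      have "G x y = q y" using that by (simp add: G_def centralizer_def)
      then have "y = R x (q y)" using RG[OF x, of y] by simp
      then show ?thesis using qC by blast
    qed
    then have "centralizer br x \<subseteq> R x ` ?C" by blast
    moreover have "dim (R x ` ?C) \<le> dim (centralizer br x)"
      using dim_image_le[OF lR[OF x], of ?C] dim_centralizer_regular[OF x0, of x] x S(3) by auto
    ultimately show ?thesis
      by (intro subspace_dim_equal subspace_centralizer linear_subspace_image[OF lR[OF x]])
  qed
  obtain B where B: "B > 0" "\<And>u v. norm (br u v) \<le> norm u * norm v * B"
    using bounded_bilinear.pos_bounded[OF bilinear_conv_bounded_bilinear[THEN iffD1, OF bilinear]] by blast
  have der: "((\<lambda>x. R x h) has_derivative (\<lambda>w. - R x (br w (R x h)))) (at x)" if x: "x \<in> S" for x h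
    unfolding has_derivative_at
  proof
    let ?y = "R x h" and ?D = "\<lambda>w. - R x (br w (R x h))"
    have "linear ?D"
      by (rule linearI) (simp_all add: br_simps linear_add[OF lR[OF x]] linear_scale[OF lR[OF x]])
    then show "bounded_linear ?D" by (simp add: linear_conv_bounded_linear)
    \<comment> \<open>An exact remainder, quadratic in w; the uniform bound on \<open>R\<close> over
      S then makes it at most a constant times |w|^2.\<close>
    have eq: "R (x + w) h - ?y - ?D w = R (x + w) (br w (R x (br w ?y)))" if xw: "x + w \<in> S" for w
    proof -
      have Gw: "G (x + w) v = G x v + br w v" for v by (simp add: G_def br_simps)
      have "G (x + w) (R (x + w) h - ?y - ?D w) = br w (R x (br w ?y))"
        unfolding linear_diff[OF lG] GR[OF xw] unfolding Gw linear_neg[OF lG]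
        by (simp add: GR[OF x] br_simps)
      then show ?thesis using RG[OF xw] by metis
    qed
    have bound: "norm (norm (R (x + w) h - ?y - ?D w) / norm w) \<le> norm w * (B * norm ?y * B / (c * c))" if xw: "x + w \<in> S" for w
    proof -
      have "norm (R (x + w) h - ?y - ?D w) \<le> norm (br w (R x (br w ?y))) / c"
        unfolding eq[OF xw] by (rule nR[OF xw])
      also have "\<dots> \<le> norm w * norm (R x (br w ?y)) * B / c"
        using B(2) c(1) by (intro divide_right_mono) auto
      also have "\<dots> \<le> norm w * (norm (br w ?y) / c) * B / c"
        using nR[OF x] B(1) c(1) by (intro divide_right_mono mult_right_mono mult_left_mono) auto
      also have "\<dots> \<le> norm w * (norm w * norm ?y * B / c) * B / c"
        using B c(1) by (intro divide_right_mono mult_right_mono mult_left_mono) auto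
      also have "\<dots> = norm w * (norm w * (B * norm ?y * B / (c * c)))" by (simp add: field_simps)
      finally have "norm (R (x + w) h - ?y - ?D w) \<le> norm w * (norm w * (B * norm ?y * B / (c * c)))" .
      then show ?thesis by (cases "w = 0") (simp_all add: pos_divide_le_eq mult.commute)
    qed
    show "(\<lambda>w. norm (R (x + w) h - ?y - ?D w) / norm w) \<midarrow>0\<rightarrow> 0"
    proof (rule Lim_null_comparison)
      have "\<forall>\<^sub>F w in at 0. x + w \<in> S"
      proof -
        have "((\<lambda>w. x + w) \<longlongrightarrow> x + 0) (at 0)" by (intro tendsto_add tendsto_const tendsto_ident_at)
        then show ?thesis using topological_tendstoD[OF _ S(1)] x by fastforce
      qed
      then show "\<forall>\<^sub>F w in at 0. norm (norm (R (x + w) h - ?y - ?D w) / norm w) \<le> norm w * (B * norm ?y * B / (c * c))"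
        by eventually_elim (rule bound)
      have "((\<lambda>w::'a. norm w * (B * norm ?y * B / (c * c))) \<longlongrightarrow> norm (0::'a) * (B * norm ?y * B / (c * c))) (at 0)"
        by (intro tendsto_mult tendsto_norm tendsto_ident_at tendsto_const)
      then show "((\<lambda>w::'a. norm w * (B * norm ?y * B / (c * c))) \<longlongrightarrow> 0) (at 0)" by simp
    qed
  qed
  have "local_frame x0 S R" unfolding local_frame_def using S lR CR der by blast
  then show ?thesis by blast
qed

text \<open>The derivative of the frame is expressed by the frame: in the basis it is a sum of
  products of scalars linear in \<open>R (\<kappa> \<xi>) h\<close> with vectors
  \<open>R (\<kappa> \<xi>) b\<close>. Hence C^k for all h yields C^(k+1).\<close>

lemma Ck_on_frame:
  assumes frame: "local_frame x0 S R"
  shows "Ck_on k (\<iota> ` S) (\<lambda>\<xi>. R (\<kappa> \<xi>) h)"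
proof (induction k arbitrary: h)
  have U: "open (\<iota> ` S)" by (rule open_\<iota>_image[OF local_frameD(1)[OF frame]])
  have derU: "((\<lambda>\<xi>. R (\<kappa> \<xi>) h) has_derivative (\<lambda>w. - R (\<kappa> \<xi>) (br (\<kappa> w) (R (\<kappa> \<xi>) h)))) (at \<xi>)" if "\<xi> \<in> \<iota> ` S" for \<xi> h
  proof -
    have "\<kappa> \<xi> \<in> S" using that by auto
    from has_derivative_compose[OF bounded_linear_imp_has_derivative[OF bounded_linear_\<kappa>] local_frameD(6)[OF frame this]]
    show ?thesis .
  qed
  {
    case 0
    show ?case using has_derivative_continuous[OF derU] by (auto intro!: continuous_at_imp_continuous_on)
  next
    case (Suc k)
    show ?case
    proof (rule Ck_on_Suc_I[OF U derU])
      fix v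
      have "Ck_on k (\<iota> ` S) (\<lambda>\<xi>. - (\<Sum>b\<in>Basis. (br (\<kappa> v) (R (\<kappa> \<xi>) h) \<bullet> b) *\<^sub>R R (\<kappa> \<xi>) b))"
      proof (rule Ck_on_linear[OF bounded_linear_minus[OF bounded_linear_ident] U])
        have "bounded_linear (\<lambda>u. br (\<kappa> v) u \<bullet> b)" for b
          using bounded_linear_compose[OF bounded_linear_inner_left, of "br (\<kappa> v)"] linear_ad by (simp add: linear_conv_bounded_linear)
        then show "Ck_on k (\<iota> ` S) (\<lambda>\<xi>. \<Sum>b\<in>Basis. (br (\<kappa> v) (R (\<kappa> \<xi>) h) \<bullet> b) *\<^sub>R R (\<kappa> \<xi>) b)"
          by (intro Ck_on_sum[OF U] Ck_on_bilinear[OF bounded_bilinear_scaleR U] Suc.IH Ck_on_linear[OF _ U Suc.IH])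
      qed
      moreover have "- (\<Sum>b\<in>Basis. (br (\<kappa> v) (R (\<kappa> \<xi>) h) \<bullet> b) *\<^sub>R R (\<kappa> \<xi>) b) = - R (\<kappa> \<xi>) (br (\<kappa> v) (R (\<kappa> \<xi>) h))"
        if "\<xi> \<in> \<iota> ` S" for \<xi>
      proof -
        have l: "linear (R (\<kappa> \<xi>))" using that local_frameD(4)[OF frame] by auto
        have "R (\<kappa> \<xi>) u = (\<Sum>b\<in>Basis. (u \<bullet> b) *\<^sub>R R (\<kappa> \<xi>) b)" for u
          by (subst euclidean_representation[of u, symmetric]) (simp only: linear_sum[OF l] linear_scale[OF l])
        then show ?thesis by metis
      qed
      ultimately show "Ck_on k (\<iota> ` S) (\<lambda>\<xi>. - R (\<kappa> \<xi>) (br (\<kappa> v) (R (\<kappa> \<xi>) h)))"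
        by (rule_tac Ck_on_cong[OF U])
    qed
  }
qed

abbreviation \<N> :: "('a \<Rightarrow>\<^sub>L real) \<Rightarrow> ('a \<Rightarrow>\<^sub>L real) set" where "\<N> \<equiv> normal_distribution br"

lemma smooth_normal_distribution: "smooth_distribution \<N> (regular_dual br)"
  unfolding smooth_distribution_def regular_dual_eq
proof
  obtain z where z: "z \<in> regular_elements br"
    using fitting_regular_nonempty unfolding regular_elements_eq by blast
  show "\<exists>k. \<forall>p\<in>\<iota> ` regular_elements br. subspace (\<N> p) \<and> dim (\<N> p) = k"
    using dim_centralizer_regular[OF _ z] linear_subspace_image[OF linear_\<iota> subspace_centralizer]
    by (intro exI[of _ "dim (centralizer br z)"]) (auto simp: normal_distribution_regular dim_\<iota>_image)
  show "\<forall>p\<in>\<iota> ` regular_elements br. \<exists>U F. open U \<and> p \<in> U \<and> U \<subseteq> \<iota> ` regular_elements br \<and> finite F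
      \<and> (\<forall>X\<in>F. smooth_on U X) \<and> (\<forall>q\<in>U. \<N> q = span ((\<lambda>X. X q) ` F))"
  proof clarify
    fix x0 assume x0: "x0 \<in> regular_elements br"
    obtain S R where frame: "local_frame x0 S R" using local_frame_exists[OF x0] by blast
    note S = local_frameD(1-3)[OF frame] and R = local_frameD(4-6)[OF frame]
    obtain B where B: "finite B" "B \<subseteq> centralizer br x0" "independent B" "span B = centralizer br x0"
      "card B = dim (centralizer br x0)"
      by (rule basis_subspace_exists[OF subspace_centralizer])
    define F where "F = (\<lambda>h \<xi>. \<iota> (R (\<kappa> \<xi>) h)) ` B"
    have U: "open (\<iota> ` S)" by (rule open_\<iota>_image[OF S(1)])
    have "smooth_on (\<iota> ` S) X" if "X \<in> F" for X
      using that unfolding F_def smooth_on_def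
      by (auto intro!: Ck_on_linear[OF bounded_linear_\<iota> U] Ck_on_frame[OF frame])
    moreover have "\<N> (\<iota> x) = span ((\<lambda>X. X (\<iota> x)) ` F)" if "x \<in> S" for x
    proof -
      have "\<N> (\<iota> x) = \<iota> ` R x ` span B"
        using that S(3) by (simp add: normal_distribution_regular subset_iff R(2)[OF that] B(4))
      also have "\<dots> = span (\<iota> ` R x ` B)"
        by (simp only: linear_span_image[OF R(1)[OF that]] linear_span_image[OF linear_\<iota>])
      finally show ?thesis by (simp add: F_def image_image)
    qed
    ultimately show "\<exists>U F. open U \<and> \<iota> x0 \<in> U \<and> U \<subseteq> \<iota> ` regular_elements br \<and> finite F
      \<and> (\<forall>X\<in>F. smooth_on U X) \<and> (\<forall>q\<in>U. \<N> q = span ((\<lambda>X. X q) ` F))"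
      using U S(2,3) B(1) by (intro exI[of _ "\<iota> ` S"] exI[of _ F]) (auto simp: F_def)
  qed
qed

lemma tangent_regular_part:
  assumes H: "subspace H" and A: "open A" and x: "x \<in> H \<inter> A"
  shows "tangent_space (top_of_set (\<iota> ` (H \<inter> A))) (\<iota> x) = \<iota> ` H"
proof
  let ?S = "\<iota> ` (H \<inter> A)"
  show "tangent_space (top_of_set ?S) (\<iota> x) \<subseteq> \<iota> ` H"
  proof
    fix v assume "v \<in> tangent_space (top_of_set ?S) (\<iota> x)"
    then obtain \<gamma> e where \<gamma>: "e > 0" "continuous_map (top_of_set {-e<..<e}) (top_of_set ?S) \<gamma>"
      "(\<gamma> has_vector_derivative v) (at 0)"
      unfolding tangent_space_def by blast
    have mem: "\<kappa> (\<gamma> t) \<in> H" if "\<bar>t\<bar> < e" for t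
    proof -
      have "t \<in> {-e<..<e}" using that by auto
      then have "\<gamma> t \<in> ?S" using \<gamma>(2) by (auto simp: continuous_map_in_subtopology)
      then show ?thesis by auto
    qed
    have "((\<lambda>t. \<kappa> (\<gamma> t)) has_vector_derivative \<kappa> v) (at 0)"
      by (rule bounded_linear.has_vector_derivative[OF bounded_linear_\<kappa> \<gamma>(3)])
    from velocity_in_closed_subspace[OF H closed_subspace[OF H] \<gamma>(1) mem this]
    have "\<kappa> v \<in> H" .
    then show "v \<in> \<iota> ` H" by (rule image_eqI[rotated]) simp
  qed
  show "\<iota> ` H \<subseteq> tangent_space (top_of_set ?S) (\<iota> x)"
  proof clarify
    fix h assume h: "h \<in> H"
    have "open ((\<lambda>t::real. x + t *\<^sub>R h) -` A)" by (intro open_vimage A continuous_intros)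
    moreover have "0 \<in> (\<lambda>t::real. x + t *\<^sub>R h) -` A" using x by simp
    ultimately obtain e where e: "e > 0" "ball 0 e \<subseteq> (\<lambda>t::real. x + t *\<^sub>R h) -` A" by (rule openE)
    let ?\<gamma> = "\<lambda>t. \<iota> x + t *\<^sub>R \<iota> h"
    have \<gamma>: "?\<gamma> t = \<iota> (x + t *\<^sub>R h)" for t by (simp add: linear_add[OF linear_\<iota>] linear_scale[OF linear_\<iota>])
    have mem: "?\<gamma> t \<in> ?S" if "t \<in> {-e<..<e}" for t
    proof -
      have "t \<in> ball 0 e" using that by (auto simp: dist_real_def)
      then have "x + t *\<^sub>R h \<in> A" using e(2) by blast
      moreover have "x + t *\<^sub>R h \<in> H" using x h H by (simp add: subspace_add subspace_mul)
      ultimately show ?thesis unfolding \<gamma> by blast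
    qed
    have Ck: "Ck_on k {-e<..<e} ?\<gamma>" for k
      by (rule Ck_on_line[where U = UNIV and f = "\<lambda>z. z" and a = "\<iota> x" and b = "\<iota> h"]) (simp_all add: Ck_on_id)
    have "continuous_map (top_of_set {-e<..<e}) (top_of_set ?S) ?\<gamma>"
      using Ck[of 0] mem by (auto simp: continuous_map_in_subtopology)
    moreover have "(?\<gamma> has_vector_derivative \<iota> h) (at 0)"
      unfolding has_vector_derivative_def by (auto intro!: derivative_eq_intros)
    ultimately show "\<iota> h \<in> tangent_space (top_of_set ?S) (\<iota> x)"
      unfolding tangent_space_def smooth_on_def using e(1) Ck
      by (intro CollectI exI[of _ ?\<gamma>] exI[of _ e]) simp
  qed
qed

text \<open>The open set A is kept variable so that the whole Cartan image and each of its
  components are covered.\<close>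

lemma integral_regular_part:
  assumes H: "cartan_subalgebra br H" and A: "open A" "A \<subseteq> regular_elements br"
  shows "integral_submanifold \<N> (regular_dual br) (top_of_set (\<iota> ` (H \<inter> A)))"
proof -
  let ?S = "\<iota> ` (H \<inter> A)"
  have sH: "subspace H" using H by (simp add: cartan_subalgebra_def lie_subalgebra_def)
  have U: "open (\<iota> ` A)" by (rule open_\<iota>_image[OF A(1)])
  have id: "smooth_on (\<iota> ` A) (\<lambda>z. z)" by (simp add: smooth_on_def Ck_on_id[OF U])
  have "?S \<inter> \<iota> ` A = \<iota> ` A \<inter> \<iota> ` H" by auto
  then have "embedded_submanifold ?S"
    unfolding embedded_submanifold_def
    using U id linear_subspace_image[OF linear_\<iota> sH]
    by (intro ballI exI[of _ "\<iota> ` A"] exI[of _ "\<lambda>z. z"] exI[of _ "\<iota> ` H"]) auto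
  then have "immersed_submanifold (top_of_set ?S)"
    unfolding immersed_submanifold_def
    by (intro ballI exI[of _ ?S]) (auto simp: subtopology_subtopology)
  moreover have "?S \<subseteq> regular_dual br" unfolding regular_dual_eq using A(2) by blast
  moreover have "tangent_space (top_of_set ?S) p = \<N> p" if p: "p \<in> ?S" for p
  proof -
    obtain x where x: "p = \<iota> x" "x \<in> H \<inter> A" using p by blast
    then have xr: "x \<in> regular_elements br" using A(2) by blast
    show ?thesis
      unfolding x(1) tangent_regular_part[OF sH A(1) x(2)] normal_distribution_regular[OF xr]
      using cartan_eq_centralizer[OF H _ xr] x(2) by simp
  qed
  ultimately show ?thesis unfolding integral_submanifold_def by simp
qed

lemma cartan_image_eq: "cartan_image br H = \<iota> ` (H \<inter> regular_elements br)"
  by (simp add: cartan_image_def)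

lemma integrable_normal_distribution: "integrable_distribution \<N> (regular_dual br)"
  unfolding integrable_distribution_def
proof (intro conjI smooth_normal_distribution ballI)
  fix p assume "p \<in> regular_dual br"
  then obtain x where x: "p = \<iota> x" "x \<in> regular_elements br" unfolding regular_dual_eq by blast
  let ?T = "top_of_set (\<iota> ` (centralizer br x \<inter> regular_elements br))"
  have "integral_submanifold \<N> (regular_dual br) ?T"
    by (rule integral_regular_part[OF cartan_centralizer[OF x(2)] open_regular order_refl])
  moreover have "p \<in> topspace ?T" using x self_in_centralizer by simp
  ultimately show "\<exists>T. integral_submanifold \<N> (regular_dual br) T \<and> p \<in> topspace T" by blast
qed

lemma closed_subspace_dual:
  fixes V :: "('a \<Rightarrow>\<^sub>L real) set"
  assumes "subspace V" shows "closed V"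
proof -
  have "closed (\<kappa> ` V)" by (rule closed_subspace[OF linear_subspace_image[OF linear_\<kappa> assms]])
  then have "closed (\<kappa> -` (\<kappa> ` V))" by (rule closed_vimage[OF _ continuous_on_\<kappa>])
  moreover have "\<kappa> -` (\<kappa> ` V) = V"
    by (rule inj_vimage_image_eq) (metis injI \<iota>_\<kappa>)
  ultimately show ?thesis by simp
qed

text \<open>Inside a chart two points of an integral submanifold are joined by a smooth curve \<open>\<iota> (y s)\<close> with
  \<open>y' \<in> C(y)\<close>. Along it the frame \<open>R (y s) h\<close>, hence \<open>C(y s)\<close>, is constant.\<close>

lemma integral_submanifold_local:
  assumes T: "integral_submanifold \<N> (regular_dual br) T" and p: "p \<in> topspace T"
  obtains N where "openin T N" "p \<in> N" "N \<subseteq> \<iota> ` centralizer br (\<kappa> p)"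
proof -
  have imm: "immersed_submanifold T" and sub: "topspace T \<subseteq> \<iota> ` regular_elements br"
    and tan: "\<And>p. p \<in> topspace T \<Longrightarrow> tangent_space T p = \<N> p"
    using T unfolding integral_submanifold_def regular_dual_eq by auto
  obtain S where S: "openin T S" "p \<in> S" "subtopology T S = top_of_set S" "embedded_submanifold S"
    using imm p unfolding immersed_submanifold_def by blast
  obtain W \<Phi> \<Psi> V where ch: "flat_chart S W \<Phi> \<Psi> V" and pW: "p \<in> W" by (rule embedded_chart[OF S(4,2)])
  interpret flat_chart S W \<Phi> \<Psi> V by (rule ch)
  define x0 where "x0 = \<kappa> p"
  have x0: "x0 \<in> regular_elements br" using p sub by (auto simp: x0_def)
  obtain A R where frame: "local_frame x0 A R" using local_frame_exists[OF x0] by blast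
  note A = local_frameD(1-3)[OF frame] and R = local_frameD(4-6)[OF frame]
  have "open (\<Phi> ` W \<inter> \<Psi> -` (\<iota> ` A))"
    by (rule continuous_open_preimage[OF continuous_on_\<Psi> open_image open_\<iota>_image[OF A(1)]])
  moreover have "\<Phi> p \<in> \<Phi> ` W \<inter> \<Psi> -` (\<iota> ` A)"
  proof -
    have "p = \<iota> x0" by (simp add: x0_def)
    then show ?thesis using pW \<Psi>_\<Phi>[OF pW] A(2) by auto
  qed
  ultimately obtain e where e: "e > 0" "ball (\<Phi> p) e \<subseteq> \<Phi> ` W \<inter> \<Psi> -` (\<iota> ` A)" by (rule openE)
  \<comment> \<open>Convexity of the ball keeps the segment from \<open>\<Phi> p\<close> to
    \<open>\<Phi> u\<close> inside the chart and over A, where the frame is defined.\<close>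
  define N where "N = S \<inter> (W \<inter> \<Phi> -` ball (\<Phi> p) e)"
  have "open (W \<inter> \<Phi> -` ball (\<Phi> p) e)"
    by (rule continuous_open_preimage[OF continuous_on_\<Phi> open_W open_ball])
  then have "openin (subtopology T S) N" unfolding N_def S(3) by (rule openin_open_Int)
  then have NT: "openin T N" using S(1) openin_trans_full by blast
  have pN: "p \<in> N" using S(2) pW e(1) by (simp add: N_def)
  have "N \<subseteq> \<iota> ` centralizer br x0"
  proof
    fix u assume u: "u \<in> N"
    define b where "b = \<Phi> u - \<Phi> p"
    have "\<Phi> u \<in> \<Phi> ` (S \<inter> W)" "\<Phi> p \<in> \<Phi> ` (S \<inter> W)" using u S(2) pW unfolding N_def by auto
    then have uV: "\<Phi> u \<in> V" "\<Phi> p \<in> V" unfolding flat by auto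
    then have bV: "b \<in> V" unfolding b_def by (rule subspace_diff[OF subspace_V])
    define c where "c s = \<Phi> p + s *\<^sub>R b" for s
    have c01: "c 0 = \<Phi> p" "c 1 = \<Phi> u" by (simp_all add: c_def b_def)
    have cball: "c s \<in> ball (\<Phi> p) e" if "s \<in> {0..1}" for s
    proof -
      have "norm b < e" using u by (simp add: N_def b_def dist_norm norm_minus_commute)
      moreover have "\<bar>s\<bar> * norm b \<le> 1 * norm b" using that by (intro mult_right_mono) auto
      ultimately show ?thesis by (simp add: c_def dist_norm)
    qed
    have cV: "c s \<in> V" for s using uV(2) bV subspace_V by (simp add: c_def subspace_add subspace_mul)
    define y where "y s = \<kappa> (\<Psi> (c s))" for s
    have zc: "c s \<in> \<Phi> ` W \<inter> V" if "s \<in> {0..1}" for s using cball[OF that] e(2) cV by blast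
    have yA: "y s \<in> A" if "s \<in> {0..1}" for s using cball[OF that] e(2) by (auto simp: y_def)
    have dy: "\<exists>d. (y has_vector_derivative d) (at s) \<and> d \<in> centralizer br (y s)" if s: "s \<in> {0..1}" for s
    proof -
      let ?d = "frechet_derivative \<Psi> (at (c s)) b"
      have dc: "(c has_vector_derivative b) (at s)"
        unfolding c_def has_vector_derivative_def by (auto intro!: derivative_eq_intros)
      have d\<Psi>: "(\<Psi> has_derivative frechet_derivative \<Psi> (at (c s))) (at (c s) within c ` UNIV)"
        by (rule has_derivative_at_withinI[OF \<Psi>_derivative]) (use zc[OF s] in blast)
      have "(\<Psi> \<circ> c has_vector_derivative ?d) (at s)"
        by (rule vector_derivative_diff_chain_within[OF dc d\<Psi>])
      then have "((\<lambda>s. \<Psi> (c s)) has_vector_derivative ?d) (at s)" by (simp add: o_def)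
      then have "(y has_vector_derivative \<kappa> ?d) (at s)"
        unfolding y_def by (rule bounded_linear.has_vector_derivative[OF bounded_linear_\<kappa>])
      moreover have "\<kappa> ?d \<in> centralizer br (y s)"
      proof -
        have "?d \<in> tangent_space T (\<Psi> (c s))" by (rule chart_velocity[OF S(1,3) zc[OF s] bV])
        moreover have "\<Psi> (c s) \<in> topspace T" using \<Psi>_flat[OF zc[OF s]] openin_subset[OF S(1)] by blast
        moreover have "\<N> (\<Psi> (c s)) = \<iota> ` centralizer br (y s)"
          using normal_distribution_regular[of "y s"] yA[OF s] A(3) by (auto simp: y_def)
        ultimately have "?d \<in> \<iota> ` centralizer br (y s)" using tan by blast
        then show ?thesis by auto
      qed
      ultimately show ?thesis by blast
    qed
    have const: "R (y 1) h = R (y 0) h" if h: "h \<in> centralizer br x0" for h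
    proof -
      have "((\<lambda>s. R (y s) h) has_vector_derivative 0) (at s within {0..1})" if s: "s \<in> {0..1}" for s
      proof -
        obtain d where d: "(y has_vector_derivative d) (at s)" "d \<in> centralizer br (y s)" using dy[OF s] by blast
        have "((\<lambda>x. R x h) \<circ> y has_vector_derivative - R (y s) (br d (R (y s) h))) (at s)"
          by (rule vector_derivative_diff_chain_within[OF d(1) has_derivative_at_withinI[OF R(3)[OF yA[OF s]]]])
        moreover have "br d (R (y s) h) = 0"
        proof (rule centralizer_abelian[OF _ d(2)])
          show "y s \<in> regular_elements br" using yA[OF s] A(3) by blast
          show "R (y s) h \<in> centralizer br (y s)" using R(2)[OF yA[OF s]] h by blast
        qed
        ultimately have "((\<lambda>s. R (y s) h) has_vector_derivative 0) (at s)"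
          using linear_0[OF R(1)[OF yA[OF s]]] by (simp add: o_def)
        then show ?thesis by (rule has_vector_derivative_at_within)
      qed
      then have "((\<lambda>s. R (y s) h) has_derivative (\<lambda>_. 0)) (at s within {0..1})" if "s \<in> {0..1}" for s
        using that unfolding has_vector_derivative_def by simp
      then show ?thesis
        by (rule has_derivative_zero_unique[OF convex_real_interval(5), where f = "\<lambda>s. R (y s) h"]) simp_all
    qed
    have y01: "y 0 = x0" "y 1 = \<kappa> u"
      using \<Psi>_\<Phi> pW u by (simp_all add: y_def c01 x0_def N_def)
    have "R (y 1) ` centralizer br x0 = R (y 0) ` centralizer br x0" using const by (rule image_cong[OF refl])
    moreover have "R (y 1) ` centralizer br x0 = centralizer br (y 1)"
      "R (y 0) ` centralizer br x0 = centralizer br (y 0)"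
      using R(2)[OF yA, of 1] R(2)[OF yA, of 0] by simp_all
    ultimately have "centralizer br (y 1) = centralizer br (y 0)" by (simp only:)
    then have "\<kappa> u \<in> centralizer br x0" using self_in_centralizer[of "y 1"] y01 by simp
    then show "u \<in> \<iota> ` centralizer br x0" by (rule image_eqI[rotated]) simp
  qed
  then have "N \<subseteq> \<iota> ` centralizer br (\<kappa> p)" unfolding x0_def .
  then show thesis by (rule that[OF NT pN])
qed

text \<open>The centralizer is locally constant on T, so the points where it equals H and those
  where it does not form two disjoint open sets.\<close>

lemma integral_submanifold_in_cartan_image:
  assumes H: "cartan_subalgebra br H" and T: "integral_submanifold \<N> (regular_dual br) T"
    and conn: "connected_space T" and meet: "topspace T \<inter> cartan_image br H \<noteq> {}"
  shows "topspace T \<subseteq> cartan_image br H"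
proof -
  have sub: "\<kappa> p \<in> regular_elements br" if "p \<in> topspace T" for p
    using T that unfolding integral_submanifold_def regular_dual_eq by auto
  \<comment> \<open>The predicate P is arbitrary so that a set and its complement are obtained from
    one statement.\<close>
  have op: "openin T {p \<in> topspace T. P (centralizer br (\<kappa> p))}" for P
  proof (subst openin_subopen, intro ballI)
    fix p assume p: "p \<in> {p \<in> topspace T. P (centralizer br (\<kappa> p))}"
    then have "p \<in> topspace T" by simp
    then obtain N where N: "openin T N" "p \<in> N" "N \<subseteq> \<iota> ` centralizer br (\<kappa> p)"
      by (rule integral_submanifold_local[OF T])
    have "u \<in> {p \<in> topspace T. P (centralizer br (\<kappa> p))}" if u: "u \<in> N" for u
    proof -
      have uT: "u \<in> topspace T" using openin_subset[OF N(1)] u by blast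
      have "\<kappa> u \<in> centralizer br (\<kappa> p)" using N(3) u by auto
      then have "centralizer br (\<kappa> u) = centralizer br (\<kappa> p)"
        using centralizer_eq_if_member sub uT p by blast
      then show ?thesis using p uT by simp
    qed
    then show "\<exists>N. openin T N \<and> p \<in> N \<and> N \<subseteq> {p \<in> topspace T. P (centralizer br (\<kappa> p))}"
      using N(1,2) by blast
  qed
  define E where "E = {p \<in> topspace T. centralizer br (\<kappa> p) = H}"
  define E' where "E' = {p \<in> topspace T. centralizer br (\<kappa> p) \<noteq> H}"
  obtain x where x: "\<iota> x \<in> topspace T" "x \<in> H" "x \<in> regular_elements br"
    using meet unfolding cartan_image_eq by blast
  have "\<iota> x \<in> E" using x(1) cartan_eq_centralizer[OF H x(2,3)] by (simp add: E_def)
  then have "E \<noteq> {}" by blast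
  moreover have "openin T E" "openin T E'"
    unfolding E_def E'_def using op[of "\<lambda>C. C = H"] op[of "\<lambda>C. C \<noteq> H"] by auto
  moreover have "topspace T \<subseteq> E \<union> E'" "E \<inter> E' = {}" unfolding E_def E'_def by auto
  ultimately have "E' = {}" using conn unfolding connected_space_def by blast
  show ?thesis
  proof
    fix p assume p: "p \<in> topspace T"
    have "p \<notin> E'" using \<open>E' = {}\<close> by simp
    then have "centralizer br (\<kappa> p) = H" using p by (simp add: E'_def)
    then have "\<kappa> p \<in> H" using self_in_centralizer[of "\<kappa> p"] by (rule subst)
    then have "\<kappa> p \<in> H \<inter> regular_elements br" using sub[OF p] by (rule IntI)
    then show "p \<in> cartan_image br H" unfolding cartan_image_eq by (rule image_eqI[rotated]) simp
  qed
qed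

subsection \<open>Maximal integral submanifolds\<close>

text \<open>The Cartan image is open in a linear subspace, hence locally connected, so its
  components are open in it and are again cut out by an open set of regular elements.\<close>

lemma component_cartan_image:
  assumes H: "cartan_subalgebra br H" and C: "C \<in> components (cartan_image br H)"
  shows "integral_submanifold \<N> (regular_dual br) (top_of_set C)"
proof -
  have sH: "subspace H" using H by (simp add: cartan_subalgebra_def lie_subalgebra_def)
  have eq: "cartan_image br H = \<iota> ` H \<inter> \<iota> ` regular_elements br" unfolding cartan_image_eq by auto
  have "convex (\<iota> ` H)" by (rule subspace_imp_convex[OF linear_subspace_image[OF linear_\<iota> sH]])
  then have "locally connected (\<iota> ` H)" by (rule convex_imp_locally_connected)
  then have "locally connected (cartan_image br H)"
    unfolding eq by (rule locally_open_subset[OF _ openin_open_Int[OF open_\<iota>_image[OF open_regular]]])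
  then have "openin (top_of_set (cartan_image br H)) C" using C by (rule openin_components_locally_connected)
  then obtain O' where O': "open O'" "C = cartan_image br H \<inter> O'" by (auto simp: openin_open)
  have "C = \<iota> ` (H \<inter> (regular_elements br \<inter> \<iota> -` O'))" unfolding O'(2) cartan_image_eq by auto
  moreover have "open (regular_elements br \<inter> \<iota> -` O')"
    by (intro open_Int open_regular open_vimage[OF O'(1) continuous_on_\<iota>])
  ultimately show ?thesis using integral_regular_part[OF H, of "regular_elements br \<inter> \<iota> -` O'"] by simp
qed

text \<open>A priori T may be finer than the subspace topology. A chart parametrizes a
  T-neighbourhood by an open piece of V, and dim V is at least dim H because the velocities of the
  chart fill the tangent space \<iota> H. Invariance of domain then makes the neighbourhood open in
  \<iota> H.\<close>

lemma integral_topology_eq: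
  assumes H: "cartan_subalgebra br H" and T: "integral_submanifold \<N> (regular_dual br) T"
    and sub: "topspace T \<subseteq> cartan_image br H"
  shows "T = top_of_set (topspace T)"
proof (rule topology_eq_local)
  let ?C = "topspace T"
  have sH: "subspace H" using H by (simp add: cartan_subalgebra_def lie_subalgebra_def)
  fix p assume p: "p \<in> topspace T"
  obtain S where S: "openin T S" "p \<in> S" "subtopology T S = top_of_set S" "embedded_submanifold S"
    using T p unfolding integral_submanifold_def immersed_submanifold_def by blast
  obtain W \<Phi> \<Psi> V where ch: "flat_chart S W \<Phi> \<Psi> V" and pW: "p \<in> W" by (rule embedded_chart[OF S(4,2)])
  interpret flat_chart S W \<Phi> \<Psi> V by (rule ch)
  define N where "N = S \<inter> W"
  have "openin (subtopology T S) N" unfolding N_def S(3) by (rule openin_open_Int[OF open_W])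
  then have NT: "openin T N" using S(1) openin_trans_full by blast
  have topN: "subtopology T N = top_of_set N"
  proof -
    have "subtopology T N = subtopology (subtopology T S) N" by (simp add: subtopology_subtopology N_def Int_assoc[symmetric])
    then show ?thesis unfolding S(3) by (simp add: subtopology_subtopology N_def Int_assoc[symmetric])
  qed
  have NC: "N \<subseteq> ?C" using openin_subset[OF NT] .
  have CH: "?C \<subseteq> \<iota> ` H" using sub unfolding cartan_image_eq by blast
  \<comment> \<open>V lies in the dual space; \<kappa> moves it to the Lie algebra, a Euclidean
    space, where invariance of domain applies.\<close>
  let ?V = "\<kappa> ` V" and ?f = "\<lambda>v. \<kappa> (\<Psi> (\<iota> v))"
  let ?D = "\<kappa> ` (\<Phi> ` W \<inter> V)"
  have sV: "subspace ?V" by (rule linear_subspace_image[OF linear_\<kappa> subspace_V])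
  have "\<iota> v \<in> \<Phi> ` W" if "v \<in> ?D" for v using that by auto
  have D_eq: "?D = ?V \<inter> \<iota> -` (\<Phi> ` W)" by (auto simp: image_iff)
  have opD: "openin (top_of_set ?V) ?D"
    unfolding D_eq by (rule openin_open_Int[OF open_vimage[OF open_image continuous_on_\<iota>]])
  have fD: "?f ` ?D = \<kappa> ` N"
  proof -
    have "\<Psi> ` (\<Phi> ` W \<inter> V) = N" unfolding flat[symmetric] N_def image_image using \<Psi>_\<Phi> by force
    then show ?thesis by (auto simp: image_image)
  qed
  have \<kappa>N: "\<kappa> ` N \<subseteq> H" using NC CH by fastforce
  have contf: "continuous_on ?D ?f"
  proof -
    have "continuous_on ?D (\<lambda>v. \<Psi> (\<iota> v))"
      by (rule continuous_on_compose2[OF continuous_on_\<Psi> continuous_on_\<iota>]) auto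
    then show ?thesis by (rule continuous_on_compose2[OF continuous_on_\<kappa>[of UNIV]]) simp
  qed
  have injf: "inj_on ?f ?D"
  proof (rule inj_onI)
    fix a b assume ab: "a \<in> ?D" "b \<in> ?D" "?f a = ?f b"
    then obtain u v where uv: "u \<in> W" "v \<in> W" "\<iota> a = \<Phi> u" "\<iota> b = \<Phi> v" by auto
    have "\<Psi> (\<iota> a) = \<Psi> (\<iota> b)" using ab(3) by (metis \<iota>_\<kappa>)
    then have "u = v" using uv \<Psi>_\<Phi> by simp
    then have "\<iota> a = \<iota> b" using uv by simp
    then show "a = b" by simp
  qed
  have "dim H \<le> dim ?V"
  proof -
    obtain x where x: "p = \<iota> x" "x \<in> H" "x \<in> regular_elements br"
      using p sub unfolding cartan_image_eq by blast
    have tan: "tangent_space T p = \<iota> ` H"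
      using T p cartan_eq_centralizer[OF H x(2,3)] unfolding integral_submanifold_def x(1)
      by (simp add: normal_distribution_regular[OF x(3)])
    let ?L = "\<lambda>v. \<kappa> (frechet_derivative \<Psi> (at (\<Phi> p)) (\<iota> v))"
    have "linear (frechet_derivative \<Psi> (at (\<Phi> p)))"
      using \<Psi>_derivative pW has_derivative_linear by blast
    then have L: "linear ?L"
      using linear_compose[OF linear_compose[OF linear_\<iota>] linear_\<kappa>] by (simp add: o_def)
    have "h \<in> ?L ` ?V" if "h \<in> H" for h
    proof -
      have "\<iota> h \<in> tangent_space T p" unfolding tan using that by blast
      moreover have "p \<in> S \<inter> W" using S(2) pW by blast
      ultimately obtain v where v: "v \<in> V" "\<iota> h = frechet_derivative \<Psi> (at (\<Phi> p)) v"
        using tangent_subset_chart[OF S(1,3) closed_subspace_dual[OF subspace_V]] by metis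
      then have "h = ?L (\<kappa> v)" by (metis \<iota>_\<kappa> \<kappa>_\<iota>)
      then show ?thesis using v(1) by blast
    qed
    then have "dim H \<le> dim (?L ` ?V)" by (intro dim_subset) blast
    also have "\<dots> \<le> dim ?V" by (rule dim_image_le[OF L])
    finally show ?thesis .
  qed
  then have "openin (top_of_set H) (?f ` ?D)"
    using fD \<kappa>N by (intro invariance_of_domain_subspaces[OF opD sV sH _ contf _ injf]) auto
  then obtain O' where O': "open O'" "\<kappa> ` N = H \<inter> O'" unfolding fD by (auto simp: openin_open)
  have "N = \<iota> ` (\<kappa> ` N)" by (simp add: image_image)
  also have "\<dots> = \<iota> ` H \<inter> \<iota> ` O'" unfolding O'(2) by auto
  finally have "openin (top_of_set (\<iota> ` H)) N" using open_\<iota>_image[OF O'(1)] by (simp add: openin_open_Int)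
  then have "openin (top_of_set ?C) N" using NC CH by (rule openin_subset_trans)
  moreover have "subtopology (top_of_set ?C) N = top_of_set N"
    using NC by (simp add: subtopology_subtopology Int_absorb1)
  moreover have "p \<in> N" using S(2) pW by (simp add: N_def)
  ultimately show "\<exists>N. p \<in> N \<and> openin T N \<and> openin (top_of_set ?C) N \<and> subtopology T N = subtopology (top_of_set ?C) N"
    using NT topN by (intro exI[of _ N]) simp
qed simp

text \<open>A maximal T stays in the Cartan image of a single centralizer and is connected, so it
  lies in a component, which is itself a connected integral submanifold. Conversely, no connected
  integral submanifold containing a component can leave its Cartan image.\<close>

lemma maximal_integral_submanifold_iff:
  "maximal_integral_submanifold \<N> (regular_dual br) T \<longleftrightarrow>
    (\<exists>H. cartan_subalgebra br H \<and> (\<exists>C\<in>components (cartan_image br H). T = top_of_set C))"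
proof
  assume max: "maximal_integral_submanifold \<N> (regular_dual br) T"
  then have T: "integral_submanifold \<N> (regular_dual br) T" "connected_space T" "topspace T \<noteq> {}"
    and Tmax: "\<And>T'. integral_submanifold \<N> (regular_dual br) T' \<Longrightarrow> connected_space T' \<Longrightarrow> topspace T \<subseteq> topspace T'
      \<Longrightarrow> topspace T' = topspace T"
    unfolding maximal_integral_submanifold_def by blast+
  obtain x where x: "\<iota> x \<in> topspace T" "x \<in> regular_elements br"
    using T(1,3) unfolding integral_submanifold_def regular_dual_eq by blast
  let ?H = "centralizer br x"
  have H: "cartan_subalgebra br ?H" by (rule cartan_centralizer[OF x(2)])
  have "\<iota> x \<in> cartan_image br ?H" unfolding cartan_image_eq using x(2) self_in_centralizer by blast
  then have sub: "topspace T \<subseteq> cartan_image br ?H"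
    using x(1) by (intro integral_submanifold_in_cartan_image[OF H T(1,2)]) blast
  have "connected (topspace T)"
    using T(1,2) immersed_connected unfolding integral_submanifold_def by blast
  then obtain C where C: "C \<in> components (cartan_image br ?H)" "topspace T \<subseteq> C"
    using exists_component_superset[OF sub] sub T(3) by blast
  have "connected_space (top_of_set C)"
    using in_components_connected[OF C(1)] by (simp add: connected_space_subtopology)
  then have "C = topspace T"
    using Tmax[OF component_cartan_image[OF H C(1)]] C(2) by simp
  \<comment> \<open>Maximality compares underlying sets only, so the topology is identified
    separately.\<close>
  then have "T = top_of_set C" using integral_topology_eq[OF H T(1) sub] by simp
  then show "\<exists>H. cartan_subalgebra br H \<and> (\<exists>C\<in>components (cartan_image br H). T = top_of_set C)"
    using H C(1) by blast
next
  assume "\<exists>H. cartan_subalgebra br H \<and> (\<exists>C\<in>components (cartan_image br H). T = top_of_set C)"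
  then obtain H C where H: "cartan_subalgebra br H" and C: "C \<in> components (cartan_image br H)" and T: "T = top_of_set C"
    by blast
  have ne: "C \<noteq> {}" by (rule in_components_nonempty[OF C])
  have CH: "C \<subseteq> cartan_image br H" by (rule in_components_subset[OF C])
  have "connected_space (top_of_set C)"
    using in_components_connected[OF C] by (simp add: connected_space_subtopology)
  moreover have "topspace T' = C"
    if T': "integral_submanifold \<N> (regular_dual br) T'" "connected_space T'" "C \<subseteq> topspace T'" for T'
  proof -
    have "topspace T' \<subseteq> cartan_image br H"
      using T'(3) ne CH by (intro integral_submanifold_in_cartan_image[OF H T'(1,2)]) blast
    moreover have "connected (topspace T')"
      using T'(1,2) immersed_connected unfolding integral_submanifold_def by blast
    moreover have "C \<inter> topspace T' \<noteq> {}" using T'(3) ne by blast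
    ultimately have "topspace T' \<subseteq> C" using components_maximal[OF C] by blast
    then show ?thesis using T'(3) by blast
  qed
  ultimately show "maximal_integral_submanifold \<N> (regular_dual br) T"
    unfolding maximal_integral_submanifold_def T
    using component_cartan_image[OF H C] ne by simp
qed

lemma open_regular_dual: "open (regular_dual br)"
  unfolding regular_dual_eq by (rule open_\<iota>_image[OF open_regular])

lemma closure_regular_dual: "closure (regular_dual br) = UNIV"
proof -
  have "\<iota> ` closure (regular_elements br) \<subseteq> closure (\<iota> ` regular_elements br)"
    by (rule image_closure_subset[OF continuous_on_\<iota>]) (auto simp: closure_subset)
  then have "range \<iota> \<subseteq> closure (regular_dual br)" unfolding closure_regular regular_dual_eq .
  moreover have "range \<iota> = UNIV" using bij_\<iota> by (simp add: bij_def)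
  ultimately show ?thesis by blast
qed

end

text \<open>Components appear because a maximal integral submanifold is connected, whereas the
  regular part of a Cartan subalgebra need not be; the last conjunct therefore treats the whole
  Cartan image. Equality with the Poisson characteristic subspace ties the orbits to the symplectic
  leaves.\<close>

theorem proposition2:
  fixes br :: "'a::euclidean_space \<Rightarrow> 'a \<Rightarrow> 'a"
  assumes "semisimple_lie_algebra br"
  shows "open (regular_dual br) \<and> closure (regular_dual br) = UNIV
    \<and> (\<forall>\<xi>\<in>regular_dual br.
          coadjoint_orbit br \<xi> \<subseteq> regular_dual br
          \<and> orbit_tangent br \<xi> = poisson_characteristic br \<xi>
          \<and> nondegenerate_on (killing_dual br) (orbit_tangent br \<xi>)
          \<and> (\<forall>\<mu>\<in>coadjoint_orbit br \<xi>.
                signature_on (killing_dual br) (orbit_tangent br \<mu>)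
                = signature_on (killing_dual br) (orbit_tangent br \<xi>)))
    \<and> integrable_distribution (normal_distribution br) (regular_dual br)
    \<and> (\<forall>T. maximal_integral_submanifold (normal_distribution br) (regular_dual br) T \<longleftrightarrow>
          (\<exists>H. cartan_subalgebra br H \<and> (\<exists>C\<in>components (cartan_image br H). T = top_of_set C)))
    \<and> (\<forall>H. cartan_subalgebra br H \<longrightarrow>
          integral_submanifold (normal_distribution br) (regular_dual br)
            (top_of_set (cartan_image br H))
          \<and> (\<forall>T. integral_submanifold (normal_distribution br) (regular_dual br) T
                \<and> connected_space T \<and> topspace T \<inter> cartan_image br H \<noteq> {}
                \<longrightarrow> topspace T \<subseteq> cartan_image br H))"
proof -
  interpret semisimple_lie br
    using assms by unfold_locales (auto simp: semisimple_lie_algebra_def)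
  have orbit: "coadjoint_orbit br \<xi> \<subseteq> regular_dual br
      \<and> orbit_tangent br \<xi> = poisson_characteristic br \<xi>
      \<and> nondegenerate_on (killing_dual br) (orbit_tangent br \<xi>)
      \<and> (\<forall>\<mu>\<in>coadjoint_orbit br \<xi>. signature_on (killing_dual br) (orbit_tangent br \<mu>)
            = signature_on (killing_dual br) (orbit_tangent br \<xi>))" if \<xi>: "\<xi> \<in> regular_dual br" for \<xi>
  proof -
    obtain x where x: "\<xi> = \<iota> x" "x \<in> regular_elements br" using \<xi> unfolding regular_dual_eq by blast
    show ?thesis
      unfolding x(1) poisson_characteristic_\<iota>
      using coadjoint_orbit_subset[OF x(2)] orbit_tangent_regular[OF x(2)] nondegenerate_orbit_tangent[OF x(2)]
        signature_orbit[OF x(2)]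
      unfolding regular_dual_eq by blast
  qed
  show ?thesis
  proof (intro conjI allI impI ballI)
    show "integral_submanifold \<N> (regular_dual br) (top_of_set (cartan_image br H))"
      if "cartan_subalgebra br H" for H
      unfolding cartan_image_eq by (rule integral_regular_part[OF that open_regular order_refl])
  qed (use orbit open_regular_dual closure_regular_dual integrable_normal_distribution
      maximal_integral_submanifold_iff integral_submanifold_in_cartan_image in blast)+
qed

end
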